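(* Let $S$ be a commutative local ring with involution $*$, and let $V$ be a free $S$-module of rank $2m$ ($m\ge1$) with a nondegenerate skew hermitian form $h:V\times V\to S$ such that $V$ has a symplectic basis. Let $\mathfrak i$ be a proper $*$-invariant ideal of $S$, $\tilde S=S/\mathfrak i$, $\tilde V=V/\mathfrak iV$, with the induced involution on $\tilde S$ and induced skew hermitian form $\tilde h$ on $\tilde V$. If $2\in S^\times$ then the reduction homomorphism $\pi:SU(V)\to SU(\tilde V)$, $X\mapsto\tilde X$, is surjective.
   Context: An involution of a commutative ring is a ring automorphism $*$ with $a^{**}=a$ (possibly trivial). A skew hermitian form $h$ is additive in each variable, $S$-linear in the second variable, and satisfies $h(u,v)^*=-h(v,u)$. A basis $u_1,v_1,\dots,u_m,v_m$ of $V$ is symplectic if $h(u_i,v_i)=1$ for all $i$, $h(u_i,u_j)=h(v_i,v_j)=0$ for all $i,j$, and $h(u_i,v_j)=0$ for $i\ne j$. $U(V)$ is the group of $S$-linear automorphisms of $V$ preserving $h$, and $SU(V)$ its subgroup of elements of determinant $1$; similarly $U(\tilde V)$, $SU(\tilde V)$ for $(\tilde V,\tilde h)$ over $\tilde S$. Here $\tilde h(\tilde u,\tilde v)=h(u,v)+\mathfrak i$, where $\tilde u$ denotes the image of $u\in V$ in $\tilde V$, and $\tilde X$ is defined by $\tilde X\tilde u=\widetilde{Xu}$. *)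

theory Defs
  imports "HOL-Combinatorics.Permutations" "HOL-Algebra.Module" "HOL-Algebra.QuotRing"
    "HOL-Algebra.Generated_Groups" "HOL-Algebra.Bij"
begin

definition local_cring :: "('a, 'c) ring_scheme \<Rightarrow> bool" where
  "local_cring S \<longleftrightarrow> cring S \<and> (\<exists>!M. maximalideal M S)"

definition ring_involution :: "('a, 'c) ring_scheme \<Rightarrow> ('a \<Rightarrow> 'a) \<Rightarrow> bool" where
  "ring_involution S star \<longleftrightarrow>
     star \<in> ring_iso S S \<and> (\<forall>a\<in>carrier S. star (star a) = a)"


section \<open>Free modules of finite rank and determinants\<close>

definition linear_map ::
    "('a, 'c) ring_scheme \<Rightarrow> ('a, 'v, 'd) module_scheme \<Rightarrow> ('a, 'w, 'e) module_scheme
      \<Rightarrow> ('v \<Rightarrow> 'w) \<Rightarrow> bool" where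
  "linear_map S V W f \<longleftrightarrow>
     f \<in> carrier V \<rightarrow> carrier W \<and>
     (\<forall>x\<in>carrier V. \<forall>y\<in>carrier V. f (x \<oplus>\<^bsub>V\<^esub> y) = f x \<oplus>\<^bsub>W\<^esub> f y) \<and>
     (\<forall>a\<in>carrier S. \<forall>x\<in>carrier V. f (a \<odot>\<^bsub>V\<^esub> x) = a \<odot>\<^bsub>W\<^esub> f x)"

definition linear_functional ::
    "('a, 'c) ring_scheme \<Rightarrow> ('a, 'v, 'd) module_scheme \<Rightarrow> ('v \<Rightarrow> 'a) \<Rightarrow> bool" where
  "linear_functional S V f \<longleftrightarrow>
     f \<in> carrier V \<rightarrow> carrier S \<and>
     (\<forall>x\<in>carrier V. \<forall>y\<in>carrier V. f (x \<oplus>\<^bsub>V\<^esub> y) = f x \<oplus>\<^bsub>S\<^esub> f y) \<and>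
     (\<forall>a\<in>carrier S. \<forall>x\<in>carrier V. f (a \<odot>\<^bsub>V\<^esub> x) = a \<otimes>\<^bsub>S\<^esub> f x)"

definition module_basis ::
    "('a, 'c) ring_scheme \<Rightarrow> ('a, 'v, 'd) module_scheme \<Rightarrow> nat \<Rightarrow> (nat \<Rightarrow> 'v) \<Rightarrow> bool" where
  "module_basis S V n b \<longleftrightarrow>
     b \<in> {..<n} \<rightarrow> carrier V \<and>
     (\<forall>x\<in>carrier V. \<exists>!c. c \<in> {..<n} \<rightarrow>\<^sub>E carrier S \<and>
        x = (\<Oplus>\<^bsub>V\<^esub>i\<in>{..<n}. c i \<odot>\<^bsub>V\<^esub> b i))"

definition free_of_rank ::
    "('a, 'c) ring_scheme \<Rightarrow> ('a, 'v, 'd) module_scheme \<Rightarrow> nat \<Rightarrow> bool" where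
  "free_of_rank S V n \<longleftrightarrow> module S V \<and> (\<exists>b. module_basis S V n b)"

definition coords ::
    "('a, 'c) ring_scheme \<Rightarrow> ('a, 'v, 'd) module_scheme \<Rightarrow> nat \<Rightarrow> (nat \<Rightarrow> 'v)
      \<Rightarrow> 'v \<Rightarrow> nat \<Rightarrow> 'a" where
  "coords S V n b x = (THE c. c \<in> {..<n} \<rightarrow>\<^sub>E carrier S \<and>
     x = (\<Oplus>\<^bsub>V\<^esub>i\<in>{..<n}. c i \<odot>\<^bsub>V\<^esub> b i))"

definition leibniz_det :: "('a, 'c) ring_scheme \<Rightarrow> nat \<Rightarrow> (nat \<Rightarrow> nat \<Rightarrow> 'a) \<Rightarrow> 'a" where
  "leibniz_det S n A =
     (\<Oplus>\<^bsub>S\<^esub>p\<in>{p. p permutes {..<n}}. add_pow S (sign p) (\<Otimes>\<^bsub>S\<^esub>i\<in>{..<n}. A i (p i)))"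

text \<open>The determinant of an endomorphism of a free module of rank \<open>n\<close>: the common value of the
  determinants of its matrices with respect to the bases with \<open>n\<close> elements (the columns of the
  matrix are the coordinates of the images of the basis vectors).\<close>

definition endo_det ::
    "('a, 'c) ring_scheme \<Rightarrow> ('a, 'v, 'd) module_scheme \<Rightarrow> nat \<Rightarrow> ('v \<Rightarrow> 'v) \<Rightarrow> 'a" where
  "endo_det S V n X = (THE d. \<exists>b. module_basis S V n b \<and>
     d = leibniz_det S n (\<lambda>i j. coords S V n b (X (b j)) i))"


section \<open>Skew hermitian forms and their unitary groups\<close>

definition skew_hermitian_form ::
    "('a, 'c) ring_scheme \<Rightarrow> ('a \<Rightarrow> 'a) \<Rightarrow> ('a, 'v, 'd) module_scheme
      \<Rightarrow> ('v \<Rightarrow> 'v \<Rightarrow> 'a) \<Rightarrow> bool" where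
  "skew_hermitian_form S star V h \<longleftrightarrow>
     (\<forall>u\<in>carrier V. linear_functional S V (h u)) \<and>
     (\<forall>u\<in>carrier V. \<forall>u'\<in>carrier V. \<forall>v\<in>carrier V.
        h (u \<oplus>\<^bsub>V\<^esub> u') v = h u v \<oplus>\<^bsub>S\<^esub> h u' v) \<and>
     (\<forall>u\<in>carrier V. \<forall>v\<in>carrier V. star (h u v) = \<ominus>\<^bsub>S\<^esub> h v u)"

text \<open>Nondegenerate: \<open>u \<mapsto> h u\<close> is a bijection from \<open>V\<close> onto its dual module.\<close>

definition nondegenerate_form ::
    "('a, 'c) ring_scheme \<Rightarrow> ('a, 'v, 'd) module_scheme \<Rightarrow> ('v \<Rightarrow> 'v \<Rightarrow> 'a) \<Rightarrow> bool" where
  "nondegenerate_form S V h \<longleftrightarrow>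
     (\<forall>f. linear_functional S V f \<longrightarrow>
        (\<exists>!u. u \<in> carrier V \<and> (\<forall>v\<in>carrier V. h u v = f v)))"

text \<open>A symplectic basis \<open>u\<^sub>1, v\<^sub>1, \<dots>, u\<^sub>m, v\<^sub>m\<close> is given as one sequence \<open>b\<close>, with
  \<open>b (2 * i)\<close> and \<open>b (2 * i + 1)\<close>, for \<open>i < m\<close>, being the \<open>u\<close>'s and the \<open>v\<close>'s.\<close>

definition symplectic_basis ::
    "('a, 'c) ring_scheme \<Rightarrow> ('a, 'v, 'd) module_scheme \<Rightarrow> ('v \<Rightarrow> 'v \<Rightarrow> 'a)
      \<Rightarrow> nat \<Rightarrow> (nat \<Rightarrow> 'v) \<Rightarrow> bool" where
  "symplectic_basis S V h m b \<longleftrightarrow>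
     module_basis S V (2 * m) b \<and>
     (\<forall>i<m. h (b (2 * i)) (b (2 * i + 1)) = \<one>\<^bsub>S\<^esub>) \<and>
     (\<forall>i<m. \<forall>j<m. h (b (2 * i)) (b (2 * j)) = \<zero>\<^bsub>S\<^esub> \<and>
        h (b (2 * i + 1)) (b (2 * j + 1)) = \<zero>\<^bsub>S\<^esub>) \<and>
     (\<forall>i<m. \<forall>j<m. i \<noteq> j \<longrightarrow> h (b (2 * i)) (b (2 * j + 1)) = \<zero>\<^bsub>S\<^esub>)"

text \<open>As in \<^const>\<open>BijGroup\<close>, automorphisms are extensional functions on the carrier of \<open>V\<close>,
  so that equality in the groups below is equality of maps on \<open>V\<close>.\<close>

definition unitary_group ::
    "('a, 'c) ring_scheme \<Rightarrow> ('a, 'v, 'd) module_scheme \<Rightarrow> ('v \<Rightarrow> 'v \<Rightarrow> 'a)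
      \<Rightarrow> ('v \<Rightarrow> 'v) monoid" where
  "unitary_group S V h = BijGroup (carrier V)
     \<lparr>carrier := {X \<in> Bij (carrier V). linear_map S V V X \<and>
        (\<forall>u\<in>carrier V. \<forall>v\<in>carrier V. h (X u) (X v) = h u v)}\<rparr>"

text \<open>Here \<open>n\<close> is the rank of \<open>V\<close>.\<close>

definition special_unitary_group ::
    "('a, 'c) ring_scheme \<Rightarrow> ('a, 'v, 'd) module_scheme \<Rightarrow> nat \<Rightarrow> ('v \<Rightarrow> 'v \<Rightarrow> 'a)
      \<Rightarrow> ('v \<Rightarrow> 'v) monoid" where
  "special_unitary_group S V n h = (unitary_group S V h)
     \<lparr>carrier := {X \<in> carrier (unitary_group S V h). endo_det S V n X = \<one>\<^bsub>S\<^esub>}\<rparr>"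


section \<open>Reduction modulo an ideal\<close>

definition ideal_smult ::
    "'a set \<Rightarrow> ('a, 'v, 'd) module_scheme \<Rightarrow> 'v set" where
  "ideal_smult I V = generate (add_monoid V) {a \<odot>\<^bsub>V\<^esub> v |a v. a \<in> I \<and> v \<in> carrier V}"

text \<open>The module \<open>V / I V\<close> over \<open>S Quot I\<close>.  As with \<^const>\<open>rcoset_mult\<close> in the quotient ring, the
  operations induced on cosets are written as unions over all representatives; each such union
  consists of a single coset, see \<open>quot_involution_coset\<close>, \<open>quot_module_smult_coset\<close>,
  \<open>quot_form_coset\<close> and \<open>reduction_coset\<close> below.  The ring multiplication and
  unit, which every module record contains, play no role.\<close>

definition quot_module ::
    "('a, 'v, 'd) module_scheme \<Rightarrow> 'a set \<Rightarrow> ('a set, 'v set) module" where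
  "quot_module V I =
     \<lparr>carrier = a_rcosets\<^bsub>V\<^esub> (ideal_smult I V), mult = undefined, one = undefined,
      zero = ideal_smult I V, add = set_add V,
      smult = \<lambda>A U. \<Union>a\<in>A. \<Union>u\<in>U. ideal_smult I V +>\<^bsub>V\<^esub> (a \<odot>\<^bsub>V\<^esub> u)\<rparr>"

definition quot_involution ::
    "('a, 'c) ring_scheme \<Rightarrow> 'a set \<Rightarrow> ('a \<Rightarrow> 'a) \<Rightarrow> 'a set \<Rightarrow> 'a set" where
  "quot_involution S I star A = (\<Union>a\<in>A. I +>\<^bsub>S\<^esub> star a)"

definition quot_form ::
    "('a, 'c) ring_scheme \<Rightarrow> 'a set \<Rightarrow> ('v \<Rightarrow> 'v \<Rightarrow> 'a) \<Rightarrow> 'v set \<Rightarrow> 'v set \<Rightarrow> 'a set" where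
  "quot_form S I h U W = (\<Union>u\<in>U. \<Union>w\<in>W. I +>\<^bsub>S\<^esub> h u w)"

definition reduction ::
    "('a, 'v, 'd) module_scheme \<Rightarrow> 'a set \<Rightarrow> ('v \<Rightarrow> 'v) \<Rightarrow> 'v set \<Rightarrow> 'v set" where
  "reduction V I X = (\<lambda>U\<in>carrier (quot_module V I). \<Union>u\<in>U. ideal_smult I V +>\<^bsub>V\<^esub> X u)"


text \<open>The induced operations are well defined, and the form induced on \<open>V / I V\<close> is skew hermitian
  with respect to the involution induced on \<open>S Quot I\<close>.\<close>

lemma ideal_smult_submodule:
  assumes "module S V" "ideal I S"
  shows "submodule (ideal_smult I V) S V"
proof -
  interpret module S V by fact
  interpret I: ideal I S by fact
  let ?P = "{a \<odot>\<^bsub>V\<^esub> v |a v. a \<in> I \<and> v \<in> carrier V}"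
  have P: "?P \<subseteq> carrier (add_monoid V)"
    using I.Icarr by auto
  have G: "group (add_monoid V)" by (rule M.a_group)
  have sub: "subgroup (ideal_smult I V) (add_monoid V)"
    unfolding ideal_smult_def by (rule group.generate_is_subgroup[OF G P])
  have "a \<odot>\<^bsub>V\<^esub> x \<in> generate (add_monoid V) ?P"
    if a: "a \<in> carrier S" and x: "x \<in> generate (add_monoid V) ?P" for a x
    using x
  proof induction
    case one
    show ?case using a generate.one[of "add_monoid V" ?P] by simp
  next
    case (incl y)
    then obtain b v where "y = b \<odot>\<^bsub>V\<^esub> v" "b \<in> I" "v \<in> carrier V" by blast
    then have "a \<odot>\<^bsub>V\<^esub> y = (a \<otimes>\<^bsub>S\<^esub> b) \<odot>\<^bsub>V\<^esub> v" "a \<otimes>\<^bsub>S\<^esub> b \<in> I"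
      using a I.Icarr I.I_l_closed by (auto simp: smult_assoc1)
    then show ?case using \<open>v \<in> carrier V\<close> by (blast intro: generate.incl)
  next
    case (inv y)
    then obtain b v where bv: "y = b \<odot>\<^bsub>V\<^esub> v" "b \<in> I" "v \<in> carrier V" by blast
    have "a \<odot>\<^bsub>V\<^esub> (\<ominus>\<^bsub>V\<^esub> y) = \<ominus>\<^bsub>V\<^esub> ((a \<otimes>\<^bsub>S\<^esub> b) \<odot>\<^bsub>V\<^esub> v)" "a \<otimes>\<^bsub>S\<^esub> b \<in> I"
      using a bv I.Icarr I.I_l_closed by (auto simp: smult_assoc1 smult_r_minus)
    then show ?case using bv generate.inv[of "(a \<otimes>\<^bsub>S\<^esub> b) \<odot>\<^bsub>V\<^esub> v" ?P "add_monoid V"]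
      by (auto simp: a_inv_def)
  next
    case (eng y z)
    have "y \<in> carrier V" "z \<in> carrier V"
      using eng.hyps group.generate_incl[OF G P] by auto
    then show ?case
      using a eng.IH generate.eng[of _ "add_monoid V" ?P] by (simp add: smult_r_distr)
  qed
  then show ?thesis
    using sub by (auto simp: ideal_smult_def submodule_def submodule_axioms_def)
qed

lemma ideal_smult_abelian_subgroup:
  assumes "module S V" "ideal I S"
  shows "abelian_subgroup (ideal_smult I V) V"
proof -
  interpret module S V by fact
  show ?thesis
    using ideal_smult_submodule[OF assms]
    by (intro abelian_subgroupI3 additive_subgroup.intro)
       (auto simp: submodule_def M.abelian_group_axioms)
qed

lemma coset_elem:
  assumes "abelian_subgroup H V" "x \<in> carrier V" "y \<in> H +>\<^bsub>V\<^esub> x"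
  obtains k where "k \<in> H" "y = k \<oplus>\<^bsub>V\<^esub> x" "k \<in> carrier V"
proof -
  interpret abelian_subgroup H V by fact
  from assms(3) obtain k where "k \<in> H" "y = k \<oplus>\<^bsub>V\<^esub> x"
    unfolding a_r_coset_def' by blast
  then show thesis using that a_Hcarr by blast
qed

lemma UN_UN_Times: "(\<Union>a\<in>A. \<Union>b\<in>B. f a b) = (\<Union>p\<in>A \<times> B. f (fst p) (snd p))"
  by force

lemma coset_union_eq:
  assumes "abelian_subgroup H V" "A \<noteq> {}"
    and "\<And>a. a \<in> A \<Longrightarrow> \<exists>k\<in>H. f a = k \<oplus>\<^bsub>V\<^esub> c" and "c \<in> carrier V"
  shows "(\<Union>a\<in>A. H +>\<^bsub>V\<^esub> f a) = H +>\<^bsub>V\<^esub> c"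
proof -
  interpret abelian_subgroup H V by fact
  have "H +>\<^bsub>V\<^esub> f a = H +>\<^bsub>V\<^esub> c" if "a \<in> A" for a
  proof -
    have "f a \<in> H +>\<^bsub>V\<^esub> c" using assms(3)[OF that] by (auto simp: a_r_coset_def')
    then show ?thesis using a_repr_independence[OF _ assms(4) a_subgroup] by blast
  qed
  then show ?thesis using assms(2) by auto
qed

lemma quot_involution_coset:
  assumes "ring_involution S star" "ideal I S" "star ` I \<subseteq> I" "a \<in> carrier S"
  shows "quot_involution S I star (I +>\<^bsub>S\<^esub> a) = I +>\<^bsub>S\<^esub> star a"
proof -
  interpret I: ideal I S by fact
  have st: "star \<in> ring_hom S S"
    using assms(1) by (simp add: ring_involution_def ring_iso_def)
  have sub: "abelian_subgroup I S" by (rule I.abelian_subgroup_axioms)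
  show ?thesis
    unfolding quot_involution_def
  proof (rule coset_union_eq[OF sub])
    show "I +>\<^bsub>S\<^esub> a \<noteq> {}" using I.a_rcos_self[OF assms(4)] by blast
    show "star a \<in> carrier S" using st assms(4) by (rule ring_hom_closed)
    fix x assume "x \<in> I +>\<^bsub>S\<^esub> a"
    then obtain k where "k \<in> I" "x = k \<oplus>\<^bsub>S\<^esub> a" "k \<in> carrier S"
      using coset_elem[OF sub assms(4)] by blast
    then show "\<exists>k\<in>I. star x = k \<oplus>\<^bsub>S\<^esub> star a"
      using assms(3,4) ring_hom_add[OF st] by blast
  qed
qed

lemma quot_module_smult_coset:
  assumes "module S V" "ideal I S" "a \<in> carrier S" "v \<in> carrier V"
  shows "(I +>\<^bsub>S\<^esub> a) \<odot>\<^bsub>quot_module V I\<^esub> (ideal_smult I V +>\<^bsub>V\<^esub> v)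
           = ideal_smult I V +>\<^bsub>V\<^esub> (a \<odot>\<^bsub>V\<^esub> v)"
proof -
  interpret module S V by fact
  interpret I: ideal I S by fact
  interpret N: abelian_subgroup "ideal_smult I V" V
    by (rule ideal_smult_abelian_subgroup[OF assms(1,2)])
  interpret N': submodule "ideal_smult I V" S V
    by (rule ideal_smult_submodule[OF assms(1,2)])
  let ?N = "ideal_smult I V"
  have sub: "abelian_subgroup I S" by (rule I.abelian_subgroup_axioms)
  have "(\<Union>p\<in>(I +>\<^bsub>S\<^esub> a) \<times> (?N +>\<^bsub>V\<^esub> v). ?N +>\<^bsub>V\<^esub> (fst p \<odot>\<^bsub>V\<^esub> snd p)) = ?N +>\<^bsub>V\<^esub> (a \<odot>\<^bsub>V\<^esub> v)"
  proof (rule coset_union_eq[OF N.abelian_subgroup_axioms])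
    show "(I +>\<^bsub>S\<^esub> a) \<times> (?N +>\<^bsub>V\<^esub> v) \<noteq> {}"
      using I.a_rcos_self[OF assms(3)] N.a_rcos_self[OF assms(4)] by blast
    show "a \<odot>\<^bsub>V\<^esub> v \<in> carrier V" using assms by simp
    fix p assume "p \<in> (I +>\<^bsub>S\<^esub> a) \<times> (?N +>\<^bsub>V\<^esub> v)"
    then obtain x y where p: "p = (x, y)" "x \<in> I +>\<^bsub>S\<^esub> a" "y \<in> ?N +>\<^bsub>V\<^esub> v" by blast
    obtain k where k: "k \<in> I" "x = k \<oplus>\<^bsub>S\<^esub> a" "k \<in> carrier S"
      using coset_elem[OF sub assms(3) p(2)] by blast
    obtain l where l: "l \<in> ?N" "y = l \<oplus>\<^bsub>V\<^esub> v" "l \<in> carrier V"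
      using coset_elem[OF N.abelian_subgroup_axioms assms(4) p(3)] by blast
    have y: "y \<in> carrier V" using l assms(4) by simp
    have "x \<odot>\<^bsub>V\<^esub> y = (k \<odot>\<^bsub>V\<^esub> y \<oplus>\<^bsub>V\<^esub> a \<odot>\<^bsub>V\<^esub> l) \<oplus>\<^bsub>V\<^esub> a \<odot>\<^bsub>V\<^esub> v"
      using k l y assms(3,4) by (simp add: smult_l_distr smult_r_distr M.a_ac)
    moreover have "k \<odot>\<^bsub>V\<^esub> y \<in> ?N"
      using k y unfolding ideal_smult_def by (blast intro: generate.incl)
    moreover have "a \<odot>\<^bsub>V\<^esub> l \<in> ?N" using l assms(3) by simp
    ultimately show "\<exists>k\<in>?N. fst p \<odot>\<^bsub>V\<^esub> snd p = k \<oplus>\<^bsub>V\<^esub> a \<odot>\<^bsub>V\<^esub> v"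
      using p N.a_closed by auto
  qed
  then show ?thesis by (simp add: quot_module_def UN_UN_Times)
qed


lemma submodule_ideal_smult_subset:
  assumes "module S V" "ideal I S" "submodule N S V"
    and "\<And>a v. a \<in> I \<Longrightarrow> v \<in> carrier V \<Longrightarrow> a \<odot>\<^bsub>V\<^esub> v \<in> N"
  shows "ideal_smult I V \<subseteq> N"
proof -
  interpret module S V by fact
  show ?thesis unfolding ideal_smult_def
    using assms(3,4) by (intro group.generate_subgroup_incl[OF M.a_group]) (auto simp: submodule_def)
qed

lemma linear_functional_ideal_smult:
  assumes "module S V" "ideal I S" "linear_functional S V f" "x \<in> ideal_smult I V"
  shows "f x \<in> I"
proof -
  interpret module S V by fact
  interpret I: ideal I S by fact
  have f: "f x \<in> carrier S" if "x \<in> carrier V" for x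
    using assms(3) that by (auto simp: linear_functional_def)
  have fadd: "f (x \<oplus>\<^bsub>V\<^esub> y) = f x \<oplus>\<^bsub>S\<^esub> f y" if "x \<in> carrier V" "y \<in> carrier V" for x y
    using assms(3) that by (auto simp: linear_functional_def)
  have fsmult: "f (a \<odot>\<^bsub>V\<^esub> x) = a \<otimes>\<^bsub>S\<^esub> f x" if "a \<in> carrier S" "x \<in> carrier V" for a x
    using assms(3) that by (auto simp: linear_functional_def)
  have f0: "f \<zero>\<^bsub>V\<^esub> = \<zero>\<^bsub>S\<^esub>"
    using fsmult[of "\<zero>\<^bsub>S\<^esub>" "\<zero>\<^bsub>V\<^esub>"] f[of "\<zero>\<^bsub>V\<^esub>"] by simp
  have fneg: "f (\<ominus>\<^bsub>V\<^esub> x) = \<ominus>\<^bsub>S\<^esub> f x" if "x \<in> carrier V" for x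
    using fadd[of "\<ominus>\<^bsub>V\<^esub> x" x] f0 that f by (simp add: M.l_neg R.minus_equality)
  have "submodule {x \<in> carrier V. f x \<in> I} S V"
    unfolding submodule_def submodule_axioms_def
  proof (intro conjI allI impI)
    show "subgroup {x \<in> carrier V. f x \<in> I} (add_monoid V)"
      by (rule group.subgroupI[OF M.a_group])
         (use f0 I.zero_closed fneg fadd I.a_inv_closed in \<open>auto simp: a_inv_def[symmetric]\<close>)
  qed (use fsmult I.I_l_closed in auto)
  then have "ideal_smult I V \<subseteq> {x \<in> carrier V. f x \<in> I}"
    by (rule submodule_ideal_smult_subset[OF assms(1,2)])
       (use I.Icarr fsmult f I.I_r_closed in auto)
  then show ?thesis using assms(4) by blast
qed

lemma quot_form_coset:
  assumes "module S V" "ideal I S" "star ` I \<subseteq> I" "ring_involution S star"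
    and "skew_hermitian_form S star V h" "u \<in> carrier V" "v \<in> carrier V"
  shows "quot_form S I h (ideal_smult I V +>\<^bsub>V\<^esub> u) (ideal_smult I V +>\<^bsub>V\<^esub> v) = I +>\<^bsub>S\<^esub> h u v"
proof -
  interpret module S V by fact
  interpret I: ideal I S by fact
  interpret N: abelian_subgroup "ideal_smult I V" V
    by (rule ideal_smult_abelian_subgroup[OF assms(1,2)])
  let ?N = "ideal_smult I V"
  have lin: "linear_functional S V (h x)" if "x \<in> carrier V" for x
    using assms(5) that by (auto simp: skew_hermitian_form_def)
  have h: "h x y \<in> carrier S" if "x \<in> carrier V" "y \<in> carrier V" for x y
    using lin[OF that(1)] that(2) by (auto simp: linear_functional_def)
  have skew: "star (h x y) = \<ominus>\<^bsub>S\<^esub> h y x" if "x \<in> carrier V" "y \<in> carrier V" for x y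
    using assms(5) that by (auto simp: skew_hermitian_form_def)
  have r: "h x n \<in> I" if "x \<in> carrier V" "n \<in> ?N" for x n
    by (rule linear_functional_ideal_smult[OF assms(1,2) lin[OF that(1)] that(2)])
  have l: "h n x \<in> I" if "x \<in> carrier V" "n \<in> ?N" for x n
  proof -
    have "n \<in> carrier V" using that(2) by (rule N.a_Hcarr)
    moreover have "star (h x n) \<in> I" using r[OF that] assms(3) by blast
    ultimately have "\<ominus>\<^bsub>S\<^esub> h n x \<in> I" using skew that(1) by simp
    then have "\<ominus>\<^bsub>S\<^esub> (\<ominus>\<^bsub>S\<^esub> h n x) \<in> I" by (rule I.a_inv_closed)
    then show ?thesis using h \<open>n \<in> carrier V\<close> that(1) by simp
  qed
  have "(\<Union>p\<in>(?N +>\<^bsub>V\<^esub> u) \<times> (?N +>\<^bsub>V\<^esub> v). I +>\<^bsub>S\<^esub> h (fst p) (snd p)) = I +>\<^bsub>S\<^esub> h u v"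
  proof (rule coset_union_eq[OF I.abelian_subgroup_axioms])
    show "(?N +>\<^bsub>V\<^esub> u) \<times> (?N +>\<^bsub>V\<^esub> v) \<noteq> {}"
      using N.a_rcos_self[OF assms(6)] N.a_rcos_self[OF assms(7)] by blast
    show "h u v \<in> carrier S" using h assms(6,7) by simp
    fix p assume "p \<in> (?N +>\<^bsub>V\<^esub> u) \<times> (?N +>\<^bsub>V\<^esub> v)"
    then obtain x y where p: "p = (x, y)" "x \<in> ?N +>\<^bsub>V\<^esub> u" "y \<in> ?N +>\<^bsub>V\<^esub> v" by blast
    obtain k where k: "k \<in> ?N" "x = k \<oplus>\<^bsub>V\<^esub> u" "k \<in> carrier V"
      using coset_elem[OF N.abelian_subgroup_axioms assms(6) p(2)] by blast
    obtain n where n: "n \<in> ?N" "y = n \<oplus>\<^bsub>V\<^esub> v" "n \<in> carrier V"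
      using coset_elem[OF N.abelian_subgroup_axioms assms(7) p(3)] by blast
    have y: "y \<in> carrier V" using n assms(7) by simp
    have "h x y = h k y \<oplus>\<^bsub>S\<^esub> h u y"
      using assms(5,6) k y by (auto simp: skew_hermitian_form_def)
    also have "h u y = h u n \<oplus>\<^bsub>S\<^esub> h u v"
      using lin[OF assms(6)] n assms(7) by (auto simp: linear_functional_def)
    finally have "h x y = (h k y \<oplus>\<^bsub>S\<^esub> h u n) \<oplus>\<^bsub>S\<^esub> h u v"
      using h k n y assms(6,7) by (simp add: R.a_assoc)
    moreover have "h k y \<oplus>\<^bsub>S\<^esub> h u n \<in> I"
      using l[OF y k(1)] r[OF assms(6) n(1)] by (rule I.a_closed)
    ultimately show "\<exists>k\<in>I. h (fst p) (snd p) = k \<oplus>\<^bsub>S\<^esub> h u v"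
      using p(1) by auto
  qed
  then show ?thesis by (simp add: quot_form_def UN_UN_Times)
qed

lemma reduction_coset:
  assumes "module S V" "ideal I S" "linear_map S V V X" "v \<in> carrier V"
  shows "reduction V I X (ideal_smult I V +>\<^bsub>V\<^esub> v) = ideal_smult I V +>\<^bsub>V\<^esub> X v"
proof -
  interpret module S V by fact
  interpret I: ideal I S by fact
  interpret N: abelian_subgroup "ideal_smult I V" V
    by (rule ideal_smult_abelian_subgroup[OF assms(1,2)])
  interpret N': submodule "ideal_smult I V" S V
    by (rule ideal_smult_submodule[OF assms(1,2)])
  let ?N = "ideal_smult I V"
  have X: "X x \<in> carrier V" if "x \<in> carrier V" for x
    using assms(3) that by (auto simp: linear_map_def)
  have Xadd: "X (x \<oplus>\<^bsub>V\<^esub> y) = X x \<oplus>\<^bsub>V\<^esub> X y" if "x \<in> carrier V" "y \<in> carrier V" for x y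
    using assms(3) that by (auto simp: linear_map_def)
  have Xsmult: "X (a \<odot>\<^bsub>V\<^esub> x) = a \<odot>\<^bsub>V\<^esub> X x" if "a \<in> carrier S" "x \<in> carrier V" for a x
    using assms(3) that by (auto simp: linear_map_def)
  have X0: "X \<zero>\<^bsub>V\<^esub> = \<zero>\<^bsub>V\<^esub>"
    using Xsmult[of "\<zero>\<^bsub>S\<^esub>" "\<zero>\<^bsub>V\<^esub>"] X[of "\<zero>\<^bsub>V\<^esub>"] by simp
  have Xneg: "X (\<ominus>\<^bsub>V\<^esub> x) = \<ominus>\<^bsub>V\<^esub> X x" if "x \<in> carrier V" for x
    using Xadd[of "\<ominus>\<^bsub>V\<^esub> x" x] X0 that X by (simp add: M.l_neg M.minus_equality)
  have "submodule {x \<in> carrier V. X x \<in> ?N} S V"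
    unfolding submodule_def submodule_axioms_def
  proof (intro conjI allI impI)
    show "subgroup {x \<in> carrier V. X x \<in> ?N} (add_monoid V)"
      by (rule group.subgroupI[OF M.a_group])
         (use X0 N.zero_closed Xneg Xadd N.a_inv_closed in \<open>auto simp: a_inv_def[symmetric]\<close>)
  qed (use Xsmult N'.smult_closed in auto)
  then have sub: "?N \<subseteq> {x \<in> carrier V. X x \<in> ?N}"
  proof (rule submodule_ideal_smult_subset[OF assms(1,2)])
    fix a v assume av: "a \<in> I" "v \<in> carrier V"
    then have "a \<odot>\<^bsub>V\<^esub> X v \<in> ?N"
      using X unfolding ideal_smult_def by (blast intro: generate.incl)
    then show "a \<odot>\<^bsub>V\<^esub> v \<in> {x \<in> carrier V. X x \<in> ?N}"
      using av I.Icarr Xsmult by auto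
  qed
  have "(\<Union>u\<in>?N +>\<^bsub>V\<^esub> v. ?N +>\<^bsub>V\<^esub> X u) = ?N +>\<^bsub>V\<^esub> X v"
  proof (rule coset_union_eq[OF N.abelian_subgroup_axioms])
    show "?N +>\<^bsub>V\<^esub> v \<noteq> {}" using N.a_rcos_self[OF assms(4)] by blast
    show "X v \<in> carrier V" using X assms(4) .
    fix x assume "x \<in> ?N +>\<^bsub>V\<^esub> v"
    then obtain k where "k \<in> ?N" "x = k \<oplus>\<^bsub>V\<^esub> v" "k \<in> carrier V"
      using coset_elem[OF N.abelian_subgroup_axioms assms(4)] by blast
    then show "\<exists>k\<in>?N. X x = k \<oplus>\<^bsub>V\<^esub> X v" using sub Xadd assms(4) by blast
  qed
  moreover have "?N +>\<^bsub>V\<^esub> v \<in> carrier (quot_module V I)"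
    using assms(4) by (simp add: quot_module_def M.a_rcosetsI[OF N.a_subset])
  ultimately show ?thesis by (simp add: reduction_def)
qed


lemma quot_form_skew_hermitian:
  assumes "module S V" "ideal I S" "star ` I \<subseteq> I" "ring_involution S star"
    and "skew_hermitian_form S star V h"
  shows "skew_hermitian_form (S Quot I) (quot_involution S I star) (quot_module V I) (quot_form S I h)"
proof -
  interpret module S V by fact
  interpret I: ideal I S by fact
  interpret N: abelian_subgroup "ideal_smult I V" V
    by (rule ideal_smult_abelian_subgroup[OF assms(1,2)])
  interpret Q: ring_hom_ring S "S Quot I" "(+>\<^bsub>S\<^esub>) I" by (rule I.rcos_ring_hom_ring)
  let ?N = "ideal_smult I V" and ?W = "quot_module V I" and ?k = "quot_form S I h"
  have V: "\<exists>u\<in>carrier V. U = ?N +>\<^bsub>V\<^esub> u" if "U \<in> carrier ?W" for U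
    using that unfolding quot_module_def A_RCOSETS_def' by simp
  have S: "\<exists>a\<in>carrier S. A = I +>\<^bsub>S\<^esub> a" if "A \<in> carrier (S Quot I)" for A
    using that unfolding FactRing_def A_RCOSETS_def' by simp
  have add: "(?N +>\<^bsub>V\<^esub> u) \<oplus>\<^bsub>?W\<^esub> (?N +>\<^bsub>V\<^esub> v) = ?N +>\<^bsub>V\<^esub> (u \<oplus>\<^bsub>V\<^esub> v)"
    if "u \<in> carrier V" "v \<in> carrier V" for u v
    using N.a_rcos_sum[OF that] by (simp add: quot_module_def)
  note k = quot_form_coset[OF assms]
  have lin: "linear_functional S V (h u)" if "u \<in> carrier V" for u
    using assms(5) that by (auto simp: skew_hermitian_form_def)
  have h: "h u v \<in> carrier S" if "u \<in> carrier V" "v \<in> carrier V" for u v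
    using lin[OF that(1)] that(2) by (auto simp: linear_functional_def)
  have hr: "h u (v \<oplus>\<^bsub>V\<^esub> w) = h u v \<oplus>\<^bsub>S\<^esub> h u w"
    if "u \<in> carrier V" "v \<in> carrier V" "w \<in> carrier V" for u v w
    using lin[OF that(1)] that by (auto simp: linear_functional_def)
  have hs: "h u (a \<odot>\<^bsub>V\<^esub> v) = a \<otimes>\<^bsub>S\<^esub> h u v"
    if "a \<in> carrier S" "u \<in> carrier V" "v \<in> carrier V" for u v a
    using lin[OF that(2)] that by (auto simp: linear_functional_def)
  have hl: "h (u \<oplus>\<^bsub>V\<^esub> v) w = h u w \<oplus>\<^bsub>S\<^esub> h v w"
    and skew: "star (h u v) = \<ominus>\<^bsub>S\<^esub> h v u"
    if "u \<in> carrier V" "v \<in> carrier V" "w \<in> carrier V" for u v w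
    using assms(5) that by (auto simp: skew_hermitian_form_def)
  show ?thesis
    unfolding skew_hermitian_form_def linear_functional_def
  proof (intro conjI ballI funcsetI)
    fix U W assume UW: "U \<in> carrier ?W" "W \<in> carrier ?W"
    then obtain u v where uv: "u \<in> carrier V" "v \<in> carrier V"
      and e: "U = ?N +>\<^bsub>V\<^esub> u" "W = ?N +>\<^bsub>V\<^esub> v" using V[OF UW(1)] V[OF UW(2)] by blast
    show "?k U W \<in> carrier (S Quot I)" using uv h by (simp add: e k)
    show "quot_involution S I star (?k U W) = \<ominus>\<^bsub>S Quot I\<^esub> ?k W U"
      using uv h skew[OF uv uv(1)]
      by (simp add: e k quot_involution_coset[OF assms(4,2,3)])
    fix Z assume Z: "Z \<in> carrier ?W"
    then obtain w where w: "w \<in> carrier V" "Z = ?N +>\<^bsub>V\<^esub> w" using V[OF Z] by blast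
    show "?k U (W \<oplus>\<^bsub>?W\<^esub> Z) = ?k U W \<oplus>\<^bsub>S Quot I\<^esub> ?k U Z"
      using uv w h by (simp add: e add k hr)
    show "?k (U \<oplus>\<^bsub>?W\<^esub> W) Z = ?k U Z \<oplus>\<^bsub>S Quot I\<^esub> ?k W Z"
      using uv w h by (simp add: e add k hl[OF uv w(1)])
  next
    fix U A W assume UAW: "U \<in> carrier ?W" "A \<in> carrier (S Quot I)" "W \<in> carrier ?W"
    then obtain u a v where uv: "u \<in> carrier V" "a \<in> carrier S" "v \<in> carrier V"
      and e: "U = ?N +>\<^bsub>V\<^esub> u" "A = I +>\<^bsub>S\<^esub> a" "W = ?N +>\<^bsub>V\<^esub> v" using V[OF UAW(1)] S[OF UAW(2)] V[OF UAW(3)] by blast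
    show "?k U (A \<odot>\<^bsub>?W\<^esub> W) = A \<otimes>\<^bsub>S Quot I\<^esub> ?k U W"
      using uv h by (simp add: e k quot_module_smult_coset[OF assms(1,2)] hs)
  qed
qed

end

theory Submission
  imports "HOL-Algebra.Ring_Divisibility" Defs
begin

text \<open>
  The idea is to lift generators.  For isotropic vectors \<open>u\<close>, \<open>w\<close> with \<open>q = h u w\<close> a unit, the
  quasi-reflection \<open>v \<mapsto> v - (q\<^sup>*)\<inverse> h (w - u) v (w - u)\<close>, called \<open>swap u w\<close>, is an isometry that takes
  \<open>u\<close> to \<open>w\<close> and fixes every vector that pairs equally with \<open>u\<close> and \<open>w\<close>.  Over a local ring, swaps
  generate the unitary group of a form with a symplectic basis
  (\<open>unitary_group_generated_by_swaps\<close>): given an isometry \<open>X\<close>, one multiplies it by swaps that move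
  the images of the basis vectors back to the basis vectors, one after the other, without moving
  those already in place.  A vector \<open>b\<close> and its image \<open>X b\<close> may pair to a nonunit; then one goes from
  \<open>X b\<close> to \<open>b\<close> through a third isotropic vector, which exists because the nonunits form an ideal.

  This is applied over the quotient ring \<open>S/I\<close>, which is again local.  A swap of \<open>V/IV\<close> lifts as soon
  as its two isotropic vectors lift to isotropic vectors, and they do: if \<open>a = h w w\<close> lies in \<open>I\<close> and \<open>z\<close>
  is isotropic with \<open>h w z = 1\<close>, then \<open>w - (a/2) z\<close> is isotropic and congruent to \<open>w\<close>; a suitable \<open>z\<close> is
  a multiple of a vector of the symplectic basis (\<open>isotropic_lift\<close>).  Hence reduction maps the
  unitary group of \<open>V\<close> onto that of \<open>V/IV\<close> (\<open>reduction_unitary_surj\<close>).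

  It remains to correct determinants.  Comparing Gram matrices shows that the determinant \<open>d\<close> of an
  isometry satisfies \<open>d\<^sup>* d = 1\<close> (\<open>unitary_det\<close>).  If moreover \<open>d\<close> is congruent to \<open>1\<close>, then
  \<open>x = (1 + d\<^sup>*)/2\<close> is a unit congruent to \<open>1\<close> with \<open>d x = x\<^sup>*\<close>, and the isometry
  \<open>u\<^sub>1 \<mapsto> x u\<^sub>1\<close>, \<open>v\<^sub>1 \<mapsto> (x\<^sup>*)\<inverse> v\<^sub>1\<close> has determinant \<open>d\<inverse>\<close> and reduces to the identity
  (\<open>determinant_correction\<close>).

  Determinants are those of the Leibniz formula over an arbitrary commutative ring given by a
  carrier, so the development starts with their multiplicativity; it also makes the determinant of
  an endomorphism independent of the basis.
\<close>

section \<open>Determinants over a commutative ring\<close>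

lemma (in comm_monoid) finprod_swap:
  assumes "finite A" "finite B" "\<And>i j. i \<in> A \<Longrightarrow> j \<in> B \<Longrightarrow> f i j \<in> carrier G"
  shows "(\<Otimes>i\<in>A. \<Otimes>j\<in>B. f i j) = (\<Otimes>j\<in>B. \<Otimes>i\<in>A. f i j)"
  using assms(1,3)
proof (induction A)
  case (insert a A)
  have "(\<Otimes>i\<in>insert a A. \<Otimes>j\<in>B. f i j) = (\<Otimes>j\<in>B. f a j) \<otimes> (\<Otimes>i\<in>A. \<Otimes>j\<in>B. f i j)"
    using insert by (subst finprod_insert) auto
  also have "\<dots> = (\<Otimes>j\<in>B. f a j) \<otimes> (\<Otimes>j\<in>B. \<Otimes>i\<in>A. f i j)"
    using insert by simp
  also have "\<dots> = (\<Otimes>j\<in>B. f a j \<otimes> (\<Otimes>i\<in>A. f i j))"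
    using insert by (intro finprod_multf[symmetric]) auto
  also have "\<dots> = (\<Otimes>j\<in>B. \<Otimes>i\<in>insert a A. f i j)"
    using insert by (intro finprod_cong) (auto simp: simp_implies_def)
  finally show ?case .
qed simp

lemma (in comm_monoid) finprod_Times:
  assumes "finite A" "finite B" "\<And>i j. i \<in> A \<Longrightarrow> j \<in> B \<Longrightarrow> f i j \<in> carrier G"
  shows "(\<Otimes>i\<in>A. \<Otimes>j\<in>B. f i j) = (\<Otimes>x\<in>A \<times> B. f (fst x) (snd x))"
proof -
  have "(\<Otimes>x\<in>A \<times> B. f (fst x) (snd x)) = (\<Otimes>x\<in>(\<Union>i\<in>A. {i} \<times> B). f (fst x) (snd x))"
    by (rule arg_cong[where f = "finprod G _"]) auto
  also have "\<dots> = (\<Otimes>i\<in>A. \<Otimes>x\<in>{i} \<times> B. f (fst x) (snd x))"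
    using assms by (intro finprod_UN_disjoint) (auto simp: pairwise_def disjnt_def)
  also have "\<dots> = (\<Otimes>i\<in>A. \<Otimes>j\<in>B. f i j)"
  proof (intro finprod_cong' refl)
    fix i assume i: "i \<in> A"
    have "(\<Otimes>x\<in>Pair i ` B. f (fst x) (snd x)) = (\<Otimes>j\<in>B. f i j)"
      using i assms(3) by (subst finprod_reindex) (auto simp: inj_on_def)
    moreover have "{i} \<times> B = Pair i ` B" by auto
    ultimately show "(\<Otimes>x\<in>{i} \<times> B. f (fst x) (snd x)) = (\<Otimes>j\<in>B. f i j)" by simp
  qed (use assms in \<open>auto intro!: finprod_closed\<close>)
  finally show ?thesis by simp
qed

text \<open>Expanding the product means choosing one summand in each factor, so the terms are indexed by choice
functions; a choice on \<open>insert a A\<close> is a choice on \<open>A\<close> updated at \<open>a\<close>.\<close>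

lemma (in cring) finprod_finsum_distrib:
  assumes "finite A" "finite B" "\<And>i k. i \<in> A \<Longrightarrow> k \<in> B \<Longrightarrow> f i k \<in> carrier R"
  shows "(\<Otimes>i\<in>A. \<Oplus>k\<in>B. f i k) = (\<Oplus>g\<in>A \<rightarrow>\<^sub>E B. \<Otimes>i\<in>A. f i (g i))"
  using assms(1,3)
proof (induction A)
  case empty
  then show ?case by simp
next
  case (insert a A)
  have inj: "inj_on (\<lambda>(y, g). g(a := y)) (B \<times> (A \<rightarrow>\<^sub>E B))"
  proof (rule inj_onI, clarsimp)
    fix y z g h assume gh: "g \<in> A \<rightarrow>\<^sub>E B" "h \<in> A \<rightarrow>\<^sub>E B" and e: "g(a := y) = h(a := z)"
    have "g x = h x" for x
      using fun_cong[OF e, of x] gh insert.hyps(2) by (cases "x = a") (auto simp: PiE_def extensional_def)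
    then show "y = z \<and> g = h" using fun_cong[OF e, of a] by auto
  qed
  have fin: "finite (A \<rightarrow>\<^sub>E B)" using insert.hyps assms(2) by (intro finite_PiE) auto
  have c: "(\<Otimes>i\<in>A. f i (g i)) \<in> carrier R" if "g \<in> A \<rightarrow>\<^sub>E B" for g
    using that insert.prems by (intro finprod_closed) (auto simp: PiE_iff)
  have c': "(\<Otimes>i\<in>insert a A. f i (g i)) \<in> carrier R" if "g \<in> insert a A \<rightarrow>\<^sub>E B" for g
    using that insert.prems by (intro finprod_closed) (auto simp: PiE_iff)
  have "(\<Otimes>i\<in>insert a A. \<Oplus>k\<in>B. f i k) = (\<Oplus>k\<in>B. f a k) \<otimes> (\<Oplus>g\<in>A \<rightarrow>\<^sub>E B. \<Otimes>i\<in>A. f i (g i))"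
    using insert by (subst finprod_insert) auto
  also have "\<dots> = (\<Oplus>k\<in>B. f a k \<otimes> (\<Oplus>g\<in>A \<rightarrow>\<^sub>E B. \<Otimes>i\<in>A. f i (g i)))"
    using insert.prems assms(2) c by (intro finsum_ldistr) auto
  also have "\<dots> = (\<Oplus>k\<in>B. \<Oplus>g\<in>A \<rightarrow>\<^sub>E B. f a k \<otimes> (\<Otimes>i\<in>A. f i (g i)))"
    using insert.prems c fin by (intro finsum_cong' refl finsum_rdistr) auto
  also have "\<dots> = (\<Oplus>x\<in>B \<times> (A \<rightarrow>\<^sub>E B). f a (fst x) \<otimes> (\<Otimes>i\<in>A. f i (snd x i)))"
    using insert.prems c fin assms(2) by (intro add.finprod_Times) auto
  also have "\<dots> = (\<Oplus>x\<in>B \<times> (A \<rightarrow>\<^sub>E B). \<Otimes>i\<in>insert a A. f i (((snd x)(a := fst x)) i))"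
  proof (intro finsum_cong' refl)
    fix x assume "x \<in> B \<times> (A \<rightarrow>\<^sub>E B)"
    then obtain k g where x: "x = (k, g)" and kg: "k \<in> B" "g \<in> A \<rightarrow>\<^sub>E B" by auto
    have "(\<Otimes>i\<in>A. f i (if i = a then k else g i)) = (\<Otimes>i\<in>A. f i (g i))"
      using kg insert.hyps insert.prems by (intro finprod_cong') (auto simp: PiE_iff)
    then show "f a (fst x) \<otimes> (\<Otimes>i\<in>A. f i (snd x i)) = (\<Otimes>i\<in>insert a A. f i (((snd x)(a := fst x)) i))"
      using kg insert.hyps insert.prems by (subst finprod_insert) (auto simp: PiE_iff x)
  next
    show "(\<lambda>x. \<Otimes>i\<in>insert a A. f i (((snd x)(a := fst x)) i)) \<in> B \<times> (A \<rightarrow>\<^sub>E B) \<rightarrow> carrier R"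
    proof
      fix x assume "x \<in> B \<times> (A \<rightarrow>\<^sub>E B)"
      then have "(snd x)(a := fst x) \<in> insert a A \<rightarrow>\<^sub>E B" by (intro PiE_fun_upd) auto
      then show "(\<Otimes>i\<in>insert a A. f i (((snd x)(a := fst x)) i)) \<in> carrier R" by (rule c')
    qed
  qed
  also have "\<dots> = (\<Oplus>g\<in>(\<lambda>(y, g). g(a := y)) ` (B \<times> (A \<rightarrow>\<^sub>E B)). \<Otimes>i\<in>insert a A. f i (g i))"
  proof (subst finsum_reindex[OF _ inj])
    show "(\<lambda>g. \<Otimes>i\<in>insert a A. f i (g i)) \<in> (\<lambda>(y, g). g(a := y)) ` (B \<times> (A \<rightarrow>\<^sub>E B)) \<rightarrow> carrier R"
      unfolding PiE_insert_eq[of a A "\<lambda>_. B", symmetric] using c' by (rule Pi_I)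
  qed (simp add: case_prod_unfold)
  finally show ?case by (simp only: PiE_insert_eq)
qed

context cring
begin

lemma prod_entries_closed:
  fixes n :: nat
  assumes "A \<in> {..<n} \<rightarrow> {..<n} \<rightarrow> carrier R" "\<And>i. i < n \<Longrightarrow> p i < n"
  shows "(\<Otimes>i\<in>{..<n}. A i (p i)) \<in> carrier R"
  using assms by (intro finprod_closed) auto

lemma permutes_less: "p permutes {..<n::nat} \<Longrightarrow> i < n \<Longrightarrow> p i < n"
  using permutes_in_image[of p "{..<n}" i] by simp

lemma restrict_permutes_PiE:
  "p permutes {..<n::nat} \<Longrightarrow> restrict p {..<n} \<in> {..<n} \<rightarrow>\<^sub>E {..<n}"
  by (simp only: restrict_PiE_iff) (auto dest: permutes_less)

lemma sign_mult_add_pow: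
  assumes "x \<in> carrier R" 
  shows "[(sign p * sign q)] \<cdot> x = [sign p] \<cdot> ([sign q] \<cdot> x)"
  using add.int_pow_pow[OF assms, of "sign p" "sign q"] by (simp add: mult.commute)

lemma leibniz_det_term_closed:
  fixes n :: nat
  assumes "A \<in> {..<n} \<rightarrow> {..<n} \<rightarrow> carrier R" "p permutes {..<n}"
  shows "[sign p] \<cdot> (\<Otimes>i\<in>{..<n}. A i (p i)) \<in> carrier R"
  using prod_entries_closed[of A n p, OF assms(1) permutes_less[OF assms(2)]] by simp

lemma leibniz_det_closed:
  assumes "A \<in> {..<n} \<rightarrow> {..<n} \<rightarrow> carrier R"
  shows "leibniz_det R n A \<in> carrier R"
  unfolding leibniz_det_def using leibniz_det_term_closed[OF assms] by (intro finsum_closed) auto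

lemma leibniz_det_cong:
  assumes "\<And>i j. i < n \<Longrightarrow> j < n \<Longrightarrow> A i j = B i j"
    and "B \<in> {..<n} \<rightarrow> {..<n} \<rightarrow> carrier R"
  shows "leibniz_det R n A = leibniz_det R n B"
  unfolding leibniz_det_def
proof (intro finsum_cong' refl)
  show "(\<lambda>p. [sign p] \<cdot> (\<Otimes>i\<in>{..<n}. B i (p i))) \<in> {p. p permutes {..<n}} \<rightarrow> carrier R"
    using leibniz_det_term_closed[OF assms(2)] by auto
  fix p assume p: "p \<in> {p. p permutes {..<n}}"
  have "(\<Otimes>i\<in>{..<n}. A i (p i)) = (\<Otimes>i\<in>{..<n}. B i (p i))"
    using p assms permutes_less[of p n] by (intro finprod_cong') (auto simp: Pi_iff)
  then show "[sign p] \<cdot> (\<Otimes>i\<in>{..<n}. A i (p i)) = [sign p] \<cdot> (\<Otimes>i\<in>{..<n}. B i (p i))" by simp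
qed

text \<open>Reindex the Leibniz sum by \<open>p \<mapsto> p \<circ> q\<close> and each product by \<open>q\<close>.\<close>

lemma leibniz_det_permute_rows:
  assumes AA: "A \<in> {..<n} \<rightarrow> {..<n} \<rightarrow> carrier R" and q: "q permutes {..<n}"
  shows "leibniz_det R n (\<lambda>i. A (q i)) = [sign q] \<cdot> leibniz_det R n A"
proof -
  have A: "A i j \<in> carrier R" if "i < n" "j < n" for i j using AA that by (auto simp: Pi_iff)
  let ?P = "{p. p permutes {..<n}}"
  have eq: "?P = (\<lambda>p. p \<circ> q) ` ?P"
  proof (intro equalityI subsetI)
    fix p assume "p \<in> ?P"
    then have "p = (p \<circ> inv_into UNIV q) \<circ> q" "p \<circ> inv_into UNIV q \<in> ?P"
      using q by (auto simp: comp_assoc permutes_inv_o permutes_compose permutes_inv)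
    then show "p \<in> (\<lambda>p. p \<circ> q) ` ?P" by blast
  qed (use q permutes_compose in auto)
  have inj: "inj_on (\<lambda>p. p \<circ> q) ?P"
  proof (rule inj_onI)
    fix p p' assume "p \<circ> q = p' \<circ> q"
    then have "p \<circ> q \<circ> inv_into UNIV q = p' \<circ> q \<circ> inv_into UNIV q" by simp
    then show "p = p'" using q by (simp add: comp_assoc permutes_inv_o)
  qed
  have Aq: "(\<lambda>i. A (q i)) \<in> {..<n} \<rightarrow> {..<n} \<rightarrow> carrier R"
    using A permutes_less[OF q] by auto
  have tm: "[sign (p \<circ> q)] \<cdot> (\<Otimes>i\<in>{..<n}. A (q i) ((p \<circ> q) i))
      = [sign q] \<cdot> ([sign p] \<cdot> (\<Otimes>i\<in>{..<n}. A i (p i)))" if p: "p \<in> ?P" for p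
  proof -
    have "(\<Otimes>i\<in>q ` {..<n}. A i (p i)) = (\<Otimes>i\<in>{..<n}. A (q i) (p (q i)))"
      using p A permutes_less permutes_less[OF q] by (intro finprod_reindex permutes_inj_on[OF q]) auto
    then have e: "(\<Otimes>i\<in>{..<n}. A (q i) ((p \<circ> q) i)) = (\<Otimes>i\<in>{..<n}. A i (p i))"
      by (simp add: permutes_image[OF q])
    have "sign (p \<circ> q) = sign q * sign p"
      using p q sign_compose[of p q] permutes_imp_permutation[of "{..<n}"] by (simp add: mult.commute)
    moreover have "(\<Otimes>i\<in>{..<n}. A i (p i)) \<in> carrier R"
      using p by (intro prod_entries_closed AA) (auto intro: permutes_less)
    ultimately show ?thesis
      by (simp only: e sign_mult_add_pow)
  qed
  have "leibniz_det R n (\<lambda>i. A (q i))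
      = (\<Oplus>p\<in>(\<lambda>p. p \<circ> q) ` ?P. [sign p] \<cdot> (\<Otimes>i\<in>{..<n}. A (q i) (p i)))"
    unfolding leibniz_det_def using eq by simp
  also have "\<dots> = (\<Oplus>p\<in>?P. [sign (p \<circ> q)] \<cdot> (\<Otimes>i\<in>{..<n}. A (q i) ((p \<circ> q) i)))"
    using leibniz_det_term_closed[of "\<lambda>i. A (q i)" n, OF Aq] eq
    by (intro finsum_reindex inj) auto
  also have "\<dots> = (\<Oplus>p\<in>?P. [sign q] \<cdot> ([sign p] \<cdot> (\<Otimes>i\<in>{..<n}. A i (p i))))"
    using leibniz_det_term_closed[OF AA] tm by (intro finsum_cong' refl) auto
  also have "\<dots> = (\<Oplus>p\<in>?P. ([sign q] \<cdot> \<one>) \<otimes> ([sign p] \<cdot> (\<Otimes>i\<in>{..<n}. A i (p i))))"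
    using leibniz_det_term_closed[OF AA] by (intro finsum_cong' refl) (auto simp: add_pow_ldistr_int)
  also have "\<dots> = ([sign q] \<cdot> \<one>) \<otimes> leibniz_det R n A"
    unfolding leibniz_det_def
    using leibniz_det_term_closed[OF AA] by (intro finsum_rdistr[symmetric]) (auto simp: finite_permutations)
  finally show ?thesis
    using leibniz_det_closed[OF AA] by (simp add: add_pow_ldistr_int)
qed

text \<open>Composition with the transposition of the two rows pairs the even permutations with the odd ones, and
paired terms are negatives of each other.  This cancellation is valid in every characteristic, whereas
the row exchange rule would only give that twice the determinant vanishes.\<close>

lemma leibniz_det_eq_rows:
  assumes AA: "A \<in> {..<n} \<rightarrow> {..<n} \<rightarrow> carrier R"
    and kl: "k < n" "l < n" "k \<noteq> l" and eq: "\<And>j. j < n \<Longrightarrow> A k j = A l j"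
  shows "leibniz_det R n A = \<zero>"
proof -
  have A: "A i j \<in> carrier R" if "i < n" "j < n" for i j using AA that by (auto simp: Pi_iff)
  let ?P = "{p. p permutes {..<n}}" and ?E = "{p. p permutes {..<n} \<and> sign p = 1}"
  let ?t = "transpose k l"
  let ?f = "\<lambda>p. [sign p] \<cdot> (\<Otimes>i\<in>{..<n}. A i (p i))"
  have t: "?t permutes {..<n}" using kl by (simp add: permutes_swap_id)
  have fin: "finite ?P" by (simp add: finite_permutations)
  have sg: "sign (p \<circ> ?t) = - sign p" if "p permutes {..<n}" for p
    using that t sign_compose[of p ?t] permutes_imp_permutation[of "{..<n}"] kl(3)
    by (simp add: sign_swap_id)
  have inj: "inj_on (\<lambda>p. p \<circ> ?t) ?E"
  proof (rule inj_onI)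
    fix p p' assume "p \<circ> ?t = p' \<circ> ?t"
    then have "p \<circ> ?t \<circ> ?t = p' \<circ> ?t \<circ> ?t" by simp
    then show "p = p'" by (simp add: comp_assoc)
  qed
  have split: "?P = ?E \<union> (\<lambda>p. p \<circ> ?t) ` ?E"
  proof (intro equalityI subsetI)
    fix p assume p: "p \<in> ?P"
    show "p \<in> ?E \<union> (\<lambda>p. p \<circ> ?t) ` ?E"
    proof (cases "sign p = 1")
      case False
      then have "sign p = -1" by (cases p rule: sign_cases) auto
      then have "p \<circ> ?t \<in> ?E" using p sg t by (auto simp: permutes_compose)
      moreover have "p = (p \<circ> ?t) \<circ> ?t" by (simp add: comp_assoc)
      ultimately show ?thesis by blast
    qed (use p in auto)
  qed (use t permutes_compose in auto)
  have f: "?f p \<in> carrier R" if "p permutes {..<n}" for p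
    using leibniz_det_term_closed[OF AA that] by simp
  have ft: "?f (p \<circ> ?t) = \<ominus> ?f p" if p: "p permutes {..<n}" for p
  proof -
    have "(\<Otimes>i\<in>?t ` {..<n}. A i (p i)) = (\<Otimes>i\<in>{..<n}. A (?t i) (p (?t i)))"
      using A permutes_less[OF p] permutes_less[OF t] 
      by (intro finprod_reindex permutes_inj_on[OF t]) auto
    also have "\<dots> = (\<Otimes>i\<in>{..<n}. A i (p (?t i)))"
    proof (intro finprod_cong' refl)
      fix i assume i: "i \<in> {..<n}"
      then have "p (?t i) < n" using permutes_less[OF p] permutes_less[OF t] by simp
      then show "A (?t i) (p (?t i)) = A i (p (?t i))"
        using eq[of "p (?t i)"] by (auto simp: Transposition.transpose_def)
    qed (use A permutes_less[OF p] permutes_less[OF t] in auto)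
    finally have "(\<Otimes>i\<in>{..<n}. A i ((p \<circ> ?t) i)) = (\<Otimes>i\<in>{..<n}. A i (p i))"
      by (simp add: permutes_image[OF t])
    then show ?thesis
      using prod_entries_closed[of A n p, OF AA permutes_less[OF p]]
      by (simp only: sg[OF p] add.int_pow_neg)
  qed
  have finE: "finite ?E" by (rule finite_subset[OF _ fin]) auto
  have fE: "?f \<in> ?E \<rightarrow> carrier R" using f by auto
  have fO: "?f \<in> (\<lambda>p. p \<circ> ?t) ` ?E \<rightarrow> carrier R" using f t permutes_compose by blast
  have "leibniz_det R n A = (\<Oplus>p\<in>?E. ?f p) \<oplus> (\<Oplus>p\<in>(\<lambda>p. p \<circ> ?t) ` ?E. ?f p)"
    unfolding leibniz_det_def
  proof (subst split, rule finsum_Un_disjoint[OF finE _ _ fE fO])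
    show "?E \<inter> (\<lambda>p. p \<circ> ?t) ` ?E = {}" using sg by auto
  qed (use finE in auto)
  also have "(\<Oplus>p\<in>(\<lambda>p. p \<circ> ?t) ` ?E. ?f p) = (\<Oplus>p\<in>?E. ?f (p \<circ> ?t))"
    by (rule finsum_reindex[OF fO inj])
  also have "\<dots> = (\<Oplus>p\<in>?E. \<ominus> ?f p)" using ft f by (intro finsum_cong' refl) auto
  also have "(\<Oplus>p\<in>?E. ?f p) \<oplus> \<dots> = (\<Oplus>p\<in>?E. ?f p \<oplus> \<ominus> ?f p)"
    using f by (intro finsum_addf[symmetric]) auto
  also have "\<dots> = \<zero>"
  proof (rule add.finprod_one_eqI)
    fix p assume "p \<in> ?E"
    then show "?f p \<oplus> \<ominus> ?f p = \<zero>" using r_neg[OF f] by blast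
  qed
  finally show ?thesis .
qed

text \<open>Expand every entry of the product matrix.  The terms are indexed by functions \<open>g\<close> that choose the
summation index in each row, and the terms of one \<open>g\<close> add up to a multiple of the determinant of the
matrix of rows \<open>g i\<close> of \<open>B\<close>.  It vanishes unless \<open>g\<close> is injective, and an injective \<open>g\<close> is a permutation,
which contributes its sign times the determinant of \<open>B\<close>.\<close>

theorem leibniz_det_mult:
  assumes AA: "A \<in> {..<n} \<rightarrow> {..<n} \<rightarrow> carrier R"
    and BB: "B \<in> {..<n} \<rightarrow> {..<n} \<rightarrow> carrier R"
  shows "leibniz_det R n (\<lambda>i j. \<Oplus>k\<in>{..<n}. A i k \<otimes> B k j)
       = leibniz_det R n A \<otimes> leibniz_det R n B"
proof -
  have A: "A i j \<in> carrier R" if "i < n" "j < n" for i j using AA that by (auto simp: Pi_iff)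
  have B: "B i j \<in> carrier R" if "i < n" "j < n" for i j using BB that by (auto simp: Pi_iff)
  let ?P = "{p. p permutes {..<n}}" and ?F = "{..<n} \<rightarrow>\<^sub>E {..<n}"
  let ?pA = "\<lambda>g. \<Otimes>i\<in>{..<n}. A i (g i)"
  have finP: "finite ?P" by (simp add: finite_permutations)
  have finF: "finite ?F" by (intro finite_PiE) auto
  have less: "g i < n" if "g \<in> ?F" "i < n" for g i using that by (auto simp: PiE_iff)
  have pA: "?pA g \<in> carrier R" if "g \<in> ?F" for g using prod_entries_closed[of A n g, OF AA less[OF that]] by simp
  have Bg: "(\<lambda>i. B (g i)) \<in> {..<n} \<rightarrow> {..<n} \<rightarrow> carrier R" if "g \<in> ?F" for g
    using B less[OF that] by auto
  have pB: "(\<Otimes>i\<in>{..<n}. B (g i) (p i)) \<in> carrier R" if "g \<in> ?F" "p \<in> ?P" for g p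
    using that less B permutes_less by (intro finprod_closed) auto
  have tB: "[sign p] \<cdot> (\<Otimes>i\<in>{..<n}. B (g i) (p i)) \<in> carrier R" if "g \<in> ?F" "p \<in> ?P" for g p
    using pB[OF that] by simp
  have "leibniz_det R n (\<lambda>i j. \<Oplus>k\<in>{..<n}. A i k \<otimes> B k j)
      = (\<Oplus>p\<in>?P. \<Oplus>g\<in>?F. ?pA g \<otimes> ([sign p] \<cdot> (\<Otimes>i\<in>{..<n}. B (g i) (p i))))"
    unfolding leibniz_det_def
  proof (intro finsum_cong' refl)
    fix p assume p: "p \<in> ?P"
    have "(\<Otimes>i\<in>{..<n}. \<Oplus>k\<in>{..<n}. A i k \<otimes> B k (p i))
        = (\<Oplus>g\<in>?F. \<Otimes>i\<in>{..<n}. A i (g i) \<otimes> B (g i) (p i))"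
      using A B p permutes_less by (intro finprod_finsum_distrib) auto
    also have "\<dots> = (\<Oplus>g\<in>?F. ?pA g \<otimes> (\<Otimes>i\<in>{..<n}. B (g i) (p i)))"
      using A B p permutes_less less pA pB[OF _ p]
      by (intro finsum_cong' refl finprod_multf) auto
    finally have "[sign p] \<cdot> (\<Otimes>i\<in>{..<n}. \<Oplus>k\<in>{..<n}. A i k \<otimes> B k (p i))
        = ([sign p] \<cdot> \<one>) \<otimes> (\<Oplus>g\<in>?F. ?pA g \<otimes> (\<Otimes>i\<in>{..<n}. B (g i) (p i)))"
      using pA pB[OF _ p] by (simp add: add_pow_ldistr_int finsum_closed Pi_def)
    also have "\<dots> = (\<Oplus>g\<in>?F. ([sign p] \<cdot> \<one>) \<otimes> (?pA g \<otimes> (\<Otimes>i\<in>{..<n}. B (g i) (p i))))"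
      using pA pB[OF _ p] finF by (intro finsum_rdistr) auto
    also have "\<dots> = (\<Oplus>g\<in>?F. ?pA g \<otimes> ([sign p] \<cdot> (\<Otimes>i\<in>{..<n}. B (g i) (p i))))"
      using pA pB[OF _ p] by (intro finsum_cong' refl) (auto simp: add_pow_ldistr_int add_pow_rdistr_int)
    finally show "[sign p] \<cdot> (\<Otimes>i\<in>{..<n}. \<Oplus>k\<in>{..<n}. A i k \<otimes> B k (p i))
        = (\<Oplus>g\<in>?F. ?pA g \<otimes> ([sign p] \<cdot> (\<Otimes>i\<in>{..<n}. B (g i) (p i))))" .
  qed (use pA tB in \<open>auto intro!: finsum_closed\<close>)
  also have "\<dots> = (\<Oplus>g\<in>?F. \<Oplus>p\<in>?P. ?pA g \<otimes> ([sign p] \<cdot> (\<Otimes>i\<in>{..<n}. B (g i) (p i))))"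
    using pA tB finP finF by (intro add.finprod_swap) auto
  also have "\<dots> = (\<Oplus>g\<in>?F. ?pA g \<otimes> leibniz_det R n (\<lambda>i. B (g i)))"
    unfolding leibniz_det_def using pA tB finP 
    by (intro finsum_cong' refl finsum_rdistr[symmetric]) (auto intro!: finsum_closed)
  also have "\<dots> = (\<Oplus>g\<in>(\<lambda>p. restrict p {..<n}) ` ?P. ?pA g \<otimes> leibniz_det R n (\<lambda>i. B (g i)))"
  proof (intro add.finprod_mono_neutral_cong_right finF refl)
    \<comment> \<open>The functions in \<open>?F\<close> are \<^const>\<open>undefined\<close> outside \<open>{..<n}\<close>, the permutations are the identity there:
    hence the passage through \<^const>\<open>restrict\<close>.\<close>
    show "(\<lambda>p. restrict p {..<n}) ` ?P \<subseteq> ?F" using restrict_permutes_PiE by blast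
    fix g assume g: "g \<in> ?F - (\<lambda>p. restrict p {..<n}) ` ?P"
    have "\<not> inj_on g {..<n}"
    proof
      assume inj: "inj_on g {..<n}"
      have "g ` {..<n} = {..<n}"
        using g inj by (intro endo_inj_surj) (auto simp: PiE_iff)
      then have "bij_betw g {..<n} {..<n}" using inj by (simp add: bij_betw_def)
      then have "(\<lambda>i. if i < n then g i else i) permutes {..<n}"
        using bij_betw_cong[where A = "{..<n}" and f = "\<lambda>i. if i < n then g i else i" and g = g and A' = "{..<n}"]
        by (intro bij_imp_permutes) auto
      moreover have "g = restrict (\<lambda>i. if i < n then g i else i) {..<n}"
        using g by (auto simp: fun_eq_iff PiE_def extensional_def)
      ultimately show False using g by blast
    qed
    then obtain k l where kl: "k < n" "l < n" "k \<noteq> l" "g k = g l" by (auto simp: inj_on_def)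
    have "leibniz_det R n (\<lambda>i. B (g i)) = \<zero>"
      using g kl Bg[of g] by (intro leibniz_det_eq_rows[of _ n k l]) auto
    then show "?pA g \<otimes> leibniz_det R n (\<lambda>i. B (g i)) = \<zero>" using pA[of g] g by simp
  qed (use pA leibniz_det_closed[OF Bg] in auto)
  also have "\<dots> = (\<Oplus>p\<in>?P. ?pA (restrict p {..<n}) \<otimes> leibniz_det R n (\<lambda>i. B (restrict p {..<n} i)))"
  proof (intro finsum_reindex)
    show "inj_on (\<lambda>p. restrict p {..<n}) ?P"
    proof (rule inj_onI)
      fix p q assume pq: "p \<in> ?P" "q \<in> ?P" and e: "restrict p {..<n} = restrict q {..<n}"
      have "p x = q x" for x
        using pq fun_cong[OF e, of x] permutes_not_in[of p "{..<n}" x] permutes_not_in[of q "{..<n}" x]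
        by (cases "x < n") auto
      then show "p = q" by blast
    qed
    show "(\<lambda>g. ?pA g \<otimes> leibniz_det R n (\<lambda>i. B (g i))) \<in> (\<lambda>p. restrict p {..<n}) ` ?P \<rightarrow> carrier R"
    proof
      fix g assume "g \<in> (\<lambda>p. restrict p {..<n}) ` ?P"
      then have "g \<in> ?F" using restrict_permutes_PiE by blast
      then show "?pA g \<otimes> leibniz_det R n (\<lambda>i. B (g i)) \<in> carrier R"
        using pA leibniz_det_closed[OF Bg] by simp
    qed
  qed
  also have "\<dots> = (\<Oplus>p\<in>?P. ([sign p] \<cdot> ?pA p) \<otimes> leibniz_det R n B)"
  proof (intro finsum_cong' refl)
    fix p assume p: "p \<in> ?P"
    have "?pA (restrict p {..<n}) = ?pA p"
      using p A permutes_less by (intro finprod_cong') auto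
    moreover have "leibniz_det R n (\<lambda>i. B (restrict p {..<n} i)) = leibniz_det R n (\<lambda>i. B (p i))"
      using p Bg[of "restrict p {..<n}"] B permutes_less[of p n] by (intro leibniz_det_cong) auto
    moreover have "leibniz_det R n (\<lambda>i. B (p i)) = [sign p] \<cdot> leibniz_det R n B"
      using p by (intro leibniz_det_permute_rows BB) auto
    moreover have "?pA p \<in> carrier R"
      using p by (intro prod_entries_closed AA) (auto intro: permutes_less)
    ultimately show "?pA (restrict p {..<n}) \<otimes> leibniz_det R n (\<lambda>i. B (restrict p {..<n} i))
        = ([sign p] \<cdot> ?pA p) \<otimes> leibniz_det R n B"
      using leibniz_det_closed[OF BB]
      by (simp add: add_pow_ldistr_int add_pow_rdistr_int)
  qed (use leibniz_det_term_closed[OF AA] leibniz_det_closed[OF BB] in auto)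
  also have "\<dots> = leibniz_det R n A \<otimes> leibniz_det R n B"
    unfolding leibniz_det_def[of R n A]
    using leibniz_det_term_closed[OF AA] leibniz_det_closed[OF BB] finP
    by (intro finsum_ldistr[symmetric]) auto
  finally show ?thesis .
qed

text \<open>Reindex the Leibniz sum by inversion of permutations, which preserves the sign.\<close>

lemma leibniz_det_transpose:
  assumes AA: "A \<in> {..<n} \<rightarrow> {..<n} \<rightarrow> carrier R"
  shows "leibniz_det R n (\<lambda>i j. A j i) = leibniz_det R n A"
proof -
  have A: "A i j \<in> carrier R" if "i < n" "j < n" for i j using AA that by (auto simp: Pi_iff)
  let ?P = "{p. p permutes {..<n}}"
  have im: "inv_into UNIV ` ?P = ?P" 
    by (auto simp: permutes_inv image_iff) (metis permutes_inv permutes_inv_inv)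
  have inj: "inj_on (inv_into UNIV) ?P" by (metis (mono_tags, lifting) inj_onI mem_Collect_eq permutes_inv_inv)
  have tm: "[sign (inv_into UNIV p)] \<cdot> (\<Otimes>i\<in>{..<n}. A (inv_into UNIV p i) i) = [sign p] \<cdot> (\<Otimes>i\<in>{..<n}. A i (p i))"
    if p: "p permutes {..<n}" for p
  proof -
    have "(\<Otimes>i\<in>p ` {..<n}. A (inv_into UNIV p i) i) = (\<Otimes>i\<in>{..<n}. A (inv_into UNIV p (p i)) (p i))"
      using A permutes_less[OF p] permutes_less[OF permutes_inv[OF p]]
      by (intro finprod_reindex permutes_inj_on[OF p]) (auto simp: permutes_inverses[OF p])
    then show ?thesis
      using sign_inverse[of p] p permutes_imp_permutation[of "{..<n}" p]
      by (simp add: permutes_image[OF p] permutes_inverses[OF p])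
  qed
  have "leibniz_det R n (\<lambda>i j. A j i) = (\<Oplus>p\<in>inv_into UNIV ` ?P. [sign p] \<cdot> (\<Otimes>i\<in>{..<n}. A (p i) i))"
    unfolding leibniz_det_def im ..
  also have "\<dots> = (\<Oplus>p\<in>?P. [sign (inv_into UNIV p)] \<cdot> (\<Otimes>i\<in>{..<n}. A (inv_into UNIV p i) i))"
    using leibniz_det_term_closed[of "\<lambda>i j. A j i" n] A
    by (intro finsum_reindex inj) (auto simp: permutes_inv)
  also have "\<dots> = leibniz_det R n A"
    unfolding leibniz_det_def using tm leibniz_det_term_closed[OF AA]
    by (intro finsum_cong' refl) auto
  finally show ?thesis .
qed

lemma leibniz_det_diagonal:
  assumes "\<And>i. i < n \<Longrightarrow> d i \<in> carrier R"
  shows "leibniz_det R n (\<lambda>i j. if i = j then d i else \<zero>) = (\<Otimes>i\<in>{..<n}. d i)"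
proof -
  let ?P = "{p. p permutes {..<n}}"
  let ?f = "\<lambda>p. [sign p] \<cdot> (\<Otimes>i\<in>{..<n}. if i = p i then d i else \<zero>)"
  have c: "(\<Otimes>i\<in>{..<n}. d i) \<in> carrier R" using assms by (intro finprod_closed) auto
  have "?f p = \<zero>" if p: "p \<in> ?P - {id}" for p
  proof -
    obtain k where k: "p k \<noteq> k" using p by fastforce
    then have kn: "k < n" using p permutes_not_in[of p "{..<n}" k] by force
    have "(\<Otimes>i\<in>insert k ({..<n} - {k}). if i = p i then d i else \<zero>) = \<zero>"
      using k assms by (subst finprod_insert) (auto intro!: l_null finprod_closed)
    then show ?thesis using kn by (simp add: insert_absorb)
  qed
  then have "(\<Oplus>p\<in>?P. ?f p) = (\<Oplus>p\<in>{id}. ?f p)"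
    using assms by (intro add.finprod_mono_neutral_cong_right)
      (auto simp: finite_permutations permutes_id intro!: finprod_closed)
  also have "\<dots> = (\<Otimes>i\<in>{..<n}. d i)"
  proof -
    have "(\<Otimes>i\<in>{..<n}. if i = id i then d i else \<zero>) = (\<Otimes>i\<in>{..<n}. d i)"
      using assms by (intro finprod_cong') auto
    then show ?thesis using c by (simp add: finsum_insert)
  qed
  finally show ?thesis by (simp add: leibniz_det_def)
qed

lemma leibniz_det_one: "leibniz_det R n (\<lambda>i j. if i = j then \<one> else \<zero>) = \<one>"
  using leibniz_det_diagonal[of n "\<lambda>_. \<one>"] by simp

end

lemma (in ring_hom_cring) hom_leibniz_det:
  assumes AA: "A \<in> {..<n} \<rightarrow> {..<n} \<rightarrow> carrier R"
  shows "h (leibniz_det R n A) = leibniz_det S n (\<lambda>i j. h (A i j))"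
proof -
  have A: "A i j \<in> carrier R" if "i < n" "j < n" for i j using AA that by (auto simp: Pi_iff)
  have "h (\<Oplus>p\<in>{p. p permutes {..<n}}. [sign p] \<cdot> (\<Otimes>i\<in>{..<n}. A i (p i)))
      = (\<Oplus>\<^bsub>S\<^esub>p\<in>{p. p permutes {..<n}}. h ([sign p] \<cdot> (\<Otimes>i\<in>{..<n}. A i (p i))))"
    using R.leibniz_det_term_closed[OF AA] by (subst hom_finsum) (auto simp: comp_def)
  also have "\<dots> = (\<Oplus>\<^bsub>S\<^esub>p\<in>{p. p permutes {..<n}}. [sign p] \<cdot>\<^bsub>S\<^esub> (\<Otimes>\<^bsub>S\<^esub>i\<in>{..<n}. h (A i (p i))))"
  proof (intro S.finsum_cong' refl)
    fix p assume "p \<in> {p. p permutes {..<n}}"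
    then have p: "p permutes {..<n}" by simp
    have c: "(\<Otimes>i\<in>{..<n}. A i (p i)) \<in> carrier R"
      using A R.permutes_less[OF p] by (intro R.finprod_closed) auto
    have "h (\<Otimes>i\<in>{..<n}. A i (p i)) = (\<Otimes>\<^bsub>S\<^esub>i\<in>{..<n}. h (A i (p i)))"
      using A R.permutes_less[OF p] by (subst hom_finprod) (auto simp: comp_def)
    moreover have "h ([sign p] \<cdot> x) = [sign p] \<cdot>\<^bsub>S\<^esub> h x" if "x \<in> carrier R" for x
      using that by (cases p rule: sign_cases) (simp_all add: R.add.int_pow_neg S.add.int_pow_neg)
    ultimately show "h ([sign p] \<cdot> (\<Otimes>i\<in>{..<n}. A i (p i))) = [sign p] \<cdot>\<^bsub>S\<^esub> (\<Otimes>\<^bsub>S\<^esub>i\<in>{..<n}. h (A i (p i)))"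
      using c by simp
  next
    show "(\<lambda>p. [sign p] \<cdot>\<^bsub>S\<^esub> (\<Otimes>\<^bsub>S\<^esub>i\<in>{..<n}. h (A i (p i)))) \<in> {p. p permutes {..<n}} \<rightarrow> carrier S"
      using S.leibniz_det_term_closed[of "\<lambda>i j. h (A i j)" n] A by auto
  qed
  finally show ?thesis by (simp add: leibniz_det_def)
qed


section \<open>Bases, coordinates and determinants of endomorphisms\<close>

lemma linear_mapD:
  assumes "linear_map R M N X"
  shows "x \<in> carrier M \<Longrightarrow> X x \<in> carrier N"
    and "x \<in> carrier M \<Longrightarrow> y \<in> carrier M \<Longrightarrow> X (x \<oplus>\<^bsub>M\<^esub> y) = X x \<oplus>\<^bsub>N\<^esub> X y"
    and "a \<in> carrier R \<Longrightarrow> x \<in> carrier M \<Longrightarrow> X (a \<odot>\<^bsub>M\<^esub> x) = a \<odot>\<^bsub>N\<^esub> X x"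
  using assms by (auto simp: linear_map_def)

lemma (in module) linear_map_lincomb:
  assumes N: "module R N" and X: "linear_map R M N X"
    and "finite A" "c \<in> A \<rightarrow> carrier R" "v \<in> A \<rightarrow> carrier M"
  shows "X (\<Oplus>\<^bsub>M\<^esub>i\<in>A. c i \<odot>\<^bsub>M\<^esub> v i) = (\<Oplus>\<^bsub>N\<^esub>i\<in>A. c i \<odot>\<^bsub>N\<^esub> X (v i))"
proof -
  interpret N: module R N by (rule N)
  note X' = linear_mapD[OF X]
  have X0: "X \<zero>\<^bsub>M\<^esub> = \<zero>\<^bsub>N\<^esub>"
    using X'(3)[of \<zero> "\<zero>\<^bsub>M\<^esub>"] X'(1)[of "\<zero>\<^bsub>M\<^esub>"] by simp
  show ?thesis using assms(3-5)
  proof (induction A)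
    case (insert a A)
    have 1: "c a \<odot>\<^bsub>M\<^esub> v a \<in> carrier M" "c a \<odot>\<^bsub>N\<^esub> X (v a) \<in> carrier N"
      "X (c a \<odot>\<^bsub>M\<^esub> v a) = c a \<odot>\<^bsub>N\<^esub> X (v a)"
      using insert.prems X' by auto
    have 2: "(\<lambda>i. c i \<odot>\<^bsub>M\<^esub> v i) \<in> A \<rightarrow> carrier M" "(\<lambda>i. c i \<odot>\<^bsub>N\<^esub> X (v i)) \<in> A \<rightarrow> carrier N"
      using insert.prems X'(1) by (auto simp: Pi_iff)
    have "X (\<Oplus>\<^bsub>M\<^esub>i\<in>A. c i \<odot>\<^bsub>M\<^esub> v i) = (\<Oplus>\<^bsub>N\<^esub>i\<in>A. c i \<odot>\<^bsub>N\<^esub> X (v i))"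
      using insert by (simp add: Pi_iff)
    then show ?case
      using insert.hyps 1 2 X'(2) by (simp add: M.finsum_insert N.M.finsum_insert M.finsum_closed)
  qed (simp add: X0)
qed

text \<open>The definition of a basis asks for a unique extensional coefficient function; for verifying it,
coefficient functions that agree below \<open>n\<close> may be identified.\<close>

lemma module_basisI:
  assumes "module R M" "b \<in> {..<n} \<rightarrow> carrier M"
    and span: "\<And>x. x \<in> carrier M \<Longrightarrow> \<exists>c \<in> {..<n} \<rightarrow> carrier R. x = (\<Oplus>\<^bsub>M\<^esub>i\<in>{..<n}. c i \<odot>\<^bsub>M\<^esub> b i)"
    and indep: "\<And>c d i. c \<in> {..<n} \<rightarrow> carrier R \<Longrightarrow> d \<in> {..<n} \<rightarrow> carrier R \<Longrightarrow> i < n \<Longrightarrow>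
        (\<Oplus>\<^bsub>M\<^esub>i\<in>{..<n}. c i \<odot>\<^bsub>M\<^esub> b i) = (\<Oplus>\<^bsub>M\<^esub>i\<in>{..<n}. d i \<odot>\<^bsub>M\<^esub> b i) \<Longrightarrow> c i = d i"
  shows "module_basis R M n b"
  unfolding module_basis_def
proof (intro conjI ballI assms(2))
  interpret module R M by fact
  fix x assume "x \<in> carrier M"
  then obtain c where c: "c \<in> {..<n} \<rightarrow> carrier R" and x: "x = (\<Oplus>\<^bsub>M\<^esub>i\<in>{..<n}. c i \<odot>\<^bsub>M\<^esub> b i)"
    using span by blast
  show "\<exists>!c. c \<in> {..<n} \<rightarrow>\<^sub>E carrier R \<and> x = (\<Oplus>\<^bsub>M\<^esub>i\<in>{..<n}. c i \<odot>\<^bsub>M\<^esub> b i)"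
  proof (intro ex1I[of _ "restrict c {..<n}"] conjI)
    show "restrict c {..<n} \<in> {..<n} \<rightarrow>\<^sub>E carrier R" using c by (simp only: restrict_PiE_iff) auto
    show "x = (\<Oplus>\<^bsub>M\<^esub>i\<in>{..<n}. restrict c {..<n} i \<odot>\<^bsub>M\<^esub> b i)"
      unfolding x using c assms(2) by (intro M.finsum_cong' refl) (auto simp: Pi_iff)
    fix d assume d: "d \<in> {..<n} \<rightarrow>\<^sub>E carrier R \<and> x = (\<Oplus>\<^bsub>M\<^esub>i\<in>{..<n}. d i \<odot>\<^bsub>M\<^esub> b i)"
    then have "d i = c i" if "i < n" for i
      using indep[OF _ c that, of d] x by (auto simp: PiE_def)
    then show "d = restrict c {..<n}"
      using d by (auto simp: fun_eq_iff PiE_def extensional_def)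
  qed
qed

locale based_module = module +
  fixes n :: nat and b :: "nat \<Rightarrow> 'c"
  assumes basis: "module_basis R M n b"
begin

lemma basis_in: "b \<in> {..<n} \<rightarrow> carrier M"
  using basis by (simp add: module_basis_def)

lemma basis_closed: "i < n \<Longrightarrow> b i \<in> carrier M"
  using basis_in by auto

lemma coords_spec:
  assumes "x \<in> carrier M"
  shows "coords R M n b x \<in> {..<n} \<rightarrow>\<^sub>E carrier R \<and>
    x = (\<Oplus>\<^bsub>M\<^esub>i\<in>{..<n}. coords R M n b x i \<odot>\<^bsub>M\<^esub> b i)"
proof -
  have "\<exists>!c. c \<in> {..<n} \<rightarrow>\<^sub>E carrier R \<and> x = (\<Oplus>\<^bsub>M\<^esub>i\<in>{..<n}. c i \<odot>\<^bsub>M\<^esub> b i)"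
    using basis assms by (simp add: module_basis_def)
  from theI'[OF this] show ?thesis by (simp only: coords_def)
qed

lemma coords_closed: "x \<in> carrier M \<Longrightarrow> i < n \<Longrightarrow> coords R M n b x i \<in> carrier R"
  using coords_spec by (auto simp: PiE_iff)

lemma lincomb_coords: "x \<in> carrier M \<Longrightarrow> (\<Oplus>\<^bsub>M\<^esub>i\<in>{..<n}. coords R M n b x i \<odot>\<^bsub>M\<^esub> b i) = x"
  using coords_spec by auto

lemma lincomb_closed:
  "c \<in> {..<n} \<rightarrow> carrier R \<Longrightarrow> (\<Oplus>\<^bsub>M\<^esub>i\<in>{..<n}. c i \<odot>\<^bsub>M\<^esub> b i) \<in> carrier M"
  using basis_in by (intro M.finsum_closed) (auto simp: Pi_iff)

lemma coords_lincomb: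
  assumes c: "c \<in> {..<n} \<rightarrow> carrier R" and i: "i < n"
  shows "coords R M n b (\<Oplus>\<^bsub>M\<^esub>i\<in>{..<n}. c i \<odot>\<^bsub>M\<^esub> b i) i = c i"
proof -
  let ?x = "\<Oplus>\<^bsub>M\<^esub>i\<in>{..<n}. c i \<odot>\<^bsub>M\<^esub> b i"
  have x: "?x \<in> carrier M" using c by (rule lincomb_closed)
  have r: "restrict c {..<n} \<in> {..<n} \<rightarrow>\<^sub>E carrier R" using c by (simp only: restrict_PiE_iff) auto
  have "?x = (\<Oplus>\<^bsub>M\<^esub>i\<in>{..<n}. restrict c {..<n} i \<odot>\<^bsub>M\<^esub> b i)"
    using c basis_in by (intro M.finsum_cong' refl) (auto simp: Pi_iff)
  then have "coords R M n b ?x = restrict c {..<n}"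
    using coords_spec[OF x] r basis x unfolding module_basis_def by blast
  then show ?thesis using i by simp
qed

lemma coords_basis: "i < n \<Longrightarrow> j < n \<Longrightarrow> coords R M n b (b j) i = (if i = j then \<one> else \<zero>)"
proof -
  assume ij: "i < n" "j < n"
  have "(\<Oplus>\<^bsub>M\<^esub>i\<in>{..<n}. (if i = j then \<one> else \<zero>) \<odot>\<^bsub>M\<^esub> b i)
      = (\<Oplus>\<^bsub>M\<^esub>i\<in>{..<n}. if i = j then b i else \<zero>\<^bsub>M\<^esub>)"
    using basis_in by (intro M.finsum_cong' refl) (auto simp: Pi_iff)
  also have "\<dots> = b j" using ij basis_in by (intro M.add.finprod_singleton_swap) auto
  finally show ?thesis
    using coords_lincomb[of "\<lambda>i. if i = j then \<one> else \<zero>" i] ij by (simp add: Pi_iff)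
qed

lemma coords_linear:
  assumes "i < n"
  shows "linear_functional R M (\<lambda>x. coords R M n b x i)"
  unfolding linear_functional_def
proof (intro conjI ballI)
  show "(\<lambda>x. coords R M n b x i) \<in> carrier M \<rightarrow> carrier R" using coords_closed assms by auto
  fix x assume x: "x \<in> carrier M"
  let ?c = "coords R M n b x"
  have c: "?c \<in> {..<n} \<rightarrow> carrier R" using coords_closed[OF x] by auto
  {
    fix y assume y: "y \<in> carrier M"
    let ?d = "coords R M n b y"
    have d: "?d \<in> {..<n} \<rightarrow> carrier R" using coords_closed[OF y] by auto
    have "(\<Oplus>\<^bsub>M\<^esub>i\<in>{..<n}. (?c i \<oplus> ?d i) \<odot>\<^bsub>M\<^esub> b i)
        = (\<Oplus>\<^bsub>M\<^esub>i\<in>{..<n}. ?c i \<odot>\<^bsub>M\<^esub> b i \<oplus>\<^bsub>M\<^esub> ?d i \<odot>\<^bsub>M\<^esub> b i)"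
      using c d basis_in by (intro M.finsum_cong' refl) (auto simp: Pi_iff smult_l_distr)
    also have "\<dots> = (\<Oplus>\<^bsub>M\<^esub>i\<in>{..<n}. ?c i \<odot>\<^bsub>M\<^esub> b i) \<oplus>\<^bsub>M\<^esub> (\<Oplus>\<^bsub>M\<^esub>i\<in>{..<n}. ?d i \<odot>\<^bsub>M\<^esub> b i)"
      using c d basis_in by (intro M.finsum_addf) (auto simp: Pi_iff)
    also have "\<dots> = x \<oplus>\<^bsub>M\<^esub> y" using x y by (simp add: lincomb_coords)
    finally show "coords R M n b (x \<oplus>\<^bsub>M\<^esub> y) i = ?c i \<oplus> ?d i"
      using coords_lincomb[of "\<lambda>i. ?c i \<oplus> ?d i", OF _ assms] c d by (simp add: Pi_iff)
  next
    fix a assume a: "a \<in> carrier R"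
    have "a \<odot>\<^bsub>M\<^esub> x = (\<Oplus>\<^bsub>M\<^esub>i\<in>{..<n}. a \<odot>\<^bsub>M\<^esub> (?c i \<odot>\<^bsub>M\<^esub> b i))"
      using finsum_smult_ldistr[of "{..<n}" a "\<lambda>i. ?c i \<odot>\<^bsub>M\<^esub> b i"] a c basis_in
      by (simp add: lincomb_coords[OF x] Pi_iff)
    also have "\<dots> = (\<Oplus>\<^bsub>M\<^esub>i\<in>{..<n}. (a \<otimes> ?c i) \<odot>\<^bsub>M\<^esub> b i)"
      using a c basis_in by (intro M.finsum_cong' refl) (auto simp: Pi_iff smult_assoc1)
    finally show "coords R M n b (a \<odot>\<^bsub>M\<^esub> x) i = a \<otimes> ?c i"
      using coords_lincomb[of "\<lambda>i. a \<otimes> ?c i", OF _ assms] a c by (simp add: Pi_iff)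
  }
qed

lemma linear_map_eqI:
  assumes X: "linear_map R M M X" and Y: "linear_map R M M Y"
    and eq: "\<And>i. i < n \<Longrightarrow> X (b i) = Y (b i)" and x: "x \<in> carrier M"
  shows "X x = Y x"
proof -
  let ?c = "coords R M n b x"
  have c: "?c \<in> {..<n} \<rightarrow> carrier R" using coords_closed[OF x] by auto
  have "X x = (\<Oplus>\<^bsub>M\<^esub>i\<in>{..<n}. ?c i \<odot>\<^bsub>M\<^esub> X (b i))"
    using linear_map_lincomb[OF module_axioms X _ c basis_in] by (simp add: lincomb_coords[OF x])
  also have "\<dots> = (\<Oplus>\<^bsub>M\<^esub>i\<in>{..<n}. ?c i \<odot>\<^bsub>M\<^esub> Y (b i))"
    using c eq linear_mapD(1)[OF Y basis_closed]
    by (intro M.finsum_cong' refl) (auto simp: Pi_iff)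
  also have "\<dots> = Y x"
    using linear_map_lincomb[OF module_axioms Y _ c basis_in] by (simp add: lincomb_coords[OF x])
  finally show ?thesis .
qed

end

lemma linear_functional_lincomb:
  assumes "module R M" and f: "linear_functional R M f"
    and "finite A" "c \<in> A \<rightarrow> carrier R" "v \<in> A \<rightarrow> carrier M"
  shows "f (\<Oplus>\<^bsub>M\<^esub>i\<in>A. c i \<odot>\<^bsub>M\<^esub> v i) = (\<Oplus>\<^bsub>R\<^esub>i\<in>A. c i \<otimes>\<^bsub>R\<^esub> f (v i))"
proof -
  interpret module R M by fact
  have f1: "x \<in> carrier M \<Longrightarrow> f x \<in> carrier R"
    "x \<in> carrier M \<Longrightarrow> y \<in> carrier M \<Longrightarrow> f (x \<oplus>\<^bsub>M\<^esub> y) = f x \<oplus>\<^bsub>R\<^esub> f y"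
    "a \<in> carrier R \<Longrightarrow> x \<in> carrier M \<Longrightarrow> f (a \<odot>\<^bsub>M\<^esub> x) = a \<otimes>\<^bsub>R\<^esub> f x" for x y a
    using f by (auto simp: linear_functional_def)
  have f0: "f \<zero>\<^bsub>M\<^esub> = \<zero>\<^bsub>R\<^esub>"
    using f1(3)[of "\<zero>\<^bsub>R\<^esub>" "\<zero>\<^bsub>M\<^esub>"] f1(1)[of "\<zero>\<^bsub>M\<^esub>"] by simp
  show ?thesis using assms(3-5)
  proof (induction A)
    case (insert a A)
    have 1: "c a \<odot>\<^bsub>M\<^esub> v a \<in> carrier M" "c a \<otimes>\<^bsub>R\<^esub> f (v a) \<in> carrier R"
      "f (c a \<odot>\<^bsub>M\<^esub> v a) = c a \<otimes>\<^bsub>R\<^esub> f (v a)"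
      using insert.prems f1 by auto
    have 2: "(\<lambda>i. c i \<odot>\<^bsub>M\<^esub> v i) \<in> A \<rightarrow> carrier M" "(\<lambda>i. c i \<otimes>\<^bsub>R\<^esub> f (v i)) \<in> A \<rightarrow> carrier R"
      using insert.prems f1(1) by (auto simp: Pi_iff)
    have "f (\<Oplus>\<^bsub>M\<^esub>i\<in>A. c i \<odot>\<^bsub>M\<^esub> v i) = (\<Oplus>\<^bsub>R\<^esub>i\<in>A. c i \<otimes>\<^bsub>R\<^esub> f (v i))"
      using insert by (simp add: Pi_iff)
    then show ?case
      using insert.hyps 1 2 f1(2) by (simp add: M.finsum_insert R.finsum_insert M.finsum_closed)
  qed (simp add: f0)
qed

text \<open>The columns of matrices may be taken with respect to two different bases.  The case \<open>b' = b\<close> gives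
the matrix of a composition, the case of the identity map gives the change of coordinates.\<close>

lemma coords_linear_map:
  assumes "based_module R M n b" "based_module R M n b'" and X: "linear_map R M M X"
    and y: "y \<in> carrier M" and i: "i < n"
  shows "coords R M n b' (X y) i
    = (\<Oplus>\<^bsub>R\<^esub>k\<in>{..<n}. coords R M n b' (X (b k)) i \<otimes>\<^bsub>R\<^esub> coords R M n b y k)"
proof -
  interpret B: based_module R M n b by fact
  interpret B': based_module R M n b' by fact
  let ?c = "coords R M n b y"
  have c: "?c \<in> {..<n} \<rightarrow> carrier R" using B.coords_closed[OF y] by auto
  have Xb: "(\<lambda>i. X (b i)) \<in> {..<n} \<rightarrow> carrier M" using linear_mapD(1)[OF X] B.basis_closed by auto
  have "X y = (\<Oplus>\<^bsub>M\<^esub>k\<in>{..<n}. ?c k \<odot>\<^bsub>M\<^esub> X (b k))"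
    using B.linear_map_lincomb[OF B.module_axioms X _ c B.basis_in] by (simp add: B.lincomb_coords[OF y])
  then have "coords R M n b' (X y) i = (\<Oplus>\<^bsub>R\<^esub>k\<in>{..<n}. ?c k \<otimes>\<^bsub>R\<^esub> coords R M n b' (X (b k)) i)"
    using linear_functional_lincomb[OF B.module_axioms B'.coords_linear[OF i] _ c Xb] by simp
  also have "\<dots> = (\<Oplus>\<^bsub>R\<^esub>k\<in>{..<n}. coords R M n b' (X (b k)) i \<otimes>\<^bsub>R\<^esub> ?c k)"
    using c Xb B'.coords_closed i by (intro B.R.finsum_cong' refl) (auto simp: Pi_iff B.R.m_comm)
  finally show ?thesis .
qed

lemma linear_map_ident: "linear_map R M M (\<lambda>x. x)"
  by (auto simp: linear_map_def)

context based_module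
begin

lemma mat_closed:
  assumes "linear_map R M M X"
  shows "(\<lambda>i j. coords R M n b (X (b j)) i) \<in> {..<n} \<rightarrow> {..<n} \<rightarrow> carrier R"
  using coords_closed linear_mapD(1)[OF assms] basis_closed by auto

lemma based_module: "based_module R M n b"
  by (rule based_module_axioms)

text \<open>With \<open>P\<close> and \<open>Q\<close> the two matrices of the change of basis, the new matrix is \<open>Q A P\<close>, and \<open>Q P = 1\<close>.\<close>

lemma leibniz_det_change_basis:
  assumes "module_basis R M n b'" and X: "linear_map R M M X"
  shows "leibniz_det R n (\<lambda>i j. coords R M n b' (X (b' j)) i)
    = leibniz_det R n (\<lambda>i j. coords R M n b (X (b j)) i)"
proof -
  interpret B': based_module R M n b' by unfold_locales fact
  note cl = linear_map_ident[of R M]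
  let ?co = "coords R M n b" and ?co' = "coords R M n b'"
  let ?Q = "\<lambda>i j. ?co' (b j) i" and ?P = "\<lambda>i j. ?co (b' j) i"
  let ?A = "\<lambda>i j. ?co (X (b j)) i" and ?A' = "\<lambda>i j. ?co' (X (b' j)) i"
  have Q: "?Q \<in> {..<n} \<rightarrow> {..<n} \<rightarrow> carrier R" using B'.coords_closed basis_closed by auto
  have P: "?P \<in> {..<n} \<rightarrow> {..<n} \<rightarrow> carrier R" using coords_closed B'.basis_closed by auto
  have A: "?A \<in> {..<n} \<rightarrow> {..<n} \<rightarrow> carrier R" by (rule mat_closed[OF X])
  have QA: "(\<lambda>i j. \<Oplus>k\<in>{..<n}. ?Q i k \<otimes> ?A k j) \<in> {..<n} \<rightarrow> {..<n} \<rightarrow> carrier R"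
    using Q A by (auto intro!: R.finsum_closed simp: Pi_iff)
  have "leibniz_det R n ?A' = leibniz_det R n (\<lambda>i j. \<Oplus>l\<in>{..<n}. (\<Oplus>k\<in>{..<n}. ?Q i k \<otimes> ?A k l) \<otimes> ?P l j)"
  proof (rule R.leibniz_det_cong)
    fix i j assume ij: "i < n" "j < n"
    have "?A' i j = (\<Oplus>l\<in>{..<n}. ?co' (X (b l)) i \<otimes> ?P l j)"
      using coords_linear_map[OF based_module B'.based_module X B'.basis_closed[OF ij(2)] ij(1)] .
    also have "\<dots> = (\<Oplus>l\<in>{..<n}. (\<Oplus>k\<in>{..<n}. ?Q i k \<otimes> ?A k l) \<otimes> ?P l j)"
    proof (intro R.finsum_cong' refl)
      fix l assume "l \<in> {..<n}"
      then show "?co' (X (b l)) i \<otimes> ?P l j = (\<Oplus>k\<in>{..<n}. ?Q i k \<otimes> ?A k l) \<otimes> ?P l j"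
        using coords_linear_map[OF based_module B'.based_module cl linear_mapD(1)[OF X basis_closed] ij(1), of l]
        by simp
    qed (use QA P ij in \<open>auto simp: Pi_iff\<close>)
    finally show "?A' i j = (\<Oplus>l\<in>{..<n}. (\<Oplus>k\<in>{..<n}. ?Q i k \<otimes> ?A k l) \<otimes> ?P l j)" .
  qed (use QA P in \<open>auto intro!: R.finsum_closed R.m_closed simp: Pi_iff\<close>)
  also have "\<dots> = (leibniz_det R n ?Q \<otimes> leibniz_det R n ?A) \<otimes> leibniz_det R n ?P"
    using R.leibniz_det_mult[OF QA P] R.leibniz_det_mult[OF Q A] by simp
  also have "\<dots> = (leibniz_det R n ?Q \<otimes> leibniz_det R n ?P) \<otimes> leibniz_det R n ?A"
    using Q P A by (simp add: R.leibniz_det_closed R.m_ac)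
  also have "leibniz_det R n ?Q \<otimes> leibniz_det R n ?P = \<one>"
  proof -
    have "leibniz_det R n (\<lambda>i j. \<Oplus>k\<in>{..<n}. ?Q i k \<otimes> ?P k j) = leibniz_det R n (\<lambda>i j. if i = j then \<one> else \<zero>)"
    proof (rule R.leibniz_det_cong)
      fix i j assume "i < n" "j < n"
      then show "(\<Oplus>k\<in>{..<n}. ?Q i k \<otimes> ?P k j) = (if i = j then \<one> else \<zero>)"
        using coords_linear_map[OF based_module B'.based_module cl B'.basis_closed, of j i]
        by (simp add: B'.coords_basis)
    qed auto
    then show ?thesis by (simp add: R.leibniz_det_mult[OF Q P] R.leibniz_det_one)
  qed
  finally show ?thesis using R.leibniz_det_closed[OF A] by simp
qed

text \<open>Independence of the basis is what makes the description in the definition of \<^const>\<open>endo_det\<close>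
definite.\<close>

lemma endo_det_eq:
  assumes "linear_map R M M X"
  shows "endo_det R M n X = leibniz_det R n (\<lambda>i j. coords R M n b (X (b j)) i)"
  unfolding endo_det_def using basis leibniz_det_change_basis[OF _ assms] by (intro the_equality) blast+

lemma endo_det_closed: "linear_map R M M X \<Longrightarrow> endo_det R M n X \<in> carrier R"
  using R.leibniz_det_closed[OF mat_closed] by (simp add: endo_det_eq)

lemma endo_det_comp:
  assumes X: "linear_map R M M X" and Y: "linear_map R M M Y" and Z: "linear_map R M M Z"
    and eq: "\<And>x. x \<in> carrier M \<Longrightarrow> Z x = X (Y x)"
  shows "endo_det R M n Z = endo_det R M n X \<otimes> endo_det R M n Y"
proof -
  have "endo_det R M n Z = leibniz_det R n
      (\<lambda>i j. \<Oplus>k\<in>{..<n}. coords R M n b (X (b k)) i \<otimes> coords R M n b (Y (b j)) k)"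
    unfolding endo_det_eq[OF Z]
    using coords_linear_map[OF based_module based_module X linear_mapD(1)[OF Y]] eq basis_closed
      mat_closed[OF X] mat_closed[OF Y]
    by (intro R.leibniz_det_cong) (auto intro!: R.finsum_closed R.m_closed simp: Pi_iff)
  then show ?thesis
    using R.leibniz_det_mult[OF mat_closed[OF X] mat_closed[OF Y]] by (simp add: endo_det_eq X Y)
qed

end


section \<open>Free modules modulo an ideal\<close>

lemma linear_functional_axpy:
  assumes "module R M" "linear_functional R M f" "a \<in> carrier R" "x \<in> carrier M" "y \<in> carrier M"
  shows "f (x \<oplus>\<^bsub>M\<^esub> a \<odot>\<^bsub>M\<^esub> y) = f x \<oplus>\<^bsub>R\<^esub> a \<otimes>\<^bsub>R\<^esub> f y"
proof -
  interpret module R M by fact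
  show ?thesis using assms by (simp add: linear_functional_def)
qed

lemma (in abelian_subgroup) coset_eq_iff:
  assumes "u \<in> carrier G" "v \<in> carrier G"
  shows "H +> u = H +> v \<longleftrightarrow> u \<ominus> v \<in> H"
proof
  assume "H +> u = H +> v"
  then have "u \<in> H +> v" using a_rcos_self[OF assms(1)] by simp
  then show "u \<ominus> v \<in> H" using assms by (simp add: a_rcos_module_imp a_minus_def)
next
  assume "u \<ominus> v \<in> H"
  then have "u \<in> H +> v" using assms by (simp add: a_rcos_module a_minus_def)
  then show "H +> u = H +> v" using a_repr_independence[OF _ assms(2) a_subgroup] by simp
qed

locale module_mod_ideal = module R M + I: ideal I R for R (structure) and M (structure) and I
begin

abbreviation N where "N \<equiv> ideal_smult I M"
abbreviation Q where "Q \<equiv> quot_module M I"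
abbreviation cls where "cls a \<equiv> I +>\<^bsub>R\<^esub> a"
abbreviation proj where "proj v \<equiv> N +>\<^bsub>M\<^esub> v"

sublocale N: abelian_subgroup N M
  by (rule ideal_smult_abelian_subgroup[OF module_axioms I.ideal_axioms])

sublocale cls: ring_hom_cring R "R Quot I" "(+>\<^bsub>R\<^esub>) I"
  by (rule I.rcos_ring_hom_cring[OF R.is_cring])

lemma cls_closed: "a \<in> carrier R \<Longrightarrow> cls a \<in> carrier (R Quot I)"
  by (rule cls.hom_closed)

lemma cls_surj:
  assumes "A \<in> carrier (R Quot I)"
  obtains a where "a \<in> carrier R" "A = cls a"
  using assms unfolding FactRing_def A_RCOSETS_def' by auto

lemma proj_closed: "v \<in> carrier M \<Longrightarrow> proj v \<in> carrier Q"
  by (simp add: quot_module_def M.a_rcosetsI[OF N.a_subset])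

lemma proj_surj:
  assumes "U \<in> carrier Q"
  obtains v where "v \<in> carrier M" "U = proj v"
  using assms unfolding quot_module_def A_RCOSETS_def' by auto

lemma proj_add: "u \<in> carrier M \<Longrightarrow> v \<in> carrier M \<Longrightarrow> proj (u \<oplus>\<^bsub>M\<^esub> v) = proj u \<oplus>\<^bsub>Q\<^esub> proj v"
  using N.a_rcos_sum by (simp add: quot_module_def)

lemma proj_smult: "a \<in> carrier R \<Longrightarrow> v \<in> carrier M \<Longrightarrow> proj (a \<odot>\<^bsub>M\<^esub> v) = cls a \<odot>\<^bsub>Q\<^esub> proj v"
  using quot_module_smult_coset[OF module_axioms I.ideal_axioms] by simp

lemma proj_zero: "proj \<zero>\<^bsub>M\<^esub> = \<zero>\<^bsub>Q\<^esub>"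
  using M.a_coset_join2[OF _ N.a_subgroup] by (simp add: quot_module_def)

lemma quot_abelian_group: "abelian_group Q"
proof (rule abelian_groupI)
  fix U W assume "U \<in> carrier Q" "W \<in> carrier Q"
  then obtain u w where uw: "u \<in> carrier M" "U = proj u" "w \<in> carrier M" "W = proj w"
    by (metis proj_surj)
  then show "U \<oplus>\<^bsub>Q\<^esub> W \<in> carrier Q" "U \<oplus>\<^bsub>Q\<^esub> W = W \<oplus>\<^bsub>Q\<^esub> U"
    by (simp_all add: proj_add[symmetric] proj_closed M.a_comm)
  fix Z assume "Z \<in> carrier Q"
  then obtain z where "z \<in> carrier M" "Z = proj z" by (metis proj_surj)
  with uw show "U \<oplus>\<^bsub>Q\<^esub> W \<oplus>\<^bsub>Q\<^esub> Z = U \<oplus>\<^bsub>Q\<^esub> (W \<oplus>\<^bsub>Q\<^esub> Z)"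
    by (simp add: proj_add[symmetric] M.a_assoc)
next
  show "\<zero>\<^bsub>Q\<^esub> \<in> carrier Q" by (simp add: proj_zero[symmetric] proj_closed)
  fix U assume "U \<in> carrier Q"
  then obtain u where u: "u \<in> carrier M" "U = proj u" by (metis proj_surj)
  then show "\<zero>\<^bsub>Q\<^esub> \<oplus>\<^bsub>Q\<^esub> U = U" by (simp add: proj_zero[symmetric] proj_add[symmetric])
  have "proj (\<ominus>\<^bsub>M\<^esub> u) \<oplus>\<^bsub>Q\<^esub> U = \<zero>\<^bsub>Q\<^esub>"
    using u by (simp add: proj_zero[symmetric] proj_add[symmetric] M.l_neg)
  then show "\<exists>W\<in>carrier Q. W \<oplus>\<^bsub>Q\<^esub> U = \<zero>\<^bsub>Q\<^esub>"
    by (rule bexI[OF _ proj_closed[OF M.a_inv_closed[OF u(1)]]])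
qed

lemma quot_module: "module (R Quot I) Q"
proof (rule moduleI[OF cls.S.is_cring quot_abelian_group])
  fix A B U W
  assume "A \<in> carrier (R Quot I)" "U \<in> carrier Q"
  then obtain a u where au: "a \<in> carrier R" "A = cls a" "u \<in> carrier M" "U = proj u"
    by (metis cls_surj proj_surj)
  then show "A \<odot>\<^bsub>Q\<^esub> U \<in> carrier Q" by (simp add: proj_smult[symmetric] proj_closed)
  {
    assume "B \<in> carrier (R Quot I)"
    then obtain b where b: "b \<in> carrier R" "B = cls b" by (metis cls_surj)
    show "(A \<oplus>\<^bsub>R Quot I\<^esub> B) \<odot>\<^bsub>Q\<^esub> U = A \<odot>\<^bsub>Q\<^esub> U \<oplus>\<^bsub>Q\<^esub> B \<odot>\<^bsub>Q\<^esub> U"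
      using au b by (simp add: proj_smult[symmetric] proj_add[symmetric] smult_l_distr flip: cls.hom_add)
    show "(A \<otimes>\<^bsub>R Quot I\<^esub> B) \<odot>\<^bsub>Q\<^esub> U = A \<odot>\<^bsub>Q\<^esub> (B \<odot>\<^bsub>Q\<^esub> U)"
      using au b by (simp add: proj_smult[symmetric] smult_assoc1 flip: cls.hom_mult)
  next
    assume "W \<in> carrier Q"
    then obtain w where w: "w \<in> carrier M" "W = proj w" by (metis proj_surj)
    show "A \<odot>\<^bsub>Q\<^esub> (U \<oplus>\<^bsub>Q\<^esub> W) = A \<odot>\<^bsub>Q\<^esub> U \<oplus>\<^bsub>Q\<^esub> A \<odot>\<^bsub>Q\<^esub> W"
      using au w by (simp add: proj_smult[symmetric] proj_add[symmetric] smult_r_distr)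
  }
next
  fix U assume "U \<in> carrier Q"
  then obtain u where "u \<in> carrier M" "U = proj u" by (metis proj_surj)
  then show "\<one>\<^bsub>R Quot I\<^esub> \<odot>\<^bsub>Q\<^esub> U = U" by (simp add: proj_smult[symmetric] flip: cls.hom_one)
qed

sublocale Q: module "R Quot I" Q
  by (rule quot_module)

lemma proj_lincomb:
  assumes "finite A" "c \<in> A \<rightarrow> carrier R" "v \<in> A \<rightarrow> carrier M"
  shows "proj (\<Oplus>\<^bsub>M\<^esub>i\<in>A. c i \<odot>\<^bsub>M\<^esub> v i) = (\<Oplus>\<^bsub>Q\<^esub>i\<in>A. cls (c i) \<odot>\<^bsub>Q\<^esub> proj (v i))"
  using assms
proof (induction A)
  case (insert a A)
  have "(\<lambda>i. c i \<odot>\<^bsub>M\<^esub> v i) \<in> A \<rightarrow> carrier M" "(\<lambda>i. cls (c i) \<odot>\<^bsub>Q\<^esub> proj (v i)) \<in> A \<rightarrow> carrier Q"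
    using insert.prems proj_closed by (auto simp: Pi_iff)
  then show ?case
    using insert by (simp add: M.finsum_insert Q.M.finsum_insert M.finsum_closed Pi_iff proj_add proj_smult proj_closed)
qed (simp add: proj_zero)

lemma linear_reduction:
  assumes X: "linear_map R M M X"
  shows "linear_map (R Quot I) Q Q (reduction M I X)"
proof -
  note red = reduction_coset[OF module_axioms I.ideal_axioms X]
  note X' = linear_mapD[OF X]
  show ?thesis unfolding linear_map_def
  proof (intro conjI ballI Pi_I)
    fix U assume "U \<in> carrier Q"
    then obtain u where u: "u \<in> carrier M" "U = proj u" by (metis proj_surj)
    then show "reduction M I X U \<in> carrier Q" using X' by (simp add: red proj_closed)
    {
      fix W assume "W \<in> carrier Q"
      then obtain w where w: "w \<in> carrier M" "W = proj w" by (metis proj_surj)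
      show "reduction M I X (U \<oplus>\<^bsub>Q\<^esub> W) = reduction M I X U \<oplus>\<^bsub>Q\<^esub> reduction M I X W"
        using u w X' by (simp add: proj_add[symmetric] red)
    next
      fix A assume "A \<in> carrier (R Quot I)"
      then obtain a where a: "a \<in> carrier R" "A = cls a" by (metis cls_surj)
      show "reduction M I X (A \<odot>\<^bsub>Q\<^esub> U) = A \<odot>\<^bsub>Q\<^esub> reduction M I X U"
        using u a X' by (simp add: proj_smult[symmetric] red)
    }
  qed
qed

text \<open>Independence of the classes holds because coordinates are linear functionals, and a linear functional
maps \<open>I M\<close> into \<open>I\<close>.\<close>

lemma quot_basis:
  assumes "module_basis R M n b"
  shows "module_basis (R Quot I) Q n (\<lambda>i. proj (b i))"
proof -
  interpret B: based_module R M n b by unfold_locales fact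
  have lift: "\<exists>c\<in>{..<n} \<rightarrow> carrier R. \<forall>i<n. C i = cls (c i)"
    if "C \<in> {..<n} \<rightarrow> carrier (R Quot I)" for C
  proof -
    have "\<exists>a. a \<in> carrier R \<and> C i = cls a" if i: "i \<in> {..<n}" for i
    proof -
      obtain a where "a \<in> carrier R" "C i = cls a"
        using cls_surj[OF Pi_mem[OF \<open>C \<in> _\<close> i]] by metis
      then show ?thesis by (intro exI conjI)
    qed
    then have "\<forall>i\<in>{..<n}. \<exists>a. a \<in> carrier R \<and> C i = cls a" by blast
    then obtain c where "\<forall>i\<in>{..<n}. c i \<in> carrier R \<and> C i = cls (c i)" by metis
    then show ?thesis by (intro bexI[of _ c]) auto
  qed
  have sum: "(\<Oplus>\<^bsub>Q\<^esub>i\<in>{..<n}. C i \<odot>\<^bsub>Q\<^esub> proj (b i)) = proj (\<Oplus>\<^bsub>M\<^esub>i\<in>{..<n}. c i \<odot>\<^bsub>M\<^esub> b i)"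
    if "c \<in> {..<n} \<rightarrow> carrier R" "\<forall>i<n. C i = cls (c i)" for c C
  proof -
    have "(\<Oplus>\<^bsub>Q\<^esub>i\<in>{..<n}. C i \<odot>\<^bsub>Q\<^esub> proj (b i)) = (\<Oplus>\<^bsub>Q\<^esub>i\<in>{..<n}. cls (c i) \<odot>\<^bsub>Q\<^esub> proj (b i))"
      using that B.basis_closed by (intro Q.M.finsum_cong' refl) (auto simp: Pi_iff proj_closed)
    then show ?thesis using proj_lincomb[OF _ that(1) B.basis_in] by simp
  qed
  show ?thesis
  proof (rule module_basisI[OF quot_module])
    show "(\<lambda>i. proj (b i)) \<in> {..<n} \<rightarrow> carrier Q" using B.basis_closed proj_closed by auto
    fix U assume "U \<in> carrier Q"
    then obtain u where u: "u \<in> carrier M" "U = proj u" by (metis proj_surj)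
    let ?c = "coords R M n b u"
    have "?c \<in> {..<n} \<rightarrow> carrier R" using B.coords_closed u by auto
    from sum[OF this, of "\<lambda>i. cls (?c i)"]
    show "\<exists>c\<in>{..<n} \<rightarrow> carrier (R Quot I). U = (\<Oplus>\<^bsub>Q\<^esub>i\<in>{..<n}. c i \<odot>\<^bsub>Q\<^esub> proj (b i))"
      using u B.coords_closed cls_closed by (intro bexI[of _ "\<lambda>i. cls (?c i)"]) (auto simp: B.lincomb_coords)
  next
    fix C D i
    assume CD: "C \<in> {..<n} \<rightarrow> carrier (R Quot I)" "D \<in> {..<n} \<rightarrow> carrier (R Quot I)" and i: "i < n"
      and eq: "(\<Oplus>\<^bsub>Q\<^esub>i\<in>{..<n}. C i \<odot>\<^bsub>Q\<^esub> proj (b i)) = (\<Oplus>\<^bsub>Q\<^esub>i\<in>{..<n}. D i \<odot>\<^bsub>Q\<^esub> proj (b i))"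
    obtain c where c: "c \<in> {..<n} \<rightarrow> carrier R" "\<forall>i<n. C i = cls (c i)" using lift[OF CD(1)] by blast
    obtain d where d: "d \<in> {..<n} \<rightarrow> carrier R" "\<forall>i<n. D i = cls (d i)" using lift[OF CD(2)] by blast
    let ?x = "\<Oplus>\<^bsub>M\<^esub>i\<in>{..<n}. c i \<odot>\<^bsub>M\<^esub> b i" and ?y = "\<Oplus>\<^bsub>M\<^esub>i\<in>{..<n}. d i \<odot>\<^bsub>M\<^esub> b i"
    have xy: "?x \<in> carrier M" "?y \<in> carrier M" using c d B.lincomb_closed by auto
    have ci: "c i \<in> carrier R" "d i \<in> carrier R" using c d i by auto
    have "proj ?x = proj ?y" using eq unfolding sum[OF c] sum[OF d] .
    then have "?x \<ominus>\<^bsub>M\<^esub> ?y \<in> N" using N.coset_eq_iff[OF xy] by simp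
    moreover have "?x \<ominus>\<^bsub>M\<^esub> ?y = ?x \<oplus>\<^bsub>M\<^esub> (\<ominus> \<one>) \<odot>\<^bsub>M\<^esub> ?y"
      using xy by (simp add: a_minus_def smult_l_minus)
    ultimately have "coords R M n b (?x \<oplus>\<^bsub>M\<^esub> (\<ominus> \<one>) \<odot>\<^bsub>M\<^esub> ?y) i \<in> I"
      using linear_functional_ideal_smult[OF module_axioms I.ideal_axioms B.coords_linear[OF i]] by simp
    moreover have "coords R M n b (?x \<oplus>\<^bsub>M\<^esub> (\<ominus> \<one>) \<odot>\<^bsub>M\<^esub> ?y) i = c i \<oplus> (\<ominus> \<one>) \<otimes> d i"
      using linear_functional_axpy[OF module_axioms B.coords_linear[OF i] _ xy, of "\<ominus> \<one>"]
      by (simp only: B.coords_lincomb[OF c(1) i] B.coords_lincomb[OF d(1) i]) simp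
    ultimately have "c i \<ominus> d i \<in> I" using ci by (simp add: a_minus_def R.l_minus)
    then show "C i = D i" using I.coset_eq_iff[OF ci] c d i by simp
  qed
qed

lemma coords_proj:
  assumes "module_basis R M n b" "x \<in> carrier M" "i < n"
  shows "coords (R Quot I) Q n (\<lambda>i. proj (b i)) (proj x) i = cls (coords R M n b x i)"
proof -
  interpret B: based_module R M n b by unfold_locales fact
  interpret QB: based_module "R Quot I" Q n "\<lambda>i. proj (b i)" by unfold_locales (rule quot_basis[OF assms(1)])
  let ?c = "coords R M n b x"
  have c: "?c \<in> {..<n} \<rightarrow> carrier R" using B.coords_closed assms(2) by auto
  have "proj x = (\<Oplus>\<^bsub>Q\<^esub>i\<in>{..<n}. cls (?c i) \<odot>\<^bsub>Q\<^esub> proj (b i))"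
    using proj_lincomb[OF _ c B.basis_in] by (simp add: B.lincomb_coords[OF assms(2)])
  then show ?thesis using QB.coords_lincomb[of "\<lambda>i. cls (?c i)", OF _ assms(3)] c by (simp add: Pi_iff cls_closed)
qed

text \<open>The determinant commutes with ring homomorphisms, and the matrix of the reduced map is the reduced
matrix.\<close>

lemma endo_det_reduction:
  assumes b: "module_basis R M n b" and X: "linear_map R M M X"
  shows "endo_det (R Quot I) Q n (reduction M I X) = cls (endo_det R M n X)"
proof -
  interpret B: based_module R M n b by unfold_locales fact
  interpret QB: based_module "R Quot I" Q n "\<lambda>i. proj (b i)" by unfold_locales (rule quot_basis[OF b])
  have "endo_det (R Quot I) Q n (reduction M I X)
      = leibniz_det (R Quot I) n (\<lambda>i j. cls (coords R M n b (X (b j)) i))"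
    unfolding QB.endo_det_eq[OF linear_reduction[OF X]]
  proof (rule cls.S.leibniz_det_cong)
    fix i j assume "i < n" "j < n"
    then show "coords (R Quot I) Q n (\<lambda>i. proj (b i)) (reduction M I X (proj (b j))) i
      = cls (coords R M n b (X (b j)) i)"
      using reduction_coset[OF module_axioms I.ideal_axioms X B.basis_closed]
        coords_proj[OF b linear_mapD(1)[OF X B.basis_closed]] by simp
  qed (use B.mat_closed[OF X] in \<open>auto simp: Pi_iff cls_closed\<close>)
  also have "\<dots> = cls (endo_det R M n X)"
    unfolding B.endo_det_eq[OF X] using cls.hom_leibniz_det[OF B.mat_closed[OF X]] by simp
  finally show ?thesis .
qed

end


section \<open>Unitary groups and quasi-reflections\<close>

context cring
begin

text \<open>The computation by which quasi-reflections preserve the form: \<open>C\<close> stands for \<open>star c\<close>, \<open>p\<close> for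
\<open>star (h x u)\<close>, \<open>q\<close> for \<open>h x v\<close>, \<open>e\<close> for \<open>h x x\<close> and \<open>k\<close> for \<open>h u v\<close>.\<close>

lemma isometry_identity:
  assumes "p \<in> carrier R" "q \<in> carrier R" "c \<in> carrier R" "C \<in> carrier R" "e \<in> carrier R" "k \<in> carrier R"
    and "C \<oplus> c \<otimes> C \<otimes> e = c"
  shows "k \<oplus> (c \<otimes> q) \<otimes> (\<ominus> p) \<oplus> (C \<otimes> p) \<otimes> (q \<oplus> (c \<otimes> q) \<otimes> e) = k"
proof -
  have "k \<oplus> (c \<otimes> q) \<otimes> (\<ominus> p) \<oplus> (C \<otimes> p) \<otimes> (q \<oplus> (c \<otimes> q) \<otimes> e)
      = k \<oplus> ((\<ominus> c) \<otimes> q \<otimes> p \<oplus> (C \<oplus> c \<otimes> C \<otimes> e) \<otimes> q \<otimes> p)"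
    using assms(1-6) by (simp add: l_distr r_distr l_minus r_minus m_ac a_ac)
  also have "\<dots> = k" using assms by (simp add: l_minus l_neg)
  finally show ?thesis .
qed

text \<open>The isometry condition for the constant \<open>- 1 / Q\<close> of a swap, where \<open>Q\<close> stands for \<open>star q\<close>; for
isotropic \<open>u\<close> and \<open>w\<close> with \<open>h u w = q\<close>, the vector \<open>w - u\<close> pairs with itself to \<open>Q - q\<close>.\<close>

lemma swap_identity:
  assumes "q \<in> Units R" "Q \<in> Units R"
  shows "\<ominus> (inv q) \<oplus> (\<ominus> (inv Q)) \<otimes> (\<ominus> (inv q)) \<otimes> (Q \<ominus> q) = \<ominus> (inv Q)"
proof -
  have gen: "\<ominus> a \<oplus> (\<ominus> b) \<otimes> (\<ominus> a) \<otimes> (Q \<ominus> q) = \<ominus> a \<oplus> a \<otimes> (b \<otimes> Q) \<ominus> b \<otimes> (a \<otimes> q)"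
    if "a \<in> carrier R" "b \<in> carrier R" "q \<in> carrier R" "Q \<in> carrier R" for a b q Q
    using that by (simp add: minus_eq r_distr l_minus r_minus m_ac a_ac)
  have "inv q \<in> carrier R" "inv Q \<in> carrier R" "q \<in> carrier R" "Q \<in> carrier R"
    using assms by auto
  from gen[OF this] show ?thesis
    using assms by (simp add: a_minus_def l_neg)
qed

end

locale skew_hermitian_module = module R M for R (structure) and M (structure) +
  fixes star :: "'a \<Rightarrow> 'a" and h :: "'c \<Rightarrow> 'c \<Rightarrow> 'a"
  assumes involution: "ring_involution R star"
    and form: "skew_hermitian_form R star M h"
begin

lemma star_hom: "star \<in> ring_hom R R"
  using involution by (simp add: ring_involution_def ring_iso_def)

sublocale star: ring_hom_cring R R star
  by (intro ring_hom_cringI ring_hom_ringI2 R.ring_axioms R.is_cring star_hom)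

lemma star_star [simp]: "a \<in> carrier R \<Longrightarrow> star (star a) = a"
  using involution by (simp add: ring_involution_def)

lemma star_Units: "a \<in> Units R \<Longrightarrow> star a \<in> Units R"
  unfolding Units_def by (auto simp flip: star.hom_mult)
    (metis star.hom_closed star.hom_mult star.hom_one)

lemma star_inv: "a \<in> Units R \<Longrightarrow> star (inv a) = inv (star a)"
proof -
  assume a: "a \<in> Units R"
  then have "star (inv a) \<otimes> star a = \<one>" "star a \<otimes> star (inv a) = \<one>"
    by (simp_all add: R.Units_closed flip: star.hom_mult)
  then show ?thesis using a by (metis R.Units_closed R.Units_inv_closed R.comm_inv_char star.hom_closed)
qed

lemma h_linear: "u \<in> carrier M \<Longrightarrow> linear_functional R M (h u)"
  using form by (simp add: skew_hermitian_form_def)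

lemma h_closed [simp]: "u \<in> carrier M \<Longrightarrow> v \<in> carrier M \<Longrightarrow> h u v \<in> carrier R"
  using h_linear[of u] by (auto simp: linear_functional_def)

lemma h_add_r: "u \<in> carrier M \<Longrightarrow> v \<in> carrier M \<Longrightarrow> w \<in> carrier M \<Longrightarrow>
    h u (v \<oplus>\<^bsub>M\<^esub> w) = h u v \<oplus> h u w"
  using h_linear[of u] by (auto simp: linear_functional_def)

lemma h_smult_r: "a \<in> carrier R \<Longrightarrow> u \<in> carrier M \<Longrightarrow> v \<in> carrier M \<Longrightarrow>
    h u (a \<odot>\<^bsub>M\<^esub> v) = a \<otimes> h u v"
  using h_linear[of u] by (auto simp: linear_functional_def)

lemma h_add_l: "u \<in> carrier M \<Longrightarrow> v \<in> carrier M \<Longrightarrow> w \<in> carrier M \<Longrightarrow>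
    h (u \<oplus>\<^bsub>M\<^esub> v) w = h u w \<oplus> h v w"
  using form by (auto simp: skew_hermitian_form_def)

lemma star_h: "u \<in> carrier M \<Longrightarrow> v \<in> carrier M \<Longrightarrow> star (h u v) = \<ominus> h v u"
  using form by (auto simp: skew_hermitian_form_def)

lemma h_swap: "u \<in> carrier M \<Longrightarrow> v \<in> carrier M \<Longrightarrow> h v u = \<ominus> star (h u v)"
  by (simp add: star_h)

text \<open>Linearity in the second variable turns into semilinearity in the first, because \<open>star\<close> exchanges the
variables up to sign.\<close>

lemma h_smult_l:
  assumes "a \<in> carrier R" "u \<in> carrier M" "v \<in> carrier M"
  shows "h (a \<odot>\<^bsub>M\<^esub> u) v = star a \<otimes> h u v"
  using assms h_swap[of v "a \<odot>\<^bsub>M\<^esub> u"] h_swap[of v u] by (simp add: h_smult_r R.r_minus)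

lemma h_Units_swap:
  "u \<in> carrier M \<Longrightarrow> v \<in> carrier M \<Longrightarrow> h u v \<in> Units R \<Longrightarrow> h v u \<in> Units R"
  using star_Units[of "h u v"] star_h[of u v] R.Units_minus_one_closed R.Units_m_closed[of "\<ominus> \<one>" "\<ominus> h v u"]
  by (simp add: R.l_minus)

lemma h_zero_swap: "u \<in> carrier M \<Longrightarrow> v \<in> carrier M \<Longrightarrow> h u v = \<zero> \<Longrightarrow> h v u = \<zero>"
  by (simp add: h_swap[of u v])

lemma h_minus_r: "u \<in> carrier M \<Longrightarrow> v \<in> carrier M \<Longrightarrow> w \<in> carrier M \<Longrightarrow>
    h u (v \<ominus>\<^bsub>M\<^esub> w) = h u v \<oplus> \<ominus> h u w"
  using h_smult_r[of "\<ominus> \<one>" u w] by (simp add: a_minus_def h_add_r smult_l_minus R.l_minus)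

lemma h_minus_l: "u \<in> carrier M \<Longrightarrow> v \<in> carrier M \<Longrightarrow> w \<in> carrier M \<Longrightarrow>
    h (u \<ominus>\<^bsub>M\<^esub> v) w = h u w \<oplus> \<ominus> h v w"
  using h_smult_l[of "\<ominus> \<one>" v w] by (simp add: a_minus_def h_add_l smult_l_minus R.l_minus)


abbreviation U where "U \<equiv> unitary_group R M h"

lemma in_U_iff: "X \<in> carrier U \<longleftrightarrow> X \<in> Bij (carrier M) \<and> linear_map R M M X \<and>
    (\<forall>u\<in>carrier M. \<forall>v\<in>carrier M. h (X u) (X v) = h u v)"
  by (simp add: unitary_group_def)

lemma U_closed: "X \<in> carrier U \<Longrightarrow> v \<in> carrier M \<Longrightarrow> X v \<in> carrier M"
  using linear_mapD(1)[of R M M X v] by (simp add: in_U_iff)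

lemma U_isometry: "X \<in> carrier U \<Longrightarrow> u \<in> carrier M \<Longrightarrow> v \<in> carrier M \<Longrightarrow> h (X u) (X v) = h u v"
  by (simp add: in_U_iff)

lemma in_U_I:
  assumes "X \<in> extensional (carrier M)" and X: "linear_map R M M X"
    and iso: "\<And>u v. u \<in> carrier M \<Longrightarrow> v \<in> carrier M \<Longrightarrow> h (X u) (X v) = h u v"
    and Y: "\<And>v. v \<in> carrier M \<Longrightarrow> Y v \<in> carrier M" "\<And>v. v \<in> carrier M \<Longrightarrow> X (Y v) = v"
      "\<And>v. v \<in> carrier M \<Longrightarrow> Y (X v) = v"
  shows "X \<in> carrier U"
proof -
  have "bij_betw X (carrier M) (carrier M)"
    using linear_mapD(1)[OF X] Y by (intro bij_betw_byWitness[of _ Y]) auto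
  then show ?thesis using assms by (simp add: in_U_iff Bij_def)
qed

lemma U_mult: "X \<in> carrier U \<Longrightarrow> Y \<in> carrier U \<Longrightarrow> X \<otimes>\<^bsub>U\<^esub> Y = compose (carrier M) X Y"
  by (simp add: unitary_group_def BijGroup_def)

lemma U_mult_apply:
  "X \<in> carrier U \<Longrightarrow> Y \<in> carrier U \<Longrightarrow> v \<in> carrier M \<Longrightarrow> (X \<otimes>\<^bsub>U\<^esub> Y) v = X (Y v)"
  by (simp add: U_mult compose_def)

lemma U_one: "\<one>\<^bsub>U\<^esub> = (\<lambda>v\<in>carrier M. v)"
  by (simp add: unitary_group_def BijGroup_def)

lemma U_eqI:
  assumes "X \<in> carrier U" "Y \<in> carrier U" "\<And>v. v \<in> carrier M \<Longrightarrow> X v = Y v"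
  shows "X = Y"
  using assms by (auto simp: in_U_iff Bij_def intro: extensionalityI)

lemma U_group: "group U"
proof -
  interpret B: group "BijGroup (carrier M)" by (rule group_BijGroup)
  let ?H = "carrier U"
  have "subgroup ?H (BijGroup (carrier M))"
  proof (rule B.subgroupI)
    show "?H \<subseteq> carrier (BijGroup (carrier M))" by (auto simp: in_U_iff BijGroup_def)
    have "(\<lambda>v\<in>carrier M. v) \<in> ?H"
      by (rule in_U_I[where Y = "\<lambda>v. v"]) (auto simp: linear_map_def)
    then show "?H \<noteq> {}" by blast
    fix X assume X: "X \<in> ?H"
    have bij: "X \<in> Bij (carrier M)" using X by (simp add: in_U_iff)
    define Y where "Y = (\<lambda>v\<in>carrier M. inv_into (carrier M) X v)"
    have lin: "linear_map R M M X" using X by (simp add: in_U_iff)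
    have Yc: "Y v \<in> carrier M" and XY: "X (Y v) = v" and YX: "Y (X v) = v" if "v \<in> carrier M" for v
    proof -
      have bb: "bij_betw X (carrier M) (carrier M)" using bij by (simp add: Bij_def)
      show "Y v \<in> carrier M" using Bij_inv_into_mem[OF bij that] that by (simp add: Y_def)
      show "X (Y v) = v" using bij_betw_inv_into_right[OF bb that] that by (simp add: Y_def)
      show "Y (X v) = v" using bij_betw_inv_into_left[OF bb that] U_closed[OF X that] by (simp add: Y_def)
    qed
    have inj: "u = v" if "u \<in> carrier M" "v \<in> carrier M" "X u = X v" for u v
      using that YX by metis
    have "Y \<in> ?H"
    proof (rule in_U_I[where Y = X])
      show "linear_map R M M Y"
        unfolding linear_map_def
      proof (intro conjI ballI)
        show "Y \<in> carrier M \<rightarrow> carrier M" using Yc by blast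
        fix u assume u: "u \<in> carrier M"
        {
          fix v assume v: "v \<in> carrier M"
          show "Y (u \<oplus>\<^bsub>M\<^esub> v) = Y u \<oplus>\<^bsub>M\<^esub> Y v"
            by (rule inj) (use u v Yc XY linear_mapD(2)[OF lin, of "Y u" "Y v"] in simp_all)
        next
          fix a assume a: "a \<in> carrier R"
          show "Y (a \<odot>\<^bsub>M\<^esub> u) = a \<odot>\<^bsub>M\<^esub> Y u"
            by (rule inj) (use u a Yc XY linear_mapD(3)[OF lin, of a "Y u"] in simp_all)
        }
      qed
      fix u v assume uv: "u \<in> carrier M" "v \<in> carrier M"
      then show "h (Y u) (Y v) = h u v"
        using U_isometry[OF X Yc[OF uv(1)] Yc[OF uv(2)]] by (simp only: XY)
    qed (use XY YX U_closed[OF X] in \<open>auto simp: Y_def\<close>)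
    then show "inv\<^bsub>BijGroup (carrier M)\<^esub> X \<in> ?H" using bij by (simp add: inv_BijGroup Y_def)
    fix Z assume Z: "Z \<in> ?H"
    have "compose (carrier M) X Z \<in> ?H"
      using X Z compose_Bij[of X "carrier M" Z] by (auto simp: in_U_iff linear_map_def compose_def Pi_iff)
    then show "X \<otimes>\<^bsub>BijGroup (carrier M)\<^esub> Z \<in> ?H"
      using X Z by (simp add: BijGroup_def in_U_iff)
  qed
  then have "group (BijGroup (carrier M)\<lparr>carrier := ?H\<rparr>)" by (rule B.subgroup_imp_group)
  then show ?thesis by (simp add: unitary_group_def)
qed

sublocale U: group U by (rule U_group)


text \<open>These maps comprise the transvections, where \<open>h x x = 0\<close>, as well as the hermitian analogues of
reflections, where \<open>h x x\<close> is a unit.  The vector \<open>x\<close> of a swap may be of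
neither kind.\<close>

definition quasi_reflection :: "'a \<Rightarrow> 'c \<Rightarrow> 'c \<Rightarrow> 'c" where
  "quasi_reflection c x = (\<lambda>v\<in>carrier M. v \<oplus>\<^bsub>M\<^esub> (c \<otimes> h x v) \<odot>\<^bsub>M\<^esub> x)"

lemma quasi_reflection_apply:
  "v \<in> carrier M \<Longrightarrow> quasi_reflection c x v = v \<oplus>\<^bsub>M\<^esub> (c \<otimes> h x v) \<odot>\<^bsub>M\<^esub> x"
  by (simp add: quasi_reflection_def)

lemma quasi_reflection_closed:
  "c \<in> carrier R \<Longrightarrow> x \<in> carrier M \<Longrightarrow> v \<in> carrier M \<Longrightarrow> quasi_reflection c x v \<in> carrier M"
  by (simp add: quasi_reflection_apply)

lemma quasi_reflection_linear:
  assumes "c \<in> carrier R" "x \<in> carrier M"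
  shows "linear_map R M M (quasi_reflection c x)"
proof -
  have "(c \<otimes> (p \<oplus> q)) \<odot>\<^bsub>M\<^esub> x = (c \<otimes> p) \<odot>\<^bsub>M\<^esub> x \<oplus>\<^bsub>M\<^esub> (c \<otimes> q) \<odot>\<^bsub>M\<^esub> x"
    if "p \<in> carrier R" "q \<in> carrier R" for p q
    using that assms by (simp add: R.r_distr smult_l_distr)
  moreover have "(c \<otimes> (a \<otimes> p)) \<odot>\<^bsub>M\<^esub> x = a \<odot>\<^bsub>M\<^esub> ((c \<otimes> p) \<odot>\<^bsub>M\<^esub> x)"
    if "p \<in> carrier R" "a \<in> carrier R" for p a
    using that assms by (simp add: R.m_lcomm flip: smult_assoc1)
  ultimately show ?thesis
    using assms by (auto simp: linear_map_def quasi_reflection_apply h_add_r h_smult_r M.a_ac smult_r_distr)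
qed

lemma quasi_reflection_cancel:
  assumes "c \<in> carrier R" "d \<in> carrier R" "x \<in> carrier M" "v \<in> carrier M"
    and "c \<oplus> d \<oplus> d \<otimes> c \<otimes> h x x = \<zero>"
  shows "quasi_reflection d x (quasi_reflection c x v) = v"
proof -
  have ring: "c \<otimes> p \<oplus> d \<otimes> (p \<oplus> (c \<otimes> p) \<otimes> e) = (c \<oplus> d \<oplus> d \<otimes> c \<otimes> e) \<otimes> p"
    if "c \<in> carrier R" "d \<in> carrier R" "p \<in> carrier R" "e \<in> carrier R" for c d p e
    using that by (simp add: R.l_distr R.r_distr R.m_ac R.a_ac)
  have "quasi_reflection d x (quasi_reflection c x v)
      = v \<oplus>\<^bsub>M\<^esub> (c \<otimes> h x v \<oplus> d \<otimes> (h x v \<oplus> (c \<otimes> h x v) \<otimes> h x x)) \<odot>\<^bsub>M\<^esub> x"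
    using assms(1-4) quasi_reflection_closed[of c x v]
    by (simp add: quasi_reflection_apply h_add_r h_smult_r smult_l_distr M.a_assoc)
  also have "\<dots> = v" using assms by (simp only: ring h_closed) simp
  finally show ?thesis .
qed

text \<open>The inverse is the quasi-reflection along \<open>x\<close> with constant \<open>- star c\<close>.\<close>

lemma quasi_reflection_in_U:
  assumes c: "c \<in> carrier R" and x: "x \<in> carrier M"
    and eq: "star c \<oplus> c \<otimes> star c \<otimes> h x x = c"
  shows "quasi_reflection c x \<in> carrier U"
proof (rule in_U_I)
  have e: "h x x \<in> carrier R" and C: "star c \<in> carrier R" using x c by auto
  have eq': "c \<oplus> \<ominus> C \<oplus> (\<ominus> C) \<otimes> c \<otimes> e = c \<ominus> (C \<oplus> c \<otimes> C \<otimes> e)"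
      "\<ominus> C \<oplus> c \<oplus> c \<otimes> (\<ominus> C) \<otimes> e = \<ominus> (C \<oplus> c \<otimes> C \<otimes> e) \<oplus> c"
    if "c \<in> carrier R" "C \<in> carrier R" "e \<in> carrier R" for c C e
    using that by (simp_all add: R.minus_eq R.minus_add R.l_minus R.r_minus R.m_ac R.a_ac)
  have 1: "c \<oplus> \<ominus> star c \<oplus> (\<ominus> star c) \<otimes> c \<otimes> h x x = \<zero>" "\<ominus> star c \<oplus> c \<oplus> c \<otimes> (\<ominus> star c) \<otimes> h x x = \<zero>"
    unfolding eq'[OF c C e] eq using c by (simp_all add: a_minus_def R.r_neg R.l_neg)
  show "quasi_reflection c x \<in> extensional (carrier M)" by (simp add: quasi_reflection_def)
  show "linear_map R M M (quasi_reflection c x)" using c x by (rule quasi_reflection_linear)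
  show "quasi_reflection (\<ominus> star c) x v \<in> carrier M" if "v \<in> carrier M" for v
    using that c x by (simp add: quasi_reflection_closed)
  show "quasi_reflection c x (quasi_reflection (\<ominus> star c) x v) = v"
    "quasi_reflection (\<ominus> star c) x (quasi_reflection c x v) = v" if "v \<in> carrier M" for v
    using that c x 1 by (auto intro!: quasi_reflection_cancel)
  fix u v assume uv: "u \<in> carrier M" "v \<in> carrier M"
  let ?p = "h x u" and ?q = "h x v"
  have "h (quasi_reflection c x u) (quasi_reflection c x v)
      = h u v \<oplus> (c \<otimes> ?q) \<otimes> (\<ominus> star ?p) \<oplus> (star c \<otimes> star ?p) \<otimes> (?q \<oplus> (c \<otimes> ?q) \<otimes> h x x)"
    using uv c x by (simp add: quasi_reflection_apply h_add_l h_add_r h_smult_l h_smult_r h_swap[of x u] R.r_distr R.a_ac R.m_ac)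
  also have "\<dots> = h u v"
    using uv c x eq by (intro R.isometry_identity) auto
  finally show "h (quasi_reflection c x u) (quasi_reflection c x v) = h u v" .
qed

text \<open>The constant \<open>c\<close> is chosen so that \<open>u\<close> goes to \<open>u + (w - u)\<close>, that is, \<open>c h (w - u) u = 1\<close>; here
\<open>h (w - u) u = - star (h u w)\<close> for isotropic \<open>u\<close>.\<close>

definition swap :: "'c \<Rightarrow> 'c \<Rightarrow> 'c \<Rightarrow> 'c" where
  "swap u w = quasi_reflection (\<ominus> (inv (star (h u w)))) (w \<ominus>\<^bsub>M\<^esub> u)"

definition hyperbolic :: "'c \<Rightarrow> 'c \<Rightarrow> bool" where
  "hyperbolic u w \<longleftrightarrow> u \<in> carrier M \<and> w \<in> carrier M \<and> h u u = \<zero> \<and> h w w = \<zero> \<and> h u w \<in> Units R"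

lemma hyperbolic_sym: "hyperbolic u w \<Longrightarrow> hyperbolic w u"
  by (auto simp: hyperbolic_def h_Units_swap)

lemma swap_in_U:
  assumes "hyperbolic u w"
  shows "swap u w \<in> carrier U"
  unfolding swap_def
proof (rule quasi_reflection_in_U)
  let ?q = "h u w"
  note uw = assms[unfolded hyperbolic_def]
  have q: "?q \<in> Units R" "star ?q \<in> Units R" using uw star_Units by auto
  show "\<ominus> (inv (star ?q)) \<in> carrier R" "w \<ominus>\<^bsub>M\<^esub> u \<in> carrier M" using q uw by auto
  have "h (w \<ominus>\<^bsub>M\<^esub> u) (w \<ominus>\<^bsub>M\<^esub> u) = star ?q \<ominus> ?q"
    using uw by (simp add: h_minus_l h_minus_r h_swap[of u w] R.minus_eq[of "star _"] R.a_comm)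
  moreover have "star (\<ominus> (inv (star ?q))) = \<ominus> (inv ?q)"
    using q uw by (simp add: star_inv)
  ultimately show "star (\<ominus> (inv (star ?q))) \<oplus> \<ominus> (inv (star ?q)) \<otimes> star (\<ominus> (inv (star ?q)))
      \<otimes> h (w \<ominus>\<^bsub>M\<^esub> u) (w \<ominus>\<^bsub>M\<^esub> u) = \<ominus> (inv (star ?q))"
    using R.swap_identity[OF q] by simp
qed

lemma swap_apply:
  assumes "hyperbolic u w"
  shows "swap u w u = w"
proof -
  let ?q = "h u w"
  note uw = assms[unfolded hyperbolic_def]
  have q: "?q \<in> Units R" "star ?q \<in> Units R" using uw star_Units by auto
  have "h (w \<ominus>\<^bsub>M\<^esub> u) u = \<ominus> star ?q" using uw by (simp add: h_minus_l h_swap[of u w])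
  then have "(\<ominus> (inv (star ?q))) \<otimes> h (w \<ominus>\<^bsub>M\<^esub> u) u = \<one>"
    using q uw by (simp add: R.l_minus R.r_minus)
  then have "swap u w u = u \<oplus>\<^bsub>M\<^esub> (w \<ominus>\<^bsub>M\<^esub> u)" using uw by (simp add: swap_def quasi_reflection_apply)
  then show ?thesis using uw by (simp add: a_minus_def M.a_comm[of w "\<ominus>\<^bsub>M\<^esub> u"] M.r_neg2)
qed

lemma swap_fix:
  assumes "hyperbolic u w" "z \<in> carrier M" "h u z = h w z"
  shows "swap u w z = z"
proof -
  note uw = assms(1)[unfolded hyperbolic_def]
  have q: "star (h u w) \<in> Units R" using uw star_Units by auto
  have "h (w \<ominus>\<^bsub>M\<^esub> u) z = \<zero>" using uw assms by (simp add: h_minus_l R.r_neg)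
  then show ?thesis using uw assms(2) q by (simp add: swap_def quasi_reflection_apply)
qed

abbreviation swaps where "swaps \<equiv> {swap u w |u w. hyperbolic u w}"

lemma swaps_subset: "swaps \<subseteq> carrier U"
  using swap_in_U by auto

lemma generated_in_U: "g \<in> generate U swaps \<Longrightarrow> g \<in> carrier U"
  using U.generate_in_carrier[OF swaps_subset] .

text \<open>The detour through \<open>y\<close> serves to move \<open>u\<close> to \<open>w\<close> when \<open>h u w\<close> is not a unit.\<close>

lemma swap_two:
  assumes "hyperbolic u y" "hyperbolic y w"
  shows "\<exists>g\<in>generate U swaps. g u = w \<and> (\<forall>z\<in>carrier M. h u z = h y z \<longrightarrow> h w z = h y z \<longrightarrow> g z = z)"
proof (intro bexI conjI ballI impI)
  have g: "swap y w \<in> carrier U" "swap u y \<in> carrier U" using assms swap_in_U by auto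
  show "swap y w \<otimes>\<^bsub>U\<^esub> swap u y \<in> generate U swaps"
    using assms by (intro generate.eng generate.incl) auto
  have u: "u \<in> carrier M" using assms by (simp add: hyperbolic_def)
  show "(swap y w \<otimes>\<^bsub>U\<^esub> swap u y) u = w"
    using U_mult_apply[OF g u] by (simp add: swap_apply assms)
  fix z assume z: "z \<in> carrier M" "h u z = h y z" "h w z = h y z"
  show "(swap y w \<otimes>\<^bsub>U\<^esub> swap u y) z = z"
    using U_mult_apply[OF g z(1)] z by (simp add: swap_fix assms)
qed

lemma swap_one:
  assumes "hyperbolic u w"
  shows "\<exists>g\<in>generate U swaps. g u = w \<and> (\<forall>z\<in>carrier M. h u z = h w z \<longrightarrow> g z = z)"
  using assms swap_apply swap_fix by (intro bexI[of _ "swap u w"]) (auto intro: generate.incl)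

end


section \<open>Generation of unitary groups over local rings\<close>

text \<open>Local rings, described by their units instead of their maximal ideal.\<close>

locale nonunits_ideal = cring +
  assumes zero_not_unit: "\<zero> \<notin> Units R"
    and unit_summand: "a \<in> carrier R \<Longrightarrow> b \<in> carrier R \<Longrightarrow> a \<oplus> b \<in> Units R \<Longrightarrow> a \<in> Units R \<or> b \<in> Units R"
begin

lemma unit_finsum:
  assumes "finite A" "f \<in> A \<rightarrow> carrier R" "(\<Oplus>i\<in>A. f i) \<in> Units R"
  shows "\<exists>i\<in>A. f i \<in> Units R"
  using assms
proof (induction A)
  case empty
  then show ?case using zero_not_unit by simp
next
  case (insert a A)
  then have "f a \<in> Units R \<or> (\<Oplus>i\<in>A. f i) \<in> Units R"
    by (intro unit_summand) (auto simp: finsum_insert finsum_closed Pi_iff)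
  then show ?case using insert by auto
qed

end

locale symplectic_module = skew_hermitian_module +
  fixes m :: nat and b :: "nat \<Rightarrow> 'c"
  assumes symplectic: "symplectic_basis R M h m b"
begin

sublocale B: based_module R M "2 * m" b
  using symplectic by unfold_locales (simp add: symplectic_basis_def)

lemma gram_even: 
  assumes "i < m" "j < 2 * m"
  shows "h (b (2 * i)) (b j) = (if j = 2 * i + 1 then \<one> else \<zero>)"
proof (cases "even j")
  case True
  then obtain l where "j = 2 * l" by blast
  then show ?thesis using symplectic assms by (auto simp: symplectic_basis_def) presburger
next
  case False
  then obtain l where "j = 2 * l + 1" by (rule oddE)
  then show ?thesis using symplectic assms by (cases "i = l") (auto simp: symplectic_basis_def)
qed

lemma gram_odd:
  assumes "i < m" "j < 2 * m"
  shows "h (b (2 * i + 1)) (b j) = (if j = 2 * i then \<ominus> \<one> else \<zero>)"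
proof (cases "even j")
  case True
  then obtain l where l: "j = 2 * l" by blast
  have "h (b (2 * l)) (b (2 * i + 1)) = (if 2 * i + 1 = 2 * l + 1 then \<one> else \<zero>)"
    using l assms by (intro gram_even) auto
  then show ?thesis
    using assms l h_swap[of "b (2 * l)" "b (2 * i + 1)"] B.basis_closed[of "2 * l"] B.basis_closed[of "2 * i + 1"]
    by auto
next
  case False
  then obtain l where "j = 2 * l + 1" by (rule oddE)
  then show ?thesis using symplectic assms by (auto simp: symplectic_basis_def) presburger
qed

lemma basis_isotropic: "i < 2 * m \<Longrightarrow> h (b i) (b i) = \<zero>"
proof -
  assume i: "i < 2 * m"
  show ?thesis
  proof (cases "even i")
    case True
    then obtain l where "i = 2 * l" by blast
    then show ?thesis using gram_even[of l i] i by simp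
  next
    case False
    then obtain l where "i = 2 * l + 1" by (rule oddE)
    then show ?thesis using gram_odd[of l i] i by simp
  qed
qed

end

locale local_symplectic_module = symplectic_module R M star h m b + nonunits_ideal R
  for R (structure) and M (structure) and star h m b
begin

text \<open>The pairing of \<open>w\<close> with any \<open>u\<close> is a combination of its pairings with the basis vectors, and the
nonunits form an ideal.\<close>

lemma unit_coordinate:
  assumes uw: "u \<in> carrier M" "w \<in> carrier M" "h w u \<in> Units R"
  shows "\<exists>i<2 * m. h (b i) w \<in> Units R"
proof -
  let ?c = "coords R M (2 * m) b u"
  have c: "?c \<in> {..<2 * m} \<rightarrow> carrier R" using B.coords_closed uw by auto
  have "h w u = (\<Oplus>i\<in>{..<2 * m}. ?c i \<otimes> h w (b i))"
    using linear_functional_lincomb[OF module_axioms h_linear[OF uw(2)] _ c B.basis_in]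
    by (simp add: B.lincomb_coords uw(1))
  then obtain i where i: "i < 2 * m" "?c i \<otimes> h w (b i) \<in> Units R"
    using uw unit_finsum[of "{..<2 * m}" "\<lambda>i. ?c i \<otimes> h w (b i)"] c B.basis_closed by (auto simp: Pi_iff)
  have "?c i \<in> carrier R" "h w (b i) \<in> carrier R" using c i uw B.basis_closed by auto
  then have "h w (b i) \<in> Units R" using R.unit_factor[of "h w (b i)" "?c i"] i(2) by (simp add: R.m_comm)
  then show ?thesis using i(1) uw(2) B.basis_closed h_Units_swap by blast
qed

lemma U_hyperbolic:
  "X \<in> carrier U \<Longrightarrow> hyperbolic u w \<Longrightarrow> hyperbolic (X u) (X w)"
  by (simp add: hyperbolic_def U_closed U_isometry)

lemma hyperbolic_basis: "k < m \<Longrightarrow> hyperbolic (b (2 * k)) (b (2 * k + 1))"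
  using gram_even[of k "2 * k + 1"] basis_isotropic[of "2 * k"] basis_isotropic[of "2 * k + 1"]
    B.basis_closed[of "2 * k"] B.basis_closed[of "2 * k + 1"]
  by (simp add: hyperbolic_def)

text \<open>Let \<open>u\<close>, \<open>v\<close> be the hyperbolic pair of basis vectors number \<open>k\<close> and \<open>w = X u\<close>.  The image \<open>w\<close> is moved back to \<open>u\<close>
directly if \<open>h u w\<close> is a unit, through \<open>v\<close> if \<open>h v w\<close> is a unit, and otherwise through \<open>v + b i\<close>, where
\<open>b i\<close> is a basis vector whose pairing with \<open>w\<close> is a unit.  All these vectors are orthogonal to the
earlier basis vectors, which are therefore not moved.\<close>

lemma fix_next_even:
  assumes X: "X \<in> carrier U" and k: "k < m" and fixed: "\<And>i. i < 2 * k \<Longrightarrow> X (b i) = b i"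
  shows "\<exists>g\<in>generate U swaps. g (X (b (2 * k))) = b (2 * k) \<and> (\<forall>i<2 * k. g (b i) = b i)"
proof -
  let ?u = "b (2 * k)" and ?v = "b (2 * k + 1)"
  define w where "w = X ?u"
  have bc: "b i \<in> carrier M" if "i < 2 * m" for i using B.basis_closed that .
  have uv: "hyperbolic ?u ?v" by (rule hyperbolic_basis[OF k])
  have w: "hyperbolic w (X ?v)" unfolding w_def by (rule U_hyperbolic[OF X uv])
  have wc: "w \<in> carrier M" "h w w = \<zero>" using w by (auto simp: hyperbolic_def)
  have uvc: "?u \<in> carrier M" "?v \<in> carrier M" "h ?u ?u = \<zero>" "h ?v ?v = \<zero>" "h ?u ?v \<in> Units R"
    using uv by (auto simp: hyperbolic_def)
  have u0: "h ?u (b i) = \<zero>" if "i < 2 * k" for i using gram_even[of k i] that k by auto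
  have v0: "h ?v (b i) = \<zero>" if "i < 2 * k" for i using gram_odd[of k i] that k by auto
  have w0: "h w (b i) = \<zero>" if "i < 2 * k" for i
    using U_isometry[OF X uvc(1) bc[of i]] fixed[OF that] u0[OF that] that k by (simp add: w_def)
  have go: "\<exists>g\<in>generate U swaps. g w = ?u \<and> (\<forall>i<2 * k. g (b i) = b i)"
    if y: "hyperbolic ?u y" "h y w \<in> Units R" "\<And>i. i < 2 * k \<Longrightarrow> h y (b i) = \<zero>" for y
  proof -
    have "hyperbolic y w" using y wc by (simp add: hyperbolic_def)
    from swap_two[OF hyperbolic_sym[OF this] hyperbolic_sym[OF y(1)]] obtain g
      where g: "g \<in> generate U swaps" "g w = ?u"
        "\<And>z. z \<in> carrier M \<Longrightarrow> h w z = h y z \<Longrightarrow> h ?u z = h y z \<Longrightarrow> g z = z" by blast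
    have "g (b i) = b i" if "i < 2 * k" for i
      using that k w0 u0 y(3) bc by (intro g(3)) auto
    then show ?thesis using g by blast
  qed
  have "\<exists>g\<in>generate U swaps. g w = ?u \<and> (\<forall>i<2 * k. g (b i) = b i)"
  proof (cases "h ?u w \<in> Units R")
    case True
    then have "hyperbolic ?u w" using uvc wc by (simp add: hyperbolic_def)
    from swap_one[OF hyperbolic_sym[OF this]] obtain g
      where g: "g \<in> generate U swaps" "g w = ?u"
        "\<And>z. z \<in> carrier M \<Longrightarrow> h w z = h ?u z \<Longrightarrow> g z = z" by blast
    have "g (b i) = b i" if "i < 2 * k" for i
      using that k w0 u0 bc by (intro g(3)) auto
    then show ?thesis using g by blast
  next
    case nu: False
    show ?thesis
    proof (cases "h ?v w \<in> Units R")
      case True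
      then show ?thesis using go[OF uv] v0 by blast
    next
      case nv: False
      obtain i where i: "i < 2 * m" "h (b i) w \<in> Units R"
        using unit_coordinate[of "X ?v" w] w by (auto simp: hyperbolic_def)
      have iu: "i \<noteq> 2 * k" "i \<noteq> 2 * k + 1" using i nu nv by auto
      have "\<not> i < 2 * k"
        using w0[of i] h_zero_swap[of w "b i"] wc bc i zero_not_unit by auto
      then have ik: "2 * k + 1 < i" using iu by linarith
      let ?y = "?v \<oplus>\<^bsub>M\<^esub> b i"
      have vi: "h ?v (b i) = \<zero>" using gram_odd[OF k i(1)] ik by simp
      have iv: "h (b i) ?v = \<zero>" by (rule h_zero_swap[OF uvc(2) bc[OF i(1)] vi])
      have ui: "h ?u (b i) = \<zero>" using gram_even[OF k i(1)] ik by simp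
      show ?thesis
      proof (rule go[of ?y])
        show "hyperbolic ?u ?y"
          using uvc bc[OF i(1)] basis_isotropic[OF i(1)] vi iv ui
          by (simp add: hyperbolic_def h_add_l h_add_r)
        have "h (b i) w = h ?y w \<oplus> \<ominus> h ?v w"
          using uvc wc bc[OF i(1)] by (simp add: h_add_l R.a_ac R.r_neg R.r_neg1 R.r_neg2)
        then have "h ?y w \<in> Units R \<or> \<ominus> h ?v w \<in> Units R"
          using unit_summand[of "h ?y w" "\<ominus> h ?v w"] i(2) uvc wc bc[OF i(1)] by simp
        moreover have "h ?v w \<in> Units R" if "\<ominus> h ?v w \<in> Units R"
          using R.Units_m_closed[OF R.Units_minus_one_closed that] uvc wc by (simp add: R.l_minus)
        ultimately show "h ?y w \<in> Units R" using nv by blast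
        fix j assume j: "j < 2 * k"
        have "h (b i) (b j) = \<zero>"
        proof (rule h_zero_swap)
          define l where "l = j div 2"
          have "l < k" "j = 2 * l \<or> j = 2 * l + 1" using j unfolding l_def by presburger+
          then show "h (b j) (b i) = \<zero>"
            using gram_even[of l i] gram_odd[of l i] ik k i(1) by auto
        qed (use j k bc i in auto)
        then show "h ?y (b j) = \<zero>"
          using v0[OF j] uvc bc[OF i(1)] bc[of j] j k by (simp add: h_add_l)
      qed
    qed
  qed
  then show ?thesis by (simp add: w_def)
qed

text \<open>Now \<open>w = X v\<close> has the same pairing with \<open>u\<close> as \<open>v\<close>, so that a swap of \<open>w\<close> and \<open>v\<close> fixes \<open>u\<close>.  If \<open>h w v\<close> is not a
unit, the detour through \<open>v + u\<close> works: \<open>h w (v + u)\<close> differs from \<open>h w v\<close> by the unit \<open>- 1\<close>.\<close>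

lemma fix_next_odd:
  assumes X: "X \<in> carrier U" and k: "k < m" and fixed: "\<And>i. i < 2 * k + 1 \<Longrightarrow> X (b i) = b i"
  shows "\<exists>g\<in>generate U swaps. g (X (b (2 * k + 1))) = b (2 * k + 1) \<and> (\<forall>i<2 * k + 1. g (b i) = b i)"
proof -
  let ?u = "b (2 * k)" and ?v = "b (2 * k + 1)"
  define w where "w = X ?v"
  have bc: "b i \<in> carrier M" if "i < 2 * m" for i using B.basis_closed that .
  have uv: "hyperbolic ?u ?v" by (rule hyperbolic_basis[OF k])
  have uvc: "?u \<in> carrier M" "?v \<in> carrier M" "h ?u ?u = \<zero>" "h ?v ?v = \<zero>"
    using uv by (auto simp: hyperbolic_def)
  have wc: "w \<in> carrier M" "h w w = \<zero>"
    using U_hyperbolic[OF X uv] by (auto simp: hyperbolic_def w_def)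
  have wv: "h w (b i) = h ?v (b i)" if "i < 2 * k + 1" for i
    using U_isometry[OF X uvc(2) bc[of i]] fixed[OF that] that k by (simp add: w_def)
  have huv: "h ?u ?v = \<one>" and hvu: "h ?v ?u = \<ominus> \<one>"
    using gram_even[of k "2 * k + 1"] gram_odd[of k "2 * k"] k by auto
  have hwu: "h w ?u = \<ominus> \<one>" using wv[of "2 * k"] hvu by simp
  have huw: "h ?u w = \<one>" using h_swap[OF wc(1) uvc(1)] hwu by simp
  have "\<exists>g\<in>generate U swaps. g w = ?v \<and> (\<forall>i<2 * k + 1. g (b i) = b i)"
  proof (cases "h w ?v \<in> Units R")
    case True
    then have "hyperbolic w ?v" using uvc wc by (simp add: hyperbolic_def)
    from swap_one[OF this] obtain g
      where g: "g \<in> generate U swaps" "g w = ?v"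
        "\<And>z. z \<in> carrier M \<Longrightarrow> h w z = h ?v z \<Longrightarrow> g z = z" by blast
    have "g (b i) = b i" if "i < 2 * k + 1" for i
      using that k wv bc by (intro g(3)) auto
    then show ?thesis using g by blast
  next
    case False
    let ?y = "?v \<oplus>\<^bsub>M\<^esub> ?u"
    have y: "?y \<in> carrier M" "h ?y ?y = \<zero>"
      using uvc huv hvu by (simp_all add: h_add_l h_add_r R.r_neg R.l_neg)
    have "\<ominus> \<one> = h w ?y \<oplus> \<ominus> h w ?v"
      using uvc wc hwu by (simp add: h_add_r R.a_ac R.r_neg R.r_neg1 R.r_neg2)
    then have "h w ?y \<in> Units R \<or> \<ominus> h w ?v \<in> Units R"
      using unit_summand[of "h w ?y" "\<ominus> h w ?v"] uvc wc y R.Units_minus_one_closed by simp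
    moreover have "h w ?v \<in> Units R" if "\<ominus> h w ?v \<in> Units R"
      using R.Units_m_closed[OF R.Units_minus_one_closed that] uvc wc by (simp add: R.l_minus)
    ultimately have "hyperbolic w ?y" using False uvc wc y by (auto simp: hyperbolic_def)
    moreover have "hyperbolic ?y ?v"
      using y uvc huv by (simp add: hyperbolic_def h_add_l)
    ultimately obtain g where g: "g \<in> generate U swaps" "g w = ?v"
        "\<And>z. z \<in> carrier M \<Longrightarrow> h w z = h ?y z \<Longrightarrow> h ?v z = h ?y z \<Longrightarrow> g z = z"
      using swap_two[of w ?y ?v] by blast
    have "g (b i) = b i" if "i < 2 * k + 1" for i
    proof -
      have "h ?y (b i) = h ?v (b i)"
        using gram_even[of k i] uvc bc[of i] that k by (simp add: h_add_l)
      then show ?thesis using that k wv[OF that] bc[of i] by (intro g(3)) auto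
    qed
    then show ?thesis using g by blast
  qed
  then show ?thesis by (simp add: w_def)
qed

text \<open>After a product \<open>g\<close> of swaps, \<open>g X\<close> fixes one more basis vector; once it fixes all of them, it is the
identity and \<open>X = g\<inverse>\<close>.\<close>

theorem unitary_group_generated_by_swaps: "generate U swaps = carrier U"
proof (intro equalityI subsetI)
  fix X assume X: "X \<in> carrier U"
  have sub: "subgroup (generate U swaps) U"
    by (rule U.generate_is_subgroup[OF swaps_subset])
  have step: "\<exists>g\<in>generate U swaps. \<forall>i<Suc j. g (X (b i)) = b i"
    if g: "g \<in> generate U swaps" "\<forall>i<j. g (X (b i)) = b i" and j: "j < 2 * m" for g j
  proof -
    let ?Y = "g \<otimes>\<^bsub>U\<^esub> X"
    have gU: "g \<in> carrier U" using g generated_in_U by blast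
    have Y: "?Y \<in> carrier U" using gU X by simp
    have Yb: "?Y (b i) = g (X (b i))" if "i < 2 * m" for i
      using U_mult_apply[OF gU X B.basis_closed[OF that]] .
    have fixed: "?Y (b i) = b i" if "i < j" for i using Yb g(2) that j by simp
    have "\<exists>g'\<in>generate U swaps. g' (?Y (b j)) = b j \<and> (\<forall>i<j. g' (b i) = b i)"
    proof (cases "even j")
      case True
      then obtain k where "j = 2 * k" by blast
      then show ?thesis using fix_next_even[OF Y, of k] fixed j by simp
    next
      case False
      then obtain k where "j = 2 * k + 1" by (rule oddE)
      then show ?thesis using fix_next_odd[OF Y, of k] fixed j by simp
    qed
    then obtain g' where g': "g' \<in> generate U swaps" "g' (?Y (b j)) = b j" "\<forall>i<j. g' (b i) = b i" by blast
    have g'U: "g' \<in> carrier U" using g' generated_in_U by blast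
    have "(g' \<otimes>\<^bsub>U\<^esub> g) (X (b i)) = b i" if "i < Suc j" for i
    proof -
      have i: "i < 2 * m" using that j by simp
      have "(g' \<otimes>\<^bsub>U\<^esub> g) (X (b i)) = g' (?Y (b i))"
        using U_mult_apply[OF g'U gU U_closed[OF X B.basis_closed[OF i]]] Yb[OF i] by simp
      then show ?thesis using g' fixed that by (cases "i = j") auto
    qed
    then show ?thesis using generate.eng[OF g'(1) g(1)] by blast
  qed
  have "\<exists>g\<in>generate U swaps. \<forall>i<j. g (X (b i)) = b i" if "j \<le> 2 * m" for j
    using that
  proof (induction j)
    case 0
    show ?case using generate.one by blast
  next
    case (Suc j)
    then show ?case using step[of _ j] by force
  qed
  then obtain g where g: "g \<in> generate U swaps" "\<forall>i<2 * m. g (X (b i)) = b i" by blast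
  have gU: "g \<in> carrier U" using g generated_in_U by blast
  have gX: "g \<otimes>\<^bsub>U\<^esub> X \<in> carrier U" using gU X by simp
  have "g \<otimes>\<^bsub>U\<^esub> X = \<one>\<^bsub>U\<^esub>"
  proof (rule U_eqI[OF gX U.one_closed])
    fix v assume v: "v \<in> carrier M"
    have "(g \<otimes>\<^bsub>U\<^esub> X) v = v"
    proof (rule B.linear_map_eqI[OF _ linear_map_ident _ v])
      show "linear_map R M M (g \<otimes>\<^bsub>U\<^esub> X)" using gX in_U_iff by blast
      show "(g \<otimes>\<^bsub>U\<^esub> X) (b i) = b i" if "i < 2 * m" for i
        using U_mult_apply[OF gU X B.basis_closed[OF that]] g that by simp
    qed
    then show "(g \<otimes>\<^bsub>U\<^esub> X) v = \<one>\<^bsub>U\<^esub> v" using v by (simp add: U_one)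
  qed
  then have "X = inv\<^bsub>U\<^esub> g" using gU X by (metis U.inv_equality U.inv_inv U.inv_closed)
  then show "X \<in> generate U swaps" using subgroup.m_inv_closed[OF sub g(1)] by simp
qed (rule generated_in_U)

end


section \<open>Local rings and their quotients\<close>

text \<open>Zorn's lemma for the ideals that contain \<open>a\<close> but not \<open>1\<close>; the principal ideal of \<open>a\<close> is one of them.\<close>

lemma (in cring) nonunit_in_maximalideal:
  assumes a: "a \<in> carrier R" "a \<notin> Units R"
  obtains M where "maximalideal M R" "a \<in> M"
proof -
  define A where "A = {J. ideal J R \<and> a \<in> J \<and> \<one> \<notin> J}"
  have P: "ideal (PIdl a) R" "a \<in> PIdl a"
    using a by (simp_all add: cgenideal_ideal cgenideal_self)
  have "\<one> \<notin> PIdl a"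
  proof
    assume "\<one> \<in> PIdl a"
    then obtain x where "x \<in> carrier R" "x \<otimes> a = \<one>" by (auto simp: cgenideal_def)
    then show False using a by (auto simp: Units_def m_comm)
  qed
  then have PA: "PIdl a \<in> A" using P by (simp add: A_def)
  have "\<exists>M\<in>A. \<forall>X\<in>A. M \<subseteq> X \<longrightarrow> X = M"
  proof (rule subset_Zorn_nonempty)
    show "A \<noteq> {}" using PA by blast
    fix C assume C: "C \<noteq> {}" "subset.chain A C"
    have "subset.chain {I. ideal I R} C" using C(2) by (auto simp: subset.chain_def A_def)
    then have "ideal (\<Union>C) R" using chain_Union_is_ideal[of C] C(1) by simp
    then show "\<Union>C \<in> A" using C by (auto simp: A_def subset.chain_def)
  qed
  then obtain M where M: "M \<in> A" "\<And>X. X \<in> A \<Longrightarrow> M \<subseteq> X \<Longrightarrow> X = M" by blast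
  have "maximalideal M R"
  proof (rule maximalidealI)
    show "ideal M R" using M(1) by (simp add: A_def)
    show "carrier R \<noteq> M" using M(1) by (auto simp: A_def)
    fix J assume J: "ideal J R" "M \<subseteq> J" "J \<subseteq> carrier R"
    show "J = M \<or> J = carrier R"
    proof (cases "\<one> \<in> J")
      case True
      then show ?thesis using ideal.one_imp_carrier[OF J(1)] by simp
    next
      case False
      then have "J \<in> A" using J M(1) by (auto simp: A_def)
      then show ?thesis using M(2) J(2) by blast
    qed
  qed
  moreover have "a \<in> M" using M(1) by (simp add: A_def)
  ultimately show ?thesis by (rule that)
qed

lemma (in ideal) unit_imp_carrier:
  assumes "u \<in> I" "u \<in> Units R"
  shows "I = carrier R"
  using I_l_closed[OF assms(1), of "inv u"] assms(2) one_imp_carrier by simp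

lemma local_cring_nonunits_ideal:
  fixes R (structure)
  assumes "local_cring R"
  shows "nonunits_ideal R"
proof -
  interpret cring R using assms by (simp add: local_cring_def)
  obtain M where M: "maximalideal M R" "\<And>M'. maximalideal M' R \<Longrightarrow> M' = M"
    using assms by (auto simp: local_cring_def)
  interpret M: maximalideal M R by (rule M(1))
  have nonunit: "a \<in> M" if a: "a \<in> carrier R" "a \<notin> Units R" for a
    using nonunit_in_maximalideal[OF a] M(2) by blast
  have unit: "a \<notin> M" if "a \<in> Units R" for a
    using M.unit_imp_carrier[OF _ that] M.I_notcarr by auto
  show ?thesis
  proof unfold_locales
    show "\<zero> \<notin> Units R" using unit M.zero_closed by blast
    fix a b assume ab: "a \<in> carrier R" "b \<in> carrier R" "a \<oplus> b \<in> Units R"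
    then show "a \<in> Units R \<or> b \<in> Units R"
      using nonunit[of a] nonunit[of b] M.a_closed[of a b] unit[of "a \<oplus> b"] by blast
  qed
qed

lemma (in ring_hom_cring) hom_Units: "a \<in> Units R \<Longrightarrow> h a \<in> Units S"
proof -
  assume a: "a \<in> Units R"
  then have "h (inv a) \<otimes>\<^bsub>S\<^esub> h a = \<one>\<^bsub>S\<^esub>" "h a \<otimes>\<^bsub>S\<^esub> h (inv a) = \<one>\<^bsub>S\<^esub>"
    by (simp_all add: R.Units_closed flip: hom_mult)
  moreover have "h a \<in> carrier S" "h (inv a) \<in> carrier S" using a by auto
  ultimately show ?thesis unfolding Units_def by blast
qed

lemma (in ring_hom_cring) hom_inv: "a \<in> Units R \<Longrightarrow> h (inv a) = inv\<^bsub>S\<^esub> h a"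
proof -
  assume a: "a \<in> Units R"
  then have "h a \<otimes>\<^bsub>S\<^esub> h (inv a) = \<one>\<^bsub>S\<^esub>" by (simp add: R.Units_closed flip: hom_mult)
  then show ?thesis using a by (intro S.comm_inv_char[symmetric]) auto
qed

locale proper_ideal_of_local_ring = nonunits_ideal R + ideal I R for R (structure) and I +
  assumes proper: "I \<noteq> carrier R"
begin

sublocale quot: ring_hom_cring R "R Quot I" "(+>\<^bsub>R\<^esub>) I"
  by (rule rcos_ring_hom_cring[OF is_cring])

lemma quot_eq_one_iff: "a \<in> carrier R \<Longrightarrow> I +> a = \<one>\<^bsub>R Quot I\<^esub> \<longleftrightarrow> a \<ominus> \<one> \<in> I"
  using coset_eq_iff[of a \<one>] by (simp flip: quot.hom_one)

text \<open>An inverse \<open>b\<close> of \<open>a\<close> modulo \<open>I\<close> makes \<open>a b\<close> differ from \<open>1\<close> by an element of \<open>I\<close>, which is not a unit.  So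
\<open>a b\<close> is a unit, and with it \<open>a\<close>.\<close>

lemma quot_Units_iff:
  assumes "a \<in> carrier R"
  shows "I +> a \<in> Units (R Quot I) \<longleftrightarrow> a \<in> Units R"
proof
  assume "I +> a \<in> Units (R Quot I)"
  then obtain B where B: "B \<in> carrier (R Quot I)" "(I +> a) \<otimes>\<^bsub>R Quot I\<^esub> B = \<one>\<^bsub>R Quot I\<^esub>"
    by (auto simp: Units_def)
  then obtain b where b: "b \<in> carrier R" "B = I +> b" unfolding FactRing_def A_RCOSETS_def' by auto
  have ab: "a \<otimes> b \<in> carrier R" using assms b by simp
  have "I +> (a \<otimes> b) = \<one>\<^bsub>R Quot I\<^esub>" using B b assms by simp
  then have "a \<otimes> b \<ominus> \<one> \<in> I" using quot_eq_one_iff ab by simp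
  then have i: "\<ominus> (a \<otimes> b \<ominus> \<one>) \<in> I" by (rule a_inv_closed)
  have "a \<otimes> b \<oplus> \<ominus> (a \<otimes> b \<ominus> \<one>) = \<one>" using ab by (simp add: minus_eq minus_add r_neg2)
  then have "a \<otimes> b \<in> Units R \<or> \<ominus> (a \<otimes> b \<ominus> \<one>) \<in> Units R"
    using unit_summand[of "a \<otimes> b" "\<ominus> (a \<otimes> b \<ominus> \<one>)"] ab by simp
  then have "a \<otimes> b \<in> Units R" using unit_imp_carrier[OF i] proper by blast
  then show "a \<in> Units R" using unit_factor assms b by blast
qed (rule quot.hom_Units)

lemma quot_nonunits_ideal: "nonunits_ideal (R Quot I)"
proof unfold_locales
  have "I +> \<zero> \<notin> Units (R Quot I)" using quot_Units_iff zero_not_unit by blast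
  then show "\<zero>\<^bsub>R Quot I\<^esub> \<notin> Units (R Quot I)" by simp
  fix A B assume "A \<in> carrier (R Quot I)" "B \<in> carrier (R Quot I)"
    and AB: "A \<oplus>\<^bsub>R Quot I\<^esub> B \<in> Units (R Quot I)"
  then obtain a b where ab: "a \<in> carrier R" "A = I +> a" "b \<in> carrier R" "B = I +> b"
    unfolding FactRing_def A_RCOSETS_def' by auto
  then show "A \<in> Units (R Quot I) \<or> B \<in> Units (R Quot I)"
    using AB unit_summand[of a b] quot_Units_iff by (simp flip: quot.hom_add)
qed

end


section \<open>Determinants of isometries\<close>

context skew_hermitian_module
begin

lemma h_lincomb_left:
  assumes "finite A" "c \<in> A \<rightarrow> carrier R" "v \<in> A \<rightarrow> carrier M" "y \<in> carrier M"
  shows "h (\<Oplus>\<^bsub>M\<^esub>i\<in>A. c i \<odot>\<^bsub>M\<^esub> v i) y = (\<Oplus>i\<in>A. star (c i) \<otimes> h (v i) y)"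
  using assms(1-3)
proof (induction A)
  case empty
  have "h \<zero>\<^bsub>M\<^esub> y = \<zero>" using h_smult_l[of \<zero> "\<zero>\<^bsub>M\<^esub>" y] assms(4) by simp
  then show ?case by simp
next
  case (insert a A)
  have 1: "(\<lambda>i. c i \<odot>\<^bsub>M\<^esub> v i) \<in> A \<rightarrow> carrier M" "(\<lambda>i. star (c i) \<otimes> h (v i) y) \<in> A \<rightarrow> carrier R"
    "c a \<in> carrier R" "v a \<in> carrier M"
    using insert.prems assms(4) by (auto simp: Pi_iff)
  have "h (\<Oplus>\<^bsub>M\<^esub>i\<in>A. c i \<odot>\<^bsub>M\<^esub> v i) y = (\<Oplus>i\<in>A. star (c i) \<otimes> h (v i) y)"
    using insert by (simp add: Pi_iff)
  then show ?case
    using insert.hyps 1 assms(4)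
    by (simp add: M.finsum_insert R.finsum_insert M.finsum_closed h_add_l h_smult_l)
qed

end

context symplectic_module
begin

lemma isometryI_basis:
  assumes X: "linear_map R M M X"
    and gram: "\<And>i j. i < 2 * m \<Longrightarrow> j < 2 * m \<Longrightarrow> h (X (b i)) (X (b j)) = h (b i) (b j)"
    and uv: "u \<in> carrier M" "v \<in> carrier M"
  shows "h (X u) (X v) = h u v"
proof -
  have Xb: "X (b i) \<in> carrier M" if "i < 2 * m" for i using linear_mapD(1)[OF X B.basis_closed[OF that]] .
  have Xb': "(\<lambda>i. X (b i)) \<in> {..<2 * m} \<rightarrow> carrier M" using Xb by auto
  let ?c = "coords R M (2 * m) b u" and ?d = "coords R M (2 * m) b v"
  have c: "?c \<in> {..<2 * m} \<rightarrow> carrier R" "?d \<in> {..<2 * m} \<rightarrow> carrier R" using B.coords_closed uv by auto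
  have Xu: "X u = (\<Oplus>\<^bsub>M\<^esub>i\<in>{..<2 * m}. ?c i \<odot>\<^bsub>M\<^esub> X (b i))"
    using linear_map_lincomb[OF module_axioms X _ c(1) B.basis_in] by (simp add: B.lincomb_coords uv)
  have Xv: "X v = (\<Oplus>\<^bsub>M\<^esub>i\<in>{..<2 * m}. ?d i \<odot>\<^bsub>M\<^esub> X (b i))"
    using linear_map_lincomb[OF module_axioms X _ c(2) B.basis_in] by (simp add: B.lincomb_coords uv)
  have right: "h (X (b i)) (X v) = h (b i) v" if i: "i < 2 * m" for i
  proof -
    have "h (X (b i)) (X v) = (\<Oplus>j\<in>{..<2 * m}. ?d j \<otimes> h (X (b i)) (X (b j)))"
      unfolding Xv using linear_functional_lincomb[OF module_axioms h_linear[OF Xb[OF i]] _ c(2) Xb'] by simp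
    also have "\<dots> = (\<Oplus>j\<in>{..<2 * m}. ?d j \<otimes> h (b i) (b j))"
      using gram[OF i] c B.basis_closed i by (intro R.finsum_cong' refl) (auto simp: Pi_iff)
    also have "\<dots> = h (b i) v"
      using linear_functional_lincomb[OF module_axioms h_linear[OF B.basis_closed[OF i]] _ c(2) B.basis_in]
      by (simp add: B.lincomb_coords uv)
    finally show ?thesis .
  qed
  have Xvc: "X v \<in> carrier M" using linear_mapD(1)[OF X uv(2)] .
  have "h (X u) (X v) = (\<Oplus>i\<in>{..<2 * m}. star (?c i) \<otimes> h (X (b i)) (X v))"
    unfolding Xu using h_lincomb_left[OF _ c(1) Xb' Xvc] by simp
  also have "\<dots> = (\<Oplus>i\<in>{..<2 * m}. star (?c i) \<otimes> h (b i) v)"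
    using right c B.basis_closed uv by (intro R.finsum_cong' refl) (auto simp: Pi_iff)
  also have "\<dots> = h u v"
    using h_lincomb_left[OF _ c(1) B.basis_in uv(2)] by (simp add: B.lincomb_coords uv)
  finally show ?thesis .
qed

lemma gram_in: "(\<lambda>i j. h (b i) (b j)) \<in> {..<2 * m} \<rightarrow> {..<2 * m} \<rightarrow> carrier R"
  using B.basis_closed by auto

lemma gram_sum:
  assumes "i < 2 * m" "f \<in> {..<2 * m} \<rightarrow> carrier R"
  shows "(\<Oplus>k\<in>{..<2 * m}. h (b i) (b k) \<otimes> f k) = (if even i then f (i + 1) else \<ominus> f (i - 1))"
proof (cases "even i")
  case True
  then obtain l where l: "i = 2 * l" by blast
  have "(\<Oplus>k\<in>{..<2 * m}. h (b i) (b k) \<otimes> f k) = (\<Oplus>k\<in>{..<2 * m}. if k = i + 1 then f k else \<zero>)"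
    using assms gram_even[of l] l by (intro R.finsum_cong' refl) (auto simp: Pi_iff)
  also have "\<dots> = f (i + 1)" using assms l by (intro R.add.finprod_singleton_swap) auto
  finally show ?thesis using True by simp
next
  case False
  then obtain l where l: "i = 2 * l + 1" by (rule oddE)
  have "(\<Oplus>k\<in>{..<2 * m}. h (b i) (b k) \<otimes> f k) = (\<Oplus>k\<in>{..<2 * m}. if k = i - 1 then \<ominus> f k else \<zero>)"
    using assms gram_odd[of l] l by (intro R.finsum_cong' refl) (auto simp: Pi_iff R.l_minus)
  also have "\<dots> = \<ominus> f (i - 1)"
    using assms l by (intro R.add.finprod_singleton_swap[of _ _ "\<lambda>k. \<ominus> f k"]) (auto simp: Pi_iff)
  finally show ?thesis using False by simp
qed

text \<open>The Gram matrix \<open>J\<close> of a symplectic basis satisfies \<open>J (- J) = 1\<close>.\<close>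

lemma gram_det_unit: "leibniz_det R (2 * m) (\<lambda>i j. h (b i) (b j)) \<in> Units R"
proof -
  let ?J = "\<lambda>i j. h (b i) (b j)"
  have N: "(\<lambda>i j. \<ominus> ?J i j) \<in> {..<2 * m} \<rightarrow> {..<2 * m} \<rightarrow> carrier R" using B.basis_closed by auto
  have "leibniz_det R (2 * m) ?J \<otimes> leibniz_det R (2 * m) (\<lambda>i j. \<ominus> ?J i j)
      = leibniz_det R (2 * m) (\<lambda>i j. \<Oplus>k\<in>{..<2 * m}. ?J i k \<otimes> \<ominus> ?J k j)"
    by (rule R.leibniz_det_mult[OF gram_in N, symmetric])
  also have "\<dots> = leibniz_det R (2 * m) (\<lambda>i j. if i = j then \<one> else \<zero>)"
  proof (rule R.leibniz_det_cong)
    fix i j assume ij: "i < 2 * m" "j < 2 * m"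
    have s: "(\<Oplus>k\<in>{..<2 * m}. ?J i k \<otimes> \<ominus> ?J k j) = (if even i then \<ominus> ?J (i + 1) j else \<ominus> (\<ominus> ?J (i - 1) j))"
      using gram_sum[OF ij(1), of "\<lambda>k. \<ominus> ?J k j"] B.basis_closed ij by auto
    show "(\<Oplus>k\<in>{..<2 * m}. ?J i k \<otimes> \<ominus> ?J k j) = (if i = j then \<one> else \<zero>)"
    proof (cases "even i")
      case True
      then obtain l where "i = 2 * l" by blast
      then show ?thesis unfolding s using gram_odd[of l j] ij by simp
    next
      case False
      then obtain l where "i = 2 * l + 1" by (rule oddE)
      then show ?thesis unfolding s using gram_even[of l j] ij by simp
    qed
  qed auto
  finally have "leibniz_det R (2 * m) ?J \<otimes> leibniz_det R (2 * m) (\<lambda>i j. \<ominus> ?J i j) = \<one>"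
    by (simp add: R.leibniz_det_one)
  then show ?thesis
    using R.unit_factor[OF _ R.leibniz_det_closed[OF gram_in] R.leibniz_det_closed[OF N]] by simp
qed

text \<open>If \<open>A\<close> is the matrix of \<open>X\<close>, the transpose of \<open>star A\<close> times \<open>J\<close> times \<open>A\<close> is \<open>J\<close>, for the Gram matrix \<open>J\<close>;
take determinants and cancel the unit \<open>det J\<close>.\<close>

lemma unitary_det:
  assumes X: "X \<in> carrier U"
  shows "star (endo_det R M (2 * m) X) \<otimes> endo_det R M (2 * m) X = \<one>"
proof -
  let ?n = "2 * m"
  let ?J = "\<lambda>i j. h (b i) (b j)"
  let ?A = "\<lambda>i j. coords R M ?n b (X (b j)) i"
  let ?B = "\<lambda>i k. star (?A k i)"
  have lin: "linear_map R M M X" using X by (simp add: in_U_iff)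
  have A: "?A \<in> {..<?n} \<rightarrow> {..<?n} \<rightarrow> carrier R" by (rule B.mat_closed[OF lin])
  have sA: "(\<lambda>i j. star (?A i j)) \<in> {..<?n} \<rightarrow> {..<?n} \<rightarrow> carrier R" using A by (auto simp: Pi_iff)
  have Bc: "?B \<in> {..<?n} \<rightarrow> {..<?n} \<rightarrow> carrier R" using A by (auto simp: Pi_iff)
  have BJ: "(\<lambda>i j. \<Oplus>k\<in>{..<?n}. ?B i k \<otimes> ?J k j) \<in> {..<?n} \<rightarrow> {..<?n} \<rightarrow> carrier R"
    using Bc gram_in by (auto intro!: R.finsum_closed simp: Pi_iff)
  have "leibniz_det R ?n ?J = leibniz_det R ?n (\<lambda>i j. \<Oplus>l\<in>{..<?n}. (\<Oplus>k\<in>{..<?n}. ?B i k \<otimes> ?J k l) \<otimes> ?A l j)"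
  proof (rule R.leibniz_det_cong)
    fix i j assume ij: "i < ?n" "j < ?n"
    have Xb: "X (b i) \<in> carrier M" "X (b j) \<in> carrier M" using U_closed[OF X B.basis_closed] ij by auto
    have c: "coords R M ?n b (X (b i)) \<in> {..<?n} \<rightarrow> carrier R" "coords R M ?n b (X (b j)) \<in> {..<?n} \<rightarrow> carrier R"
      using B.coords_closed Xb by auto
    have l: "h (X (b i)) (b l) = (\<Oplus>k\<in>{..<?n}. ?B i k \<otimes> ?J k l)" if "l < ?n" for l
      using h_lincomb_left[OF _ c(1) B.basis_in B.basis_closed[OF that]] by (simp add: B.lincomb_coords Xb)
    have "?J i j = h (X (b i)) (X (b j))" using U_isometry[OF X B.basis_closed B.basis_closed] ij by simp
    also have "\<dots> = (\<Oplus>l\<in>{..<?n}. ?A l j \<otimes> h (X (b i)) (b l))"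
      using linear_functional_lincomb[OF module_axioms h_linear[OF Xb(1)] _ c(2) B.basis_in]
      by (simp add: B.lincomb_coords Xb)
    also have "\<dots> = (\<Oplus>l\<in>{..<?n}. (\<Oplus>k\<in>{..<?n}. ?B i k \<otimes> ?J k l) \<otimes> ?A l j)"
    proof (intro R.finsum_cong' refl)
      fix k assume k: "k \<in> {..<?n}"
      then have "?A k j \<in> carrier R" "h (X (b i)) (b k) \<in> carrier R" using c Xb B.basis_closed by auto
      then show "?A k j \<otimes> h (X (b i)) (b k) = (\<Oplus>l\<in>{..<?n}. ?B i l \<otimes> ?J l k) \<otimes> ?A k j"
        using l[of k] k by (simp add: R.m_comm)
    qed (use BJ A ij in \<open>auto simp: Pi_iff\<close>)
    finally show "?J i j = (\<Oplus>l\<in>{..<?n}. (\<Oplus>k\<in>{..<?n}. ?B i k \<otimes> ?J k l) \<otimes> ?A l j)" .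
  qed (use BJ A in \<open>auto intro!: R.finsum_closed R.m_closed simp: Pi_iff\<close>)
  also have "\<dots> = (leibniz_det R ?n ?B \<otimes> leibniz_det R ?n ?J) \<otimes> leibniz_det R ?n ?A"
    by (simp only: R.leibniz_det_mult[OF BJ A] R.leibniz_det_mult[OF Bc gram_in])
  also have "leibniz_det R ?n ?B = star (leibniz_det R ?n ?A)"
    using R.leibniz_det_transpose[OF sA] star.hom_leibniz_det[OF A] by simp
  also have "leibniz_det R ?n ?A = endo_det R M ?n X" by (simp add: B.endo_det_eq[OF lin])
  finally have "leibniz_det R ?n ?J = leibniz_det R ?n ?J \<otimes> (star (endo_det R M ?n X) \<otimes> endo_det R M ?n X)"
    using B.endo_det_closed[OF lin] R.leibniz_det_closed[OF gram_in] by (simp add: R.m_ac)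
  then have "leibniz_det R ?n ?J \<otimes> \<one> = leibniz_det R ?n ?J \<otimes> (star (endo_det R M ?n X) \<otimes> endo_det R M ?n X)"
    using R.leibniz_det_closed[OF gram_in] by simp
  then show ?thesis
    using gram_det_unit B.endo_det_closed[OF lin] by simp
qed

definition diagonal_map :: "(nat \<Rightarrow> 'a) \<Rightarrow> 'c \<Rightarrow> 'c" where
  "diagonal_map d = (\<lambda>v\<in>carrier M. \<Oplus>\<^bsub>M\<^esub>i\<in>{..<2 * m}. (d i \<otimes> coords R M (2 * m) b v i) \<odot>\<^bsub>M\<^esub> b i)"

lemma diagonal_map_closed:
  "d \<in> {..<2 * m} \<rightarrow> carrier R \<Longrightarrow> v \<in> carrier M \<Longrightarrow> diagonal_map d v \<in> carrier M"
  using B.lincomb_closed[of "\<lambda>i. d i \<otimes> coords R M (2 * m) b v i"] B.coords_closed[of v]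
  by (simp add: diagonal_map_def Pi_iff)

lemma coords_diagonal_map:
  assumes "d \<in> {..<2 * m} \<rightarrow> carrier R" "v \<in> carrier M" "i < 2 * m"
  shows "coords R M (2 * m) b (diagonal_map d v) i = d i \<otimes> coords R M (2 * m) b v i"
  using B.coords_lincomb[of "\<lambda>i. d i \<otimes> coords R M (2 * m) b v i" i] B.coords_closed[of v] assms
  by (simp add: diagonal_map_def Pi_iff)

lemma eq_coordsI:
  assumes "u \<in> carrier M" "v \<in> carrier M"
    and "\<And>i. i < 2 * m \<Longrightarrow> coords R M (2 * m) b u i = coords R M (2 * m) b v i"
  shows "u = v"
proof -
  have "(\<Oplus>\<^bsub>M\<^esub>i\<in>{..<2 * m}. coords R M (2 * m) b u i \<odot>\<^bsub>M\<^esub> b i)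
      = (\<Oplus>\<^bsub>M\<^esub>i\<in>{..<2 * m}. coords R M (2 * m) b v i \<odot>\<^bsub>M\<^esub> b i)"
    using assms B.coords_closed B.basis_closed by (intro M.finsum_cong' refl) auto
  then show ?thesis by (simp add: B.lincomb_coords assms)
qed

lemma diagonal_map_linear:
  assumes d: "d \<in> {..<2 * m} \<rightarrow> carrier R"
  shows "linear_map R M M (diagonal_map d)"
  unfolding linear_map_def
proof (intro conjI ballI)
  have di: "d i \<in> carrier R" if "i < 2 * m" for i using d that by auto
  have lin: "linear_functional R M (\<lambda>x. coords R M (2 * m) b x i)" if "i < 2 * m" for i
    by (rule B.coords_linear[OF that])
  have ca: "coords R M (2 * m) b (x \<oplus>\<^bsub>M\<^esub> y) i = coords R M (2 * m) b x i \<oplus> coords R M (2 * m) b y i"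
    if "i < 2 * m" "x \<in> carrier M" "y \<in> carrier M" for i x y
    using lin[OF that(1)] that by (auto simp: linear_functional_def)
  have cs: "coords R M (2 * m) b (a \<odot>\<^bsub>M\<^esub> x) i = a \<otimes> coords R M (2 * m) b x i"
    if "i < 2 * m" "x \<in> carrier M" "a \<in> carrier R" for i x a
    using lin[OF that(1)] that by (auto simp: linear_functional_def)
  note cl = diagonal_map_closed[OF d]
  show "diagonal_map d \<in> carrier M \<rightarrow> carrier M" using cl by auto
  fix x assume x: "x \<in> carrier M"
  {
    fix y assume y: "y \<in> carrier M"
    show "diagonal_map d (x \<oplus>\<^bsub>M\<^esub> y) = diagonal_map d x \<oplus>\<^bsub>M\<^esub> diagonal_map d y"
    proof (rule eq_coordsI)
      fix i assume "i < 2 * m"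
      then show "coords R M (2 * m) b (diagonal_map d (x \<oplus>\<^bsub>M\<^esub> y)) i
        = coords R M (2 * m) b (diagonal_map d x \<oplus>\<^bsub>M\<^esub> diagonal_map d y) i"
        using x y cl d di B.coords_closed by (simp add: coords_diagonal_map ca R.r_distr)
    qed (use x y cl in auto)
  next
    fix a assume a: "a \<in> carrier R"
    show "diagonal_map d (a \<odot>\<^bsub>M\<^esub> x) = a \<odot>\<^bsub>M\<^esub> diagonal_map d x"
    proof (rule eq_coordsI)
      fix i assume "i < 2 * m"
      then show "coords R M (2 * m) b (diagonal_map d (a \<odot>\<^bsub>M\<^esub> x)) i
        = coords R M (2 * m) b (a \<odot>\<^bsub>M\<^esub> diagonal_map d x) i"
        using x a cl d di B.coords_closed by (simp add: coords_diagonal_map cs R.m_lcomm)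
    qed (use x a cl in auto)
  }
qed

lemma diagonal_map_basis:
  assumes d: "d \<in> {..<2 * m} \<rightarrow> carrier R" and j: "j < 2 * m"
  shows "diagonal_map d (b j) = d j \<odot>\<^bsub>M\<^esub> b j"
proof (rule eq_coordsI)
  fix i assume i: "i < 2 * m"
  have "coords R M (2 * m) b (d j \<odot>\<^bsub>M\<^esub> b j) i = d j \<otimes> coords R M (2 * m) b (b j) i"
    using B.coords_linear[OF i] Pi_mem[OF d, of j] j B.basis_closed[OF j] by (simp add: linear_functional_def)
  then show "coords R M (2 * m) b (diagonal_map d (b j)) i = coords R M (2 * m) b (d j \<odot>\<^bsub>M\<^esub> b j) i"
    using d i j B.basis_closed Pi_mem[OF d, of i] Pi_mem[OF d, of j]
    by (simp add: coords_diagonal_map B.coords_basis)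
qed (use d j B.basis_closed diagonal_map_closed in auto)

lemma diagonal_map_det:
  assumes d: "d \<in> {..<2 * m} \<rightarrow> carrier R"
  shows "endo_det R M (2 * m) (diagonal_map d) = (\<Otimes>i\<in>{..<2 * m}. d i)"
proof -
  have di: "d i \<in> carrier R" if "i < 2 * m" for i using d that by auto
  have "endo_det R M (2 * m) (diagonal_map d) = leibniz_det R (2 * m) (\<lambda>i j. if i = j then d i else \<zero>)"
    unfolding B.endo_det_eq[OF diagonal_map_linear[OF d]]
    using d di B.basis_closed
    by (intro R.leibniz_det_cong) (auto simp: coords_diagonal_map B.coords_basis)
  then show ?thesis using R.leibniz_det_diagonal[of "2 * m" d] di by simp
qed

text \<open>The entries \<open>x\<close> and \<open>inv (star x)\<close> at a hyperbolic pair cancel in the form, which is semilinear in the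
first variable, but not in the determinant.\<close>

lemma hyperbolic_scaling:
  assumes x: "x \<in> Units R" and m: "m \<ge> 1"
  defines "d \<equiv> (\<lambda>i::nat. if i = 0 then x else if i = 1 then inv (star x) else \<one>)"
  shows "diagonal_map d \<in> carrier U"
    and "endo_det R M (2 * m) (diagonal_map d) = x \<otimes> inv (star x)"
proof -
  have xs: "star x \<in> Units R" "x \<in> carrier R" "inv (star x) \<in> carrier R" "inv x \<in> carrier R"
    using x star_Units[OF x] by auto
  define e where "e = (\<lambda>i::nat. if i = 0 then inv x else if i = 1 then star x else \<one>)"
  have d: "d \<in> {..<2 * m} \<rightarrow> carrier R" and e: "e \<in> {..<2 * m} \<rightarrow> carrier R"
    using xs by (auto simp: d_def e_def)
  have de: "d i \<otimes> e i = \<one>" "e i \<otimes> d i = \<one>" for i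
    using x xs by (auto simp: d_def e_def)
  have cancel: "diagonal_map d (diagonal_map e v) = v" "diagonal_map e (diagonal_map d v) = v"
    if v: "v \<in> carrier M" for v
  proof -
    have c: "p \<otimes> (q \<otimes> r) = r" if "p \<otimes> q = \<one>" "p \<in> carrier R" "q \<in> carrier R" "r \<in> carrier R" for p q r
      using that by (simp flip: R.m_assoc)
    show "diagonal_map d (diagonal_map e v) = v"
      using v d e de B.coords_closed diagonal_map_closed
      by (intro eq_coordsI) (auto simp: coords_diagonal_map c Pi_iff)
    show "diagonal_map e (diagonal_map d v) = v"
      using v d e de B.coords_closed diagonal_map_closed
      by (intro eq_coordsI) (auto simp: coords_diagonal_map c Pi_iff)
  qed
  show "diagonal_map d \<in> carrier U"
  proof (rule in_U_I)
    show "diagonal_map d \<in> extensional (carrier M)" by (simp add: diagonal_map_def)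
    show lin: "linear_map R M M (diagonal_map d)" by (rule diagonal_map_linear[OF d])
    show "diagonal_map e v \<in> carrier M" if "v \<in> carrier M" for v by (rule diagonal_map_closed[OF e that])
    fix u v assume uv: "u \<in> carrier M" "v \<in> carrier M"
    show "h (diagonal_map d u) (diagonal_map d v) = h u v"
    proof (rule isometryI_basis[OF lin _ uv])
      fix i j assume ij: "i < 2 * m" "j < 2 * m"
      have dd: "d i \<in> carrier R" "d j \<in> carrier R" using d ij by auto
      have "h (diagonal_map d (b i)) (diagonal_map d (b j)) = d j \<otimes> (star (d i) \<otimes> h (b i) (b j))"
        using dd d ij B.basis_closed by (simp add: diagonal_map_basis h_smult_l h_smult_r)
      also have "\<dots> = h (b i) (b j)"
      proof (cases "even i")
        case True
        then obtain l where l: "i = 2 * l" by blast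
        show ?thesis
        proof (cases "j = i + 1")
          case True
          then show ?thesis using gram_even[of l j] ij l x xs by (cases "l = 0") (auto simp: d_def)
        next
          case False
          then show ?thesis using gram_even[of l j] ij l dd by simp
        qed
      next
        case False
        then obtain l where l: "i = 2 * l + 1" by (rule oddE)
        show ?thesis
        proof (cases "j = 2 * l")
          case True
          then show ?thesis using gram_odd[of l j] ij l x xs
            by (cases "l = 0") (auto simp: d_def star_inv R.r_minus)
        next
          case False
          then show ?thesis using gram_odd[of l j] ij l dd by simp
        qed
      qed
      finally show "h (diagonal_map d (b i)) (diagonal_map d (b j)) = h (b i) (b j)" .
    qed
  qed (use cancel in auto)
  have "(\<Otimes>i\<in>{..<2 * m}. d i) = (\<Otimes>i\<in>{0, 1}. d i)"
    using m d by (intro R.finprod_mono_neutral_cong_right) (auto simp: d_def)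
  also have "\<dots> = x \<otimes> inv (star x)" using xs by (simp add: d_def)
  finally show "endo_det R M (2 * m) (diagonal_map d) = x \<otimes> inv (star x)"
    by (simp add: diagonal_map_det[OF d])
qed

end


section \<open>Lifting isometries along reduction\<close>

locale symplectic_reduction =
  local_symplectic_module R M star h m b + module_mod_ideal R M I
  for R (structure) and M (structure) and star h m b I +
  assumes proper: "I \<noteq> carrier R"
    and star_ideal: "star ` I \<subseteq> I"
    and two_unit: "\<one> \<oplus> \<one> \<in> Units R"
begin

abbreviation star' where "star' \<equiv> quot_involution R I star"
abbreviation h' where "h' \<equiv> quot_form R I h"

sublocale proper_ideal_of_local_ring R I
  by unfold_locales (rule proper)

lemma star'_cls: "a \<in> carrier R \<Longrightarrow> star' (cls a) = cls (star a)"
  by (rule quot_involution_coset[OF involution I.ideal_axioms star_ideal])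

lemma h'_proj: "u \<in> carrier M \<Longrightarrow> v \<in> carrier M \<Longrightarrow> h' (proj u) (proj v) = cls (h u v)"
  by (rule quot_form_coset[OF module_axioms I.ideal_axioms star_ideal involution form])

lemma quot_involution: "ring_involution (R Quot I) star'"
proof -
  have hom: "star' \<in> ring_hom (R Quot I) (R Quot I)"
  proof (rule ring_hom_memI)
    fix A assume "A \<in> carrier (R Quot I)"
    then obtain a where a: "a \<in> carrier R" "A = cls a" by (metis cls_surj)
    then show "star' A \<in> carrier (R Quot I)" by (simp add: star'_cls)
    fix B assume "B \<in> carrier (R Quot I)"
    then obtain b where b: "b \<in> carrier R" "B = cls b" by (metis cls_surj)
    show "star' (A \<otimes>\<^bsub>R Quot I\<^esub> B) = star' A \<otimes>\<^bsub>R Quot I\<^esub> star' B"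
      using a b by (simp add: star'_cls flip: cls.hom_mult)
    show "star' (A \<oplus>\<^bsub>R Quot I\<^esub> B) = star' A \<oplus>\<^bsub>R Quot I\<^esub> star' B"
      using a b by (simp add: star'_cls flip: cls.hom_add)
  next
    show "star' \<one>\<^bsub>R Quot I\<^esub> = \<one>\<^bsub>R Quot I\<^esub>"
      by (simp add: star'_cls flip: cls.hom_one)
  qed
  have inv: "star' (star' A) = A" "star' A \<in> carrier (R Quot I)" if A: "A \<in> carrier (R Quot I)" for A
  proof -
    obtain a where a: "a \<in> carrier R" "A = cls a" using cls_surj[OF A] by metis
    then show "star' (star' A) = A" "star' A \<in> carrier (R Quot I)" by (simp_all add: star'_cls)
  qed
  have "bij_betw star' (carrier (R Quot I)) (carrier (R Quot I))"
    by (rule bij_betw_byWitness[of _ star']) (use inv in auto)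
  then show ?thesis using hom inv by (simp add: ring_involution_def ring_iso_def)
qed

lemma quot_symplectic: "symplectic_basis (R Quot I) Q h' m (\<lambda>i. proj (b i))"
proof -
  have b: "b i \<in> carrier M" if "i < 2 * m" for i using B.basis_closed[OF that] .
  have "h' (proj (b i)) (proj (b j)) = cls (h (b i) (b j))" if "i < 2 * m" "j < 2 * m" for i j
    using h'_proj b that by simp
  then show ?thesis
    using symplectic quot_basis[OF B.basis] unfolding symplectic_basis_def by simp
qed

sublocale bar: local_symplectic_module "R Quot I" Q star' h' m "\<lambda>i. proj (b i)"
proof -
  interpret nonunits_ideal "R Quot I" by (rule quot_nonunits_ideal)
  show "local_symplectic_module (R Quot I) Q star' h' m (\<lambda>i. proj (b i))"
    by unfold_locales
      (rule quot_involution quot_form_skew_hermitian[OF module_axioms I.ideal_axioms star_ideal involution form]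
        quot_symplectic)+
qed

lemma U_linear: "X \<in> carrier U \<Longrightarrow> linear_map R M M X"
  by (simp add: in_U_iff)

lemma reduction_proj: "X \<in> carrier U \<Longrightarrow> v \<in> carrier M \<Longrightarrow> reduction M I X (proj v) = proj (X v)"
  by (rule reduction_coset[OF module_axioms I.ideal_axioms U_linear])

lemma reduction_in_U:
  assumes X: "X \<in> carrier U"
  shows "reduction M I X \<in> carrier bar.U"
proof (rule bar.in_U_I)
  let ?Y = "inv\<^bsub>U\<^esub> X"
  have Y: "?Y \<in> carrier U" using X by simp
  have XY: "X (?Y v) = v" "?Y (X v) = v" if "v \<in> carrier M" for v
    using U_mult_apply[OF X Y that] U_mult_apply[OF Y X that] U.r_inv[OF X] U.l_inv[OF X] that
    by (simp_all add: U_one)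
  show "reduction M I X \<in> extensional (carrier Q)" by (simp add: reduction_def)
  show "linear_map (R Quot I) Q Q (reduction M I X)" by (rule linear_reduction[OF U_linear[OF X]])
  fix A assume "A \<in> carrier Q"
  then obtain v where v: "v \<in> carrier M" "A = proj v" by (metis proj_surj)
  then show "reduction M I ?Y A \<in> carrier Q" "reduction M I X (reduction M I ?Y A) = A"
    "reduction M I ?Y (reduction M I X A) = A"
    using XY U_closed[OF X] U_closed[OF Y] by (simp_all add: reduction_proj[OF X] reduction_proj[OF Y] proj_closed)
  fix B assume "B \<in> carrier Q"
  then obtain w where w: "w \<in> carrier M" "B = proj w" by (metis proj_surj)
  show "h' (reduction M I X A) (reduction M I X B) = h' A B"
    using v w U_closed[OF X] by (simp add: reduction_proj[OF X] h'_proj U_isometry[OF X])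
qed

lemma reduction_mult:
  assumes X: "X \<in> carrier U" and Y: "Y \<in> carrier U"
  shows "reduction M I (X \<otimes>\<^bsub>U\<^esub> Y) = reduction M I X \<otimes>\<^bsub>bar.U\<^esub> reduction M I Y"
proof (rule bar.U_eqI)
  show "reduction M I (X \<otimes>\<^bsub>U\<^esub> Y) \<in> carrier bar.U"
    "reduction M I X \<otimes>\<^bsub>bar.U\<^esub> reduction M I Y \<in> carrier bar.U"
    using X Y reduction_in_U by auto
  fix A assume A: "A \<in> carrier Q"
  then obtain v where v: "v \<in> carrier M" "A = proj v" by (metis proj_surj)
  show "reduction M I (X \<otimes>\<^bsub>U\<^esub> Y) A = (reduction M I X \<otimes>\<^bsub>bar.U\<^esub> reduction M I Y) A"
    using v A X Y bar.U_mult_apply[OF reduction_in_U[OF X] reduction_in_U[OF Y] A]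
      reduction_proj[of "X \<otimes>\<^bsub>U\<^esub> Y" v]
    by (simp add: reduction_proj U_closed U_mult_apply)
qed

lemma reduction_group_hom: "group_hom U bar.U (reduction M I)"
  using reduction_in_U reduction_mult
  by (intro group_hom.intro group_hom_axioms.intro U_group bar.U_group homI) auto

text \<open>The correction is \<open>t z\<close> with \<open>t = - h w w / 2\<close> and \<open>z\<close> isotropic with \<open>h w z = 1\<close>.  As \<open>h w w\<close> is
skew, both mixed terms contribute \<open>- h w w / 2\<close>; as \<open>z\<close> is isotropic, there is no quadratic term.\<close>

lemma isotropic_lift:
  assumes w: "w \<in> carrier M" and u: "u \<in> carrier M" and unit: "h w u \<in> Units R"
    and iso: "h w w \<in> I"
  obtains v where "v \<in> carrier M" "proj v = proj w" "h v v = \<zero>"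
proof -
  obtain i where i: "i < 2 * m" "h (b i) w \<in> Units R" using unit_coordinate[OF u w unit] by blast
  have bi: "b i \<in> carrier M" using B.basis_closed i by blast
  have c: "h w (b i) \<in> Units R" by (rule h_Units_swap[OF bi w i(2)])
  define z where "z = inv (h w (b i)) \<odot>\<^bsub>M\<^esub> b i"
  have z: "z \<in> carrier M" "h w z = \<one>" "h z z = \<zero>"
    using c bi w basis_isotropic[OF i(1)] by (simp_all add: z_def h_smult_r h_smult_l)
  have zw: "h z w = \<ominus> \<one>" using h_swap[OF w z(1)] z(2) by simp
  define half where "half = inv (\<one> \<oplus> \<one>)"
  have half: "half \<in> carrier R" "(\<one> \<oplus> \<one>) \<otimes> half = \<one>" "star half = half"
    using two_unit by (simp_all add: half_def star_inv)
  define a where "a = h w w"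
  have a: "a \<in> carrier R" "a \<in> I" "star a = \<ominus> a" using w iso by (simp_all add: a_def star_h)
  define t where "t = \<ominus> (half \<otimes> a)"
  have t: "t \<in> I" "t \<in> carrier R" using a half I.I_l_closed by (auto simp: t_def I.a_inv_closed)
  have st: "star t = half \<otimes> a" using a half by (simp add: t_def R.r_minus)
  have aa: "a = half \<otimes> a \<oplus> half \<otimes> a"
  proof -
    have "a = ((\<one> \<oplus> \<one>) \<otimes> half) \<otimes> a" using half a by simp
    also have "\<dots> = half \<otimes> a \<oplus> half \<otimes> a" using half(1) a by (simp add: R.l_distr)
    finally show ?thesis .
  qed
  let ?v = "w \<oplus>\<^bsub>M\<^esub> t \<odot>\<^bsub>M\<^esub> z"
  have "h ?v ?v = a \<oplus> t \<oplus> (star t \<otimes> (\<ominus> \<one>) \<oplus> t \<otimes> (star t \<otimes> \<zero>))"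
    using w z zw t by (simp add: h_add_l h_add_r h_smult_l h_smult_r a_def[symmetric] a R.a_ac)
  also have "\<dots> = a \<oplus> \<ominus> (half \<otimes> a \<oplus> half \<otimes> a)"
    using a half by (simp add: st t_def R.r_minus R.a_assoc R.minus_add)
  also have "\<dots> = \<zero>" using a by (simp add: aa[symmetric] R.r_neg)
  finally have "h ?v ?v = \<zero>" .
  moreover have "?v \<in> carrier M" using w z t by simp
  moreover have "proj ?v = proj w"
  proof -
    have "cls t = \<zero>\<^bsub>R Quot I\<^esub>"
      using t I.coset_eq_iff[of t \<zero>] by (simp add: R.minus_eq flip: cls.hom_zero)
    then show ?thesis using w z t by (simp add: proj_add proj_smult proj_closed)
  qed
  ultimately show ?thesis using that by blast
qed

text \<open>Any lifts pair to a unit, because units are detected modulo \<open>I\<close>; so the two vectors can be corrected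
to isotropic ones independently of each other.\<close>

lemma hyperbolic_lift:
  assumes "bar.hyperbolic A C"
  obtains u w where "hyperbolic u w" "A = proj u" "C = proj w"
proof -
  have AC: "A \<in> carrier Q" "C \<in> carrier Q" "h' A A = \<zero>\<^bsub>R Quot I\<^esub>" "h' C C = \<zero>\<^bsub>R Quot I\<^esub>"
    "h' A C \<in> Units (R Quot I)" using assms by (auto simp: bar.hyperbolic_def)
  obtain u0 where u0: "u0 \<in> carrier M" "A = proj u0" using proj_surj[OF AC(1)] .
  obtain w0 where w0: "w0 \<in> carrier M" "C = proj w0" using proj_surj[OF AC(2)] .
  have zero: "x \<in> I" if "x \<in> carrier R" "cls x = \<zero>\<^bsub>R Quot I\<^esub>" for x
    using that I.coset_eq_iff[of x \<zero>] by (simp add: R.minus_eq flip: cls.hom_zero)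
  have unit: "h u w \<in> Units R" if "u \<in> carrier M" "w \<in> carrier M" "A = proj u" "C = proj w" for u w
    using AC(5) that quot_Units_iff[of "h u w"] by (simp add: h'_proj)
  have iso: "h u0 u0 \<in> I" "h w0 w0 \<in> I" using AC u0 w0 zero by (auto simp: h'_proj)
  have un: "h u0 w0 \<in> Units R" using unit u0 w0 by blast
  obtain u where u: "u \<in> carrier M" "proj u = proj u0" "h u u = \<zero>"
    using isotropic_lift[OF u0(1) w0(1) un iso(1)] .
  obtain w where w: "w \<in> carrier M" "proj w = proj w0" "h w w = \<zero>"
    using isotropic_lift[OF w0(1) u0(1) h_Units_swap[OF u0(1) w0(1) un] iso(2)] .
  have "hyperbolic u w" using u w unit[of u w] u0 w0 by (simp add: hyperbolic_def)
  then show ?thesis using that u w u0 w0 by metis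
qed

lemma reduction_swap:
  assumes uw: "hyperbolic u w"
  shows "reduction M I (swap u w) = bar.swap (proj u) (proj w)"
proof -
  have c: "u \<in> carrier M" "w \<in> carrier M" "h u w \<in> Units R" "star (h u w) \<in> Units R"
    using uw star_Units by (auto simp: hyperbolic_def)
  have hyp: "bar.hyperbolic (proj u) (proj w)"
    using uw quot_Units_iff by (simp add: hyperbolic_def bar.hyperbolic_def proj_closed h'_proj)
  let ?q = "\<ominus> (inv (star (h u w)))" and ?x = "w \<ominus>\<^bsub>M\<^esub> u"
  have qx: "?q \<in> carrier R" "?x \<in> carrier M" using c by auto
  have px: "proj ?x = proj w \<ominus>\<^bsub>Q\<^esub> proj u"
  proof -
    have "?x = w \<oplus>\<^bsub>M\<^esub> (\<ominus> \<one>) \<odot>\<^bsub>M\<^esub> u" using c by (simp add: M.minus_eq smult_l_minus)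
    then show ?thesis
      using c by (simp add: proj_add proj_smult proj_closed Q.M.minus_eq Q.smult_l_minus)
  qed
  have cq: "cls ?q = \<ominus>\<^bsub>R Quot I\<^esub> (inv\<^bsub>R Quot I\<^esub> (star' (h' (proj u) (proj w))))"
    using c by (simp add: h'_proj star'_cls cls.hom_inv)
  show ?thesis
  proof (rule bar.U_eqI)
    show "reduction M I (swap u w) \<in> carrier bar.U" by (rule reduction_in_U[OF swap_in_U[OF uw]])
    show "bar.swap (proj u) (proj w) \<in> carrier bar.U" by (rule bar.swap_in_U[OF hyp])
    fix A assume "A \<in> carrier Q"
    then obtain v where v: "v \<in> carrier M" "A = proj v" by (metis proj_surj)
    have "reduction M I (swap u w) A = proj (v \<oplus>\<^bsub>M\<^esub> (?q \<otimes> h ?x v) \<odot>\<^bsub>M\<^esub> ?x)"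
      unfolding v(2) reduction_proj[OF swap_in_U[OF uw] v(1)]
      using v by (simp add: swap_def quasi_reflection_apply)
    also have "\<dots> = A \<oplus>\<^bsub>Q\<^esub> (cls ?q \<otimes>\<^bsub>R Quot I\<^esub> h' (proj ?x) A) \<odot>\<^bsub>Q\<^esub> proj ?x"
      using v qx by (simp add: proj_add proj_smult h'_proj del: cls.hom_a_inv)
    also have "\<dots> = bar.swap (proj u) (proj w) A"
      using v proj_closed by (simp only: cq px bar.swap_def bar.quasi_reflection_apply)
    finally show "reduction M I (swap u w) A = bar.swap (proj u) (proj w) A" .
  qed
qed

text \<open>The image is a subgroup that contains the generators \<open>swap A C\<close>, since these are reductions of swaps.\<close>

theorem reduction_unitary_surj:
  assumes "Y \<in> carrier bar.U"
  obtains X where "X \<in> carrier U" "reduction M I X = Y"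
proof -
  interpret group_hom U bar.U "reduction M I" by (rule reduction_group_hom)
  have "bar.swaps \<subseteq> reduction M I ` carrier U"
  proof
    fix T assume "T \<in> bar.swaps"
    then obtain A C where T: "T = bar.swap A C" "bar.hyperbolic A C" by blast
    then obtain u w where uw: "hyperbolic u w" "A = proj u" "C = proj w" using hyperbolic_lift by metis
    then have "T = reduction M I (swap u w)" using T reduction_swap by simp
    then show "T \<in> reduction M I ` carrier U" using swap_in_U[OF uw(1)] by blast
  qed
  then have "generate bar.U bar.swaps \<subseteq> reduction M I ` carrier U"
    by (rule bar.U.generate_subgroup_incl[OF _ img_is_subgroup])
  then have "Y \<in> reduction M I ` carrier U"
    using assms bar.unitary_group_generated_by_swaps by blast
  then show ?thesis using that by blast
qed

text \<open>As \<open>d\<close> has norm \<open>1\<close>, it is a quotient \<open>star x / x\<close> in the spirit of Hilbert's theorem 90.  The choice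
\<open>x = (1 + star d) / 2\<close> is congruent to \<open>1\<close>, so that the scaling by \<open>x\<close> reduces to the identity.\<close>

lemma determinant_correction:
  assumes X: "X \<in> carrier U" and m: "m \<ge> 1"
    and det: "endo_det (R Quot I) Q (2 * m) (reduction M I X) = \<one>\<^bsub>R Quot I\<^esub>"
  obtains D where "D \<in> carrier U" "reduction M I D = \<one>\<^bsub>bar.U\<^esub>"
    "endo_det R M (2 * m) (X \<otimes>\<^bsub>U\<^esub> D) = \<one>"
proof -
  let ?d = "endo_det R M (2 * m) X"
  have d: "?d \<in> carrier R" by (rule B.endo_det_closed[OF U_linear[OF X]])
  have cd: "cls ?d = \<one>\<^bsub>R Quot I\<^esub>"
    using endo_det_reduction[OF B.basis U_linear[OF X]] det by simp
  have csd: "cls (star ?d) = \<one>\<^bsub>R Quot I\<^esub>"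
    using star'_cls[OF d] cd by simp
  have dd: "star ?d \<otimes> ?d = \<one>" by (rule unitary_det[OF X])
  define half where "half = inv (\<one> \<oplus> \<one>)"
  have half: "half \<in> carrier R" "half \<otimes> (\<one> \<oplus> \<one>) = \<one>" "star half = half"
    using two_unit by (simp_all add: half_def star_inv)
  define x where "x = half \<otimes> (\<one> \<oplus> star ?d)"
  have xc: "x \<in> carrier R" using half d by (simp add: x_def)
  have "cls x = cls half \<otimes>\<^bsub>R Quot I\<^esub> (\<one>\<^bsub>R Quot I\<^esub> \<oplus>\<^bsub>R Quot I\<^esub> \<one>\<^bsub>R Quot I\<^esub>)"
    using half d csd by (simp add: x_def)
  also have "\<dots> = cls (half \<otimes> (\<one> \<oplus> \<one>))" using half(1) by simp
  finally have cx: "cls x = \<one>\<^bsub>R Quot I\<^esub>" using half by simp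
  have x: "x \<in> Units R" using quot_Units_iff[OF xc] cx by simp
  have sx: "star x \<in> Units R" by (rule star_Units[OF x])
  have dx: "?d \<otimes> x = star x"
  proof -
    have "?d \<otimes> x = half \<otimes> (?d \<oplus> star ?d \<otimes> ?d)"
      using half d by (simp add: x_def R.r_distr R.m_ac)
    also have "\<dots> = half \<otimes> (\<one> \<oplus> ?d)" using dd d by (simp add: R.a_comm)
    also have "\<dots> = star x" using half d by (simp add: x_def)
    finally show ?thesis .
  qed
  define e where "e = (\<lambda>i::nat. if i = 0 then x else if i = 1 then inv (star x) else \<one>)"
  let ?D = "diagonal_map e"
  have D: "?D \<in> carrier U" and Ddet: "endo_det R M (2 * m) ?D = x \<otimes> inv (star x)"
    using hyperbolic_scaling[OF x m] by (simp_all add: e_def)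
  have ec: "e i \<in> carrier R" "cls (e i) = \<one>\<^bsub>R Quot I\<^esub>" for i
  proof -
    have "cls (star x) = \<one>\<^bsub>R Quot I\<^esub>" using star'_cls[OF xc] cx by simp
    then show "cls (e i) = \<one>\<^bsub>R Quot I\<^esub>" using cx sx by (simp add: e_def cls.hom_inv)
  qed (use xc sx in \<open>auto simp: e_def\<close>)
  have "reduction M I ?D = \<one>\<^bsub>bar.U\<^esub>"
  proof (rule bar.U_eqI[OF reduction_in_U[OF D] bar.U.one_closed])
    fix A assume A: "A \<in> carrier Q"
    then obtain v where v: "v \<in> carrier M" "A = proj v" by (metis proj_surj)
    let ?c = "coords R M (2 * m) b v"
    have c: "?c \<in> {..<2 * m} \<rightarrow> carrier R" using B.coords_closed v by auto
    have ce: "(\<lambda>i. e i \<otimes> ?c i) \<in> {..<2 * m} \<rightarrow> carrier R" using c ec by auto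
    have "reduction M I ?D A = proj (\<Oplus>\<^bsub>M\<^esub>i\<in>{..<2 * m}. (e i \<otimes> ?c i) \<odot>\<^bsub>M\<^esub> b i)"
      unfolding v(2) reduction_proj[OF D v(1)] using v by (simp add: diagonal_map_def)
    also have "\<dots> = (\<Oplus>\<^bsub>Q\<^esub>i\<in>{..<2 * m}. cls (e i \<otimes> ?c i) \<odot>\<^bsub>Q\<^esub> proj (b i))"
      by (rule proj_lincomb[OF _ ce B.basis_in]) simp
    also have "\<dots> = (\<Oplus>\<^bsub>Q\<^esub>i\<in>{..<2 * m}. cls (?c i) \<odot>\<^bsub>Q\<^esub> proj (b i))"
      using c ec B.basis_closed by (intro Q.M.finsum_cong' refl) (auto simp: Pi_iff proj_closed)
    also have "\<dots> = A"
      using proj_lincomb[OF _ c B.basis_in] v by (simp add: B.lincomb_coords)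
    finally show "reduction M I ?D A = \<one>\<^bsub>bar.U\<^esub> A" using A by (simp add: bar.U_one)
  qed
  moreover have "endo_det R M (2 * m) (X \<otimes>\<^bsub>U\<^esub> ?D) = ?d \<otimes> (x \<otimes> inv (star x))"
    using B.endo_det_comp[OF U_linear[OF X] U_linear[OF D] U_linear[of "X \<otimes>\<^bsub>U\<^esub> ?D"]] X D
    by (simp add: U_mult_apply Ddet)
  then have "endo_det R M (2 * m) (X \<otimes>\<^bsub>U\<^esub> ?D) = \<one>"
    using dx d xc sx by (simp flip: R.m_assoc)
  ultimately show ?thesis using that D by blast
qed

theorem reduction_special_unitary_epi:
  assumes m: "m \<ge> 1"
  shows "reduction M I \<in> epi (special_unitary_group R M (2 * m) h)
    (special_unitary_group (R Quot I) Q (2 * m) h')"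
proof -
  let ?SU = "special_unitary_group R M (2 * m) h" and ?SU' = "special_unitary_group (R Quot I) Q (2 * m) h'"
  have SU: "X \<in> carrier ?SU \<longleftrightarrow> X \<in> carrier U \<and> endo_det R M (2 * m) X = \<one>" for X
    by (simp add: special_unitary_group_def)
  have SU': "Y \<in> carrier ?SU' \<longleftrightarrow> Y \<in> carrier bar.U \<and> endo_det (R Quot I) Q (2 * m) Y = \<one>\<^bsub>R Quot I\<^esub>" for Y
    by (simp add: special_unitary_group_def)
  have mult: "monoid.mult ?SU = monoid.mult U" "monoid.mult ?SU' = monoid.mult bar.U" by (simp_all add: special_unitary_group_def)
  have "reduction M I \<in> hom ?SU ?SU'"
  proof (rule homI)
    fix X assume X: "X \<in> carrier ?SU"
    then show "reduction M I X \<in> carrier ?SU'"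
      using endo_det_reduction[OF B.basis U_linear, of X] reduction_in_U[of X]
      by (simp add: SU SU')
    fix Y assume "Y \<in> carrier ?SU"
    then show "reduction M I (X \<otimes>\<^bsub>?SU\<^esub> Y) = reduction M I X \<otimes>\<^bsub>?SU'\<^esub> reduction M I Y"
      using X reduction_mult by (simp add: SU mult)
  qed
  moreover have "carrier ?SU' \<subseteq> reduction M I ` carrier ?SU"
  proof
    fix Y assume Y: "Y \<in> carrier ?SU'"
    then obtain X where X: "X \<in> carrier U" "reduction M I X = Y"
      using reduction_unitary_surj SU' by metis
    obtain D where D: "D \<in> carrier U" "reduction M I D = \<one>\<^bsub>bar.U\<^esub>"
      "endo_det R M (2 * m) (X \<otimes>\<^bsub>U\<^esub> D) = \<one>"
      using determinant_correction[OF X(1) m] X Y SU' by metis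
    have "reduction M I (X \<otimes>\<^bsub>U\<^esub> D) = Y"
      using reduction_mult[OF X(1) D(1)] D(2) X(2) Y by (simp add: SU')
    moreover have "X \<otimes>\<^bsub>U\<^esub> D \<in> carrier ?SU" using X D by (simp add: SU)
    ultimately show "Y \<in> reduction M I ` carrier ?SU" by blast
  qed
  ultimately show ?thesis by (simp add: epi_iff_subset)
qed

end

theorem theorem10p2:
  fixes S :: "('a, 'c) ring_scheme" and star :: "'a \<Rightarrow> 'a"
    and V :: "('a, 'v, 'd) module_scheme" and h :: "'v \<Rightarrow> 'v \<Rightarrow> 'a"
    and I :: "'a set" and m :: nat
  assumes "local_cring S"
    and "ring_involution S star"
    and "m \<ge> 1"
    and "free_of_rank S V (2 * m)"
    and "skew_hermitian_form S star V h"
    and "nondegenerate_form S V h"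
    and "\<exists>b. symplectic_basis S V h m b"
    and "ideal I S" and "I \<noteq> carrier S" and "star ` I \<subseteq> I"
    and "\<one>\<^bsub>S\<^esub> \<oplus>\<^bsub>S\<^esub> \<one>\<^bsub>S\<^esub> \<in> Units S"
  shows "reduction V I \<in>
    epi (special_unitary_group S V (2 * m) h)
        (special_unitary_group (S Quot I) (quot_module V I) (2 * m) (quot_form S I h))"
proof -
  obtain b where b: "symplectic_basis S V h m b" using assms(7) by blast
  interpret Module.module S V using assms(4) by (simp add: free_of_rank_def)
  interpret ideal I S by fact
  interpret nonunits_ideal S using assms(1) by (rule local_cring_nonunits_ideal)
  interpret symplectic_reduction S V star h m b I
    using assms b by unfold_locales
  show ?thesis using assms(3) by (rule reduction_special_unitary_epi)
qed

end
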